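(* Let $m\in\mathbb R$, $0\le\delta<\rho\le1$, and let $\sigma\in BS^m_{\rho,\delta}(\mathbb R^n)$. Let $\sigma^{*1},\sigma^{*2}$ be the symbols of the transposes of $T_\sigma$, i.e. $T_\sigma^{*j}=T_{\sigma^{*j}}$ for $j=1,2$. Then $\sigma^{*1}$ and $\sigma^{*2}$ have the asymptotic expansions $$\sigma^{*1}\sim\sum_\alpha\frac{i^{|\alpha|}}{\alpha!}\partial_x^\alpha\partial_\xi^\alpha\big(\sigma(x,-\xi-\eta,\eta)\big)\qquad\text{and}\qquad \sigma^{*2}\sim\sum_\alpha\frac{i^{|\alpha|}}{\alpha!}\partial_x^\alpha\partial_\eta^\alpha\big(\sigma(x,\xi,-\xi-\eta)\big),$$ where $\alpha$ runs over all multi-indices. More precisely, if $N\in\mathbb N$ then $$\sigma^{*1}-\sum_{|\alpha|<N}\frac{i^{|\alpha|}}{\alpha!}\partial_x^\alpha\partial_\xi^\alpha\big(\sigma(x,-\xi-\eta,\eta)\big)\in BS^{m+(\delta-\rho)N}_{\rho,\delta}$$ and $$\sigma^{*2}-\sum_{|\alpha|<N}\frac{i^{|\alpha|}}{\alpha!}\partial_x^\alpha\partial_\eta^\alpha\big(\sigma(x,\xi,-\xi-\eta)\big)\in BS^{m+(\delta-\rho)N}_{\rho,\delta}.$$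
   Context: For $m\in\mathbb R$ and $\rho,\delta\in[0,1]$, the bilinear Hörmander class $BS^m_{\rho,\delta}=BS^m_{\rho,\delta}(\mathbb R^n)$ is the set of all $C^\infty$ functions $\sigma$ on $\mathbb R^n\times\mathbb R^n\times\mathbb R^n$ such that for all multi-indices $\alpha,\beta,\gamma$ there is a constant $C_{\alpha\beta\gamma}>0$ with $$|\partial_x^\alpha\partial_\xi^\beta\partial_\eta^\gamma\sigma(x,\xi,\eta)|\le C_{\alpha\beta\gamma}(1+|\xi|+|\eta|)^{m+\delta|\alpha|-\rho(|\beta|+|\gamma|)}\quad\text{for all }x,\xi,\eta\in\mathbb R^n.$$ The associated bilinear pseudodifferential operator is, a priori for test functions $f,g$ (e.g. Schwartz functions), $$T_\sigma(f,g)(x)=\int_{\mathbb R^n}\int_{\mathbb R^n}\sigma(x,\xi,\eta)\widehat f(\xi)\widehat g(\eta)e^{ix\cdot(\xi+\eta)}\,d\xi\,d\eta,$$ with the Fourier transform normalized so that $f(x)=\int\widehat f(\xi)e^{ix\cdot\xi}\,d\xi$. The transposes $T^{*1},T^{*2}$ of a bilinear operator $T$ are defined by the duality relations $$\langle T(f,g),h\rangle=\langle T^{*1}(h,g),f\rangle=\langle T^{*2}(f,h),g\rangle,$$ where $\langle u,v\rangle=\int uv$ (no complex conjugation). For $\sigma\in BS^m_{\rho,\delta}$ with $0\le\delta\le\rho\le1$, $\delta<1$, it is known that $T_\sigma^{*j}=T_{\sigma^{*j}}$ with $\sigma^{*j}\in BS^m_{\rho,\delta}$, $j=1,2$. Asymptotic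 expansion: $\sigma\sim\sum_{j=0}^\infty\sigma_j$ means that there is a non-increasing sequence $m_N\searrow-\infty$ such that $\sigma-\sum_{j=0}^{N-1}\sigma_j\in BS^{m_N}_{\rho,\delta}$ for all $N>0$; for a sum over multi-indices $\alpha$, $\sigma_j$ is the sum of the terms with $|\alpha|=j$.
   Formalization: The derivatives of σ are taken first and then evaluated at (x,-ξ-η,η), resp. (x,ξ,-ξ-η); differentiating the composite with coefficient i^|α|/α!, as displayed, has wrong signs for odd |α| and is false, e.g. for n=1, σ=χ(x)ξ. *)

theory Defs
  imports "HOL-Analysis.Analysis"
begin

section \<open>Partial derivatives and smooth functions\<close>

definition dir_deriv ::
    "'a::real_normed_vector \<Rightarrow> ('a \<Rightarrow> 'b::real_normed_vector) \<Rightarrow> 'a \<Rightarrow> 'b"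
  where "dir_deriv v f x = vector_derivative (\<lambda>t. f (x + t *\<^sub>R v)) (at 0)"

text \<open>
  Smooth means \<open>C\<close>-infinity on the whole space: every iterated partial derivative, of order zero
  included, is differentiable in the sense of Frechet. In particular all of them exist and are
  continuous, and conversely a function whose iterated partial derivatives all exist and are
  continuous satisfies this condition.
\<close>

definition smooth :: "('a::euclidean_space \<Rightarrow> 'b::real_normed_vector) \<Rightarrow> bool"
  where "smooth f \<longleftrightarrow>
    (\<forall>bs. set bs \<subseteq> Basis \<longrightarrow> foldr dir_deriv bs f differentiable_on UNIV)"


section \<open>Multi-indices\<close>

type_synonym 'n multi_index = "'n \<Rightarrow> nat"

definition mi_abs :: "'n::finite multi_index \<Rightarrow> nat"
  where "mi_abs \<alpha> = (\<Sum>i\<in>UNIV. \<alpha> i)"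

definition mi_fact :: "'n::finite multi_index \<Rightarrow> nat"
  where "mi_fact \<alpha> = (\<Prod>i\<in>UNIV. fact (\<alpha> i))"

text \<open>Hence the sums over multi-indices of bounded order below range over finite sets.\<close>

lemma finite_mi_abs_less: "finite {\<alpha> :: 'n::finite multi_index. mi_abs \<alpha> < N}"
proof (rule finite_subset)
  have "\<alpha> i < N" if "mi_abs \<alpha> < N" for \<alpha> :: "'n multi_index" and i
    using that member_le_sum[of i UNIV \<alpha>] unfolding mi_abs_def by simp
  then show "{\<alpha> :: 'n multi_index. mi_abs \<alpha> < N} \<subseteq> PiE UNIV (\<lambda>_. {..<N})"
    by auto
  show "finite (PiE (UNIV :: 'n set) (\<lambda>_. {..<N}))" by (rule finite_PiE) auto
qed

lemma finite_mi_abs_eq: "finite {\<alpha> :: 'n::finite multi_index. mi_abs \<alpha> = j}"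
  by (rule finite_subset[OF _ finite_mi_abs_less[of "Suc j"]]) auto

text \<open>
  The index type carries no order, so the coordinates are processed in an arbitrary fixed order.
  On smooth functions the choice is immaterial, since partial derivatives commute there.
\<close>

definition coords :: "'n::finite list"
  where "coords = (SOME is. distinct is \<and> set is = UNIV)"

definition mi_deriv ::
    "'n::finite multi_index \<Rightarrow> (real^'n \<Rightarrow> complex) \<Rightarrow> real^'n \<Rightarrow> complex"
  where "mi_deriv \<alpha> = foldr (\<lambda>i. dir_deriv (axis i 1) ^^ \<alpha> i) coords"


section \<open>Bilinear symbols\<close>

type_synonym 'n bisymbol = "real^'n \<Rightarrow> real^'n \<Rightarrow> real^'n \<Rightarrow> complex"

definition deriv_x :: "'n::finite multi_index \<Rightarrow> 'n bisymbol \<Rightarrow> 'n bisymbol"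
  where "deriv_x \<alpha> \<sigma> = (\<lambda>x \<xi> \<eta>. mi_deriv \<alpha> (\<lambda>y. \<sigma> y \<xi> \<eta>) x)"

definition deriv_xi :: "'n::finite multi_index \<Rightarrow> 'n bisymbol \<Rightarrow> 'n bisymbol"
  where "deriv_xi \<beta> \<sigma> = (\<lambda>x \<xi> \<eta>. mi_deriv \<beta> (\<lambda>y. \<sigma> x y \<eta>) \<xi>)"

definition deriv_eta :: "'n::finite multi_index \<Rightarrow> 'n bisymbol \<Rightarrow> 'n bisymbol"
  where "deriv_eta \<gamma> \<sigma> = (\<lambda>x \<xi> \<eta>. mi_deriv \<gamma> (\<lambda>y. \<sigma> x \<xi> y) \<eta>)"

definition BS :: "real \<Rightarrow> real \<Rightarrow> real \<Rightarrow> 'n::finite bisymbol set"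
  where "BS m \<rho> \<delta> = {\<sigma>. smooth (\<lambda>(x, \<xi>, \<eta>). \<sigma> x \<xi> \<eta>) \<and>
    (\<forall>\<alpha> \<beta> \<gamma>. \<exists>C>0. \<forall>x \<xi> \<eta>.
      norm (deriv_x \<alpha> (deriv_xi \<beta> (deriv_eta \<gamma> \<sigma>)) x \<xi> \<eta>)
        \<le> C * (1 + norm \<xi> + norm \<eta>) powr
            (m + \<delta> * real (mi_abs \<alpha>) - \<rho> * real (mi_abs \<beta> + mi_abs \<gamma>)))}"

definition asymptotic_expansion ::
    "real \<Rightarrow> real \<Rightarrow> 'n::finite bisymbol \<Rightarrow> (nat \<Rightarrow> 'n bisymbol) \<Rightarrow> bool"
  where "asymptotic_expansion \<rho> \<delta> \<sigma> s \<longleftrightarrow>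
    (\<exists>M :: nat \<Rightarrow> real. decseq M \<and> filterlim M at_bot sequentially \<and>
      (\<forall>N>0. (\<lambda>x \<xi> \<eta>. \<sigma> x \<xi> \<eta> - (\<Sum>j<N. s j x \<xi> \<eta>)) \<in> BS (M N) \<rho> \<delta>))"


section \<open>Bilinear pseudodifferential operators and their transposes\<close>

definition schwartz :: "(real^'n::finite \<Rightarrow> complex) set"
  where "schwartz = {f. smooth f \<and>
    (\<forall>k \<alpha>. \<exists>C. \<forall>x. (1 + norm x) ^ k * norm (mi_deriv \<alpha> f x) \<le> C)}"

text \<open>
  The factor in front makes the inversion formula read
  \<open>f x = \<integral> fourier f \<xi> * exp (\<i> * (x \<bullet> \<xi>)) d\<xi>\<close>.
\<close>

definition fourier :: "(real^'n::finite \<Rightarrow> complex) \<Rightarrow> real^'n \<Rightarrow> complex"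
  where "fourier f \<xi> = complex_of_real (1 / (2 * pi) ^ CARD('n)) *
    (LINT x|lborel. f x * exp (- \<i> * complex_of_real (x \<bullet> \<xi>)))"

definition bilinear_op ::
    "'n::finite bisymbol \<Rightarrow> (real^'n \<Rightarrow> complex) \<Rightarrow> (real^'n \<Rightarrow> complex) \<Rightarrow> real^'n \<Rightarrow> complex"
  where "bilinear_op \<sigma> f g x =
    (LINT \<eta>|lborel. LINT \<xi>|lborel.
      \<sigma> x \<xi> \<eta> * fourier f \<xi> * fourier g \<eta> * exp (\<i> * complex_of_real (x \<bullet> (\<xi> + \<eta>))))"

definition pairing :: "(real^'n::finite \<Rightarrow> complex) \<Rightarrow> (real^'n \<Rightarrow> complex) \<Rightarrow> complex"
  where "pairing u v = (LINT x|lborel. u x * v x)"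

text \<open>\<open>S\<close> is the first (second) transpose of \<open>T\<close>, both acting on Schwartz functions.\<close>

definition is_transpose1 ::
    "((real^'n::finite \<Rightarrow> complex) \<Rightarrow> (real^'n \<Rightarrow> complex) \<Rightarrow> real^'n \<Rightarrow> complex) \<Rightarrow>
     ((real^'n \<Rightarrow> complex) \<Rightarrow> (real^'n \<Rightarrow> complex) \<Rightarrow> real^'n \<Rightarrow> complex) \<Rightarrow> bool"
  where "is_transpose1 T S \<longleftrightarrow>
    (\<forall>f\<in>schwartz. \<forall>g\<in>schwartz. \<forall>h\<in>schwartz. pairing (T f g) h = pairing (S h g) f)"

definition is_transpose2 ::
    "((real^'n::finite \<Rightarrow> complex) \<Rightarrow> (real^'n \<Rightarrow> complex) \<Rightarrow> real^'n \<Rightarrow> complex) \<Rightarrow>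
     ((real^'n \<Rightarrow> complex) \<Rightarrow> (real^'n \<Rightarrow> complex) \<Rightarrow> real^'n \<Rightarrow> complex) \<Rightarrow> bool"
  where "is_transpose2 T S \<longleftrightarrow>
    (\<forall>f\<in>schwartz. \<forall>g\<in>schwartz. \<forall>h\<in>schwartz. pairing (T f g) h = pairing (S f h) g)"


section \<open>Terms of the transpose expansions\<close>

text \<open>
  The derivatives of \<open>\<sigma>\<close> are taken first and then evaluated at the point \<open>(x, - \<xi> - \<eta>, \<eta>)\<close>
  (respectively \<open>(x, \<xi>, - \<xi> - \<eta>)\<close>). Differentiating the composite function instead would
  multiply each term by \<open>(- 1) ^ mi_abs \<alpha>\<close> and would not give the expansion of the transpose:
  on the line, away from a cutoff in \<open>x\<close>, the symbol \<open>\<sigma> x \<xi> \<eta> = x * \<xi>\<close> gives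
  \<open>T (f, g) = - \<i> * x * f' * g\<close>, whose first transpose
  \<open>(h, g) \<mapsto> \<i> * (x * g * h)'\<close> has the symbol \<open>- x * (\<xi> + \<eta>) + \<i>\<close>.
\<close>

definition transpose1_term :: "'n::finite bisymbol \<Rightarrow> 'n multi_index \<Rightarrow> 'n bisymbol"
  where "transpose1_term \<sigma> \<alpha> = (\<lambda>x \<xi> \<eta>.
    \<i> ^ mi_abs \<alpha> / of_nat (mi_fact \<alpha>) * deriv_x \<alpha> (deriv_xi \<alpha> \<sigma>) x (- \<xi> - \<eta>) \<eta>)"

definition transpose2_term :: "'n::finite bisymbol \<Rightarrow> 'n multi_index \<Rightarrow> 'n bisymbol"
  where "transpose2_term \<sigma> \<alpha> = (\<lambda>x \<xi> \<eta>.
    \<i> ^ mi_abs \<alpha> / of_nat (mi_fact \<alpha>) * deriv_x \<alpha> (deriv_eta \<alpha> \<sigma>) x \<xi> (- \<xi> - \<eta>))"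

end

(*
  The symbol of the transpose lies in the symbol class by hypothesis. Landau's inequality,
  which bounds a first derivative by the function and its second derivative, therefore reduces
  the expansion to pointwise decay: the remainder after M terms, without its derivatives, must
  be O(X^(-T)), X = 1 + |xi| + |eta|, for every T once M is large.

  To see the symbol at a point (y, xi, eta), test the transposition identity with Gaussian wave
  packets: f of width 1/l and frequency -xi-eta, where l = X^k with delta < k < rho, and g and h
  of frequencies eta and xi, almost plane waves. The width of g tends to infinity; that of h is
  1/(q l) with q a large negative power of X. On the side of the transpose this gives the average
  of its symbol at (y + z/l, xi, eta) against the Gaussian exp(-|z|^2/2). On the other side expand
  the symbol in its frequency variable at -xi-eta: the error O(l^M X^(m - rho M)) beats the loss
  q^(-n) from the width of h when M is large, and in each term the frequency integral is a
  derivative of the Gaussian, so that integration by parts in z yields the average of the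
  corresponding term of the expansion. So the Gaussian averages of the remainder are small for
  l = X^k/j, j = 1, ..., J. A J-th finite difference in the x-direction has size
  O(X^(m - (k - delta) J)) and expresses the remainder itself through these averages.
*)
theory Submission
  imports Defs "HOL-Probability.Probability" "HOL-Combinatorics.Multiset_Permutations"
begin

section \<open>Calculus of smooth functions\<close>

text \<open>The exponent k, called \<open>\<kappa>\<close> below, is squeezed from both sides:
  Taylor expansion in frequency gains only if k < \<rho>, finite differences in x gain only if
  \<delta> < k. The midpoint serves, because \<delta> < \<rho>. The packet of h cannot be spread to
  a plane wave by a limit as that of g is: it supplies the only decay in the space variable z when
  the Taylor remainder is estimated. So its relative scale q stays positive, and q = X^(-Q) is fixed
  before M. Here Q depends only on the target decay, on m, and on a power of X lost when the
  frequency of h is frozen; M is then taken large enough to pay for q^(-n) = X^(n Q). Gaussians are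
  preferred to cutoffs because their Fourier transforms are explicit and all integrals converge
  absolutely. Derivatives are indexed by words of directions rather than by multi-indices: the
  factor 1/k! then comes straight from Taylor's formula, and a multinomial count of words turns it
  into 1/\<alpha>! only at the end.\<close>

lemma dir_deriv_eq:
  assumes "(f has_derivative f') (at x)"
  shows "dir_deriv v f x = f' v"
proof -
  have g: "((\<lambda>t. x + t *\<^sub>R v) has_derivative (\<lambda>t. t *\<^sub>R v)) (at (0::real))"
    by (auto intro!: derivative_eq_intros)
  have "((\<lambda>t. f (x + t *\<^sub>R v)) has_derivative (\<lambda>t. f' (t *\<^sub>R v))) (at (0::real))"
    using has_derivative_compose[OF g, of f f'] assms by simp
  moreover have "f' (t *\<^sub>R v) = t *\<^sub>R f' v" for t
    using linear_cmul[OF has_derivative_linear[OF assms]] .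
  ultimately show ?thesis
    by (simp add: dir_deriv_def has_vector_derivative_def vector_derivative_at)
qed

lemma smooth_differentiable: "smooth f \<Longrightarrow> f differentiable (at x)"
  unfolding smooth_def differentiable_on_def
  by (drule spec[of _ "[]"]) simp

lemma smooth_continuous: "smooth f \<Longrightarrow> continuous_on UNIV f"
  by (meson differentiable_imp_continuous_within continuous_at_imp_continuous_on smooth_differentiable)

text \<open>Since \<open>smooth\<close> quantifies over words of basis directions, a direct closure
  proof would need formulas for all iterated derivatives. A property that implies differentiability
  and survives one differentiation makes them unnecessary.\<close>

lemma smooth_coinduct:
  assumes "P f" and "\<And>f x. P f \<Longrightarrow> f differentiable (at x)"
    and "\<And>f b. P f \<Longrightarrow> b \<in> Basis \<Longrightarrow> P (dir_deriv b f)"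
  shows "smooth f"
proof -
  have "P (foldr dir_deriv bs f)" if "set bs \<subseteq> Basis" for bs
    using that by (induction bs) (auto intro: assms)
  then show ?thesis
    unfolding smooth_def differentiable_on_def using assms(2) by auto
qed

lemma smooth_dir_deriv_Basis:
  assumes "smooth f" "b \<in> Basis"
  shows "smooth (dir_deriv b f)"
  unfolding smooth_def
proof (intro allI impI)
  fix bs :: "'a list" assume "set bs \<subseteq> Basis"
  then have "foldr dir_deriv (bs @ [b]) f differentiable_on UNIV"
    using assms unfolding smooth_def by (metis (no_types) Un_subset_iff empty_set empty_subsetI insert_subset list.simps(15) set_append)
  then show "foldr dir_deriv bs (dir_deriv b f) differentiable_on UNIV" by simp
qed

lemma dir_deriv_expand:
  assumes "f differentiable (at x)"
  shows "dir_deriv v f x = (\<Sum>b\<in>Basis. (v \<bullet> b) *\<^sub>R dir_deriv b f x)"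
proof -
  obtain f' where f': "(f has_derivative f') (at x)"
    using assms unfolding differentiable_def by blast
  have "f' v = f' (\<Sum>b\<in>Basis. (v \<bullet> b) *\<^sub>R b)" by (simp add: euclidean_representation)
  also have "\<dots> = (\<Sum>b\<in>Basis. (v \<bullet> b) *\<^sub>R f' b)"
    using has_derivative_linear[OF f'] by (simp add: linear_sum linear_cmul)
  finally show ?thesis by (simp add: dir_deriv_eq[OF f'])
qed

lemma dir_deriv_add:
  assumes "f differentiable (at x)" "g differentiable (at x)"
  shows "dir_deriv v (\<lambda>x. f x + g x) x = dir_deriv v f x + dir_deriv v g x"
proof -
  obtain f' g' where "(f has_derivative f') (at x)" "(g has_derivative g') (at x)"
    using assms unfolding differentiable_def by blast
  then show ?thesis
    using dir_deriv_eq[OF has_derivative_add[of f f' "at x" g g'], of v] by (simp add: dir_deriv_eq)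
qed

lemma dir_deriv_bounded_linear:
  assumes "bounded_linear T" "f differentiable (at x)"
  shows "dir_deriv v (\<lambda>x. T (f x)) x = T (dir_deriv v f x)"
proof -
  obtain f' where "(f has_derivative f') (at x)"
    using assms unfolding differentiable_def by blast
  then show ?thesis
    using dir_deriv_eq[OF bounded_linear.has_derivative[OF assms(1), of f f' "at x"], of v] by (simp add: dir_deriv_eq)
qed

lemma smooth_add:
  assumes "smooth f" "smooth g"
  shows "smooth (\<lambda>x. f x + g x)"
proof (rule smooth_coinduct[where P="\<lambda>h. \<exists>f g. smooth f \<and> smooth g \<and> h = (\<lambda>x. f x + g x)"])
  fix h :: "'a \<Rightarrow> 'b" and b :: 'a
  assume "\<exists>f g. smooth f \<and> smooth g \<and> h = (\<lambda>x. f x + g x)" "b \<in> Basis"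
  then obtain f g where fg: "smooth f" "smooth g" "h = (\<lambda>x. f x + g x)" by auto
  have "dir_deriv b h = (\<lambda>x. dir_deriv b f x + dir_deriv b g x)"
    unfolding fg(3) by (intro ext dir_deriv_add smooth_differentiable fg)
  then show "\<exists>f g. smooth f \<and> smooth g \<and> dir_deriv b h = (\<lambda>x. f x + g x)"
    using fg \<open>b \<in> Basis\<close> smooth_dir_deriv_Basis by blast
next
  fix h :: "'a \<Rightarrow> 'b" and x assume "\<exists>f g. smooth f \<and> smooth g \<and> h = (\<lambda>x. f x + g x)"
  then obtain f g where "smooth f" "smooth g" "h = (\<lambda>x. f x + g x)" by auto
  then show "h differentiable (at x)" by (metis differentiable_add smooth_differentiable)
qed (use assms in blast)

lemma smooth_bounded_linear:
  fixes f :: "'a::euclidean_space \<Rightarrow> 'b::real_normed_vector" and T :: "'b \<Rightarrow> 'c::real_normed_vector"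
  assumes T: "bounded_linear T" and f: "smooth f"
  shows "smooth (\<lambda>x. T (f x))"
proof (rule smooth_coinduct[where P="\<lambda>h. \<exists>f. smooth f \<and> h = (\<lambda>x. T (f x))"])
  fix h :: "'a \<Rightarrow> 'c" and b :: 'a
  assume "\<exists>f. smooth f \<and> h = (\<lambda>x. T (f x))" "b \<in> Basis"
  then obtain f where f: "smooth f" "h = (\<lambda>x. T (f x))" by auto
  have "dir_deriv b h = (\<lambda>x. T (dir_deriv b f x))"
    unfolding f(2) by (intro ext dir_deriv_bounded_linear smooth_differentiable f T)
  then show "\<exists>f. smooth f \<and> dir_deriv b h = (\<lambda>x. T (f x))"
    using f \<open>b \<in> Basis\<close> smooth_dir_deriv_Basis by blast
next
  fix h :: "'a \<Rightarrow> 'c" and x assume "\<exists>f. smooth f \<and> h = (\<lambda>x. T (f x))"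
  then obtain f where f: "smooth f" "h = (\<lambda>x. T (f x))" by auto
  then obtain f' where "(f has_derivative f') (at x)"
    using smooth_differentiable unfolding differentiable_def by blast
  then show "h differentiable (at x)"
    unfolding f(2) differentiable_def using bounded_linear.has_derivative[OF T] by blast
qed (use f in blast)

lemma dir_deriv_const [simp]: "dir_deriv v (\<lambda>x. c) = (\<lambda>x. 0)"
  unfolding dir_deriv_def by auto

lemma smooth_const [simp]: "smooth (\<lambda>x. c)"
  by (rule smooth_coinduct[where P="\<lambda>h. \<exists>c. h = (\<lambda>x. c)"]) auto

lemma smooth_sum:
  assumes "\<And>i. i \<in> I \<Longrightarrow> smooth (f i)"
  shows "smooth (\<lambda>x. \<Sum>i\<in>I. f i x)"
proof (cases "finite I")
  case True
  then show ?thesis using assms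
    by (induction I) (auto intro: smooth_add)
qed simp

lemma differentiable_sum':
  assumes "\<And>i. i \<in> I \<Longrightarrow> f i differentiable (at x)"
  shows "(\<lambda>x. \<Sum>i\<in>I. f i x) differentiable (at x)"
proof (cases "finite I")
  case True
  then show ?thesis using assms
    by (induction I) auto
qed simp

lemma dir_deriv_sum:
  assumes "\<And>i. i \<in> I \<Longrightarrow> f i differentiable (at x)"
  shows "dir_deriv v (\<lambda>x. \<Sum>i\<in>I. f i x) x = (\<Sum>i\<in>I. dir_deriv v (f i) x)"
proof (cases "finite I")
  case True
  then show ?thesis using assms
  proof (induction I)
    case (insert i I)
    then show ?case
      using dir_deriv_add[of "f i" x "\<lambda>x. \<Sum>i\<in>I. f i x" v] differentiable_sum'[of I f x] by auto
  qed auto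
qed simp

text \<open>The definition of \<open>smooth\<close> speaks of basis directions only; an arbitrary
  direction is reached by linearity of the Frechet derivative.\<close>

lemma smooth_dir_deriv:
  assumes "smooth f"
  shows "smooth (dir_deriv v f)"
proof -
  have "dir_deriv v f = (\<lambda>x. \<Sum>b\<in>Basis. (v \<bullet> b) *\<^sub>R dir_deriv b f x)"
    by (intro ext dir_deriv_expand smooth_differentiable assms)
  moreover have "smooth (\<lambda>x. \<Sum>b\<in>Basis. (v \<bullet> b) *\<^sub>R dir_deriv b f x)"
    by (intro smooth_sum smooth_bounded_linear[OF bounded_linear_scaleR_right] smooth_dir_deriv_Basis assms)
  ultimately show ?thesis by simp
qed

lemma smooth_foldr_dir_deriv: "smooth f \<Longrightarrow> smooth (foldr dir_deriv vs f)"
  by (induction vs) (auto intro: smooth_dir_deriv)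

lemma smooth_funpow_dir_deriv: "smooth f \<Longrightarrow> smooth ((dir_deriv v ^^ k) f)"
  by (induction k) (auto intro: smooth_dir_deriv)

lemma dir_deriv_cmult:
  fixes f :: "'a::euclidean_space \<Rightarrow> complex"
  shows "smooth f \<Longrightarrow> dir_deriv v (\<lambda>x. c * f x) x = c * dir_deriv v f x"
  by (rule dir_deriv_bounded_linear[OF bounded_linear_mult_right]) (rule smooth_differentiable)

lemma smooth_cmult:
  fixes f :: "'a::euclidean_space \<Rightarrow> complex"
  shows "smooth f \<Longrightarrow> smooth (\<lambda>x. c * f x)"
  by (rule smooth_bounded_linear[OF bounded_linear_mult_right])

lemma foldr_dir_deriv_add:
  "smooth f \<Longrightarrow> smooth g \<Longrightarrow>
    foldr dir_deriv vs (\<lambda>x. f x + g x) = (\<lambda>x. foldr dir_deriv vs f x + foldr dir_deriv vs g x)"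
  by (induction vs) (auto intro!: ext dir_deriv_add smooth_differentiable smooth_foldr_dir_deriv)

lemma foldr_dir_deriv_cmult:
  fixes f :: "'a::euclidean_space \<Rightarrow> complex"
  shows "smooth f \<Longrightarrow> foldr dir_deriv vs (\<lambda>x. c * f x) = (\<lambda>x. c * foldr dir_deriv vs f x)"
  by (induction vs) (auto intro!: ext dir_deriv_cmult smooth_foldr_dir_deriv)

lemma dir_deriv_compose_affine:
  assumes L: "bounded_linear L" and f: "f differentiable (at (c + L x))"
  shows "dir_deriv v (\<lambda>x. f (c + L x)) x = dir_deriv (L v) f (c + L x)"
proof -
  obtain f' where f': "(f has_derivative f') (at (c + L x))"
    using f unfolding differentiable_def by blast
  have "((\<lambda>x. c + L x) has_derivative L) (at x)"
    using bounded_linear_imp_has_derivative[OF L] by (auto intro!: derivative_eq_intros)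
  from has_derivative_compose[OF this f'] have "((\<lambda>x. f (c + L x)) has_derivative (\<lambda>x. f' (L x))) (at x)" .
  then show ?thesis by (simp add: dir_deriv_eq f' dir_deriv_eq[OF f'])
qed

lemma smooth_compose_affine:
  fixes f :: "'a::euclidean_space \<Rightarrow> 'c::real_normed_vector" and L :: "'b::euclidean_space \<Rightarrow> 'a"
  assumes L: "bounded_linear L" and f: "smooth f"
  shows "smooth (\<lambda>x. f (c + L x))"
proof (rule smooth_coinduct[where P="\<lambda>h. \<exists>f. smooth f \<and> h = (\<lambda>x. f (c + L x))"])
  fix h :: "'b \<Rightarrow> 'c" and b :: 'b
  assume "\<exists>f. smooth f \<and> h = (\<lambda>x. f (c + L x))" "b \<in> Basis"
  then obtain f where f: "smooth f" "h = (\<lambda>x. f (c + L x))" by auto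
  have "dir_deriv b h = (\<lambda>x. dir_deriv (L b) f (c + L x))"
    unfolding f(2) by (intro ext dir_deriv_compose_affine smooth_differentiable f L)
  then show "\<exists>f. smooth f \<and> dir_deriv b h = (\<lambda>x. f (c + L x))"
    using f smooth_dir_deriv by blast
next
  fix h :: "'b \<Rightarrow> 'c" and x assume "\<exists>f. smooth f \<and> h = (\<lambda>x. f (c + L x))"
  then obtain f where f: "smooth f" "h = (\<lambda>x. f (c + L x))" by auto
  then obtain f' where f': "(f has_derivative f') (at (c + L x))"
    using smooth_differentiable unfolding differentiable_def by blast
  have "((\<lambda>x. c + L x) has_derivative L) (at x)"
    using bounded_linear_imp_has_derivative[OF L] by (auto intro!: derivative_eq_intros)
  from has_derivative_compose[OF this f'] show "h differentiable (at x)"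
    unfolding f(2) differentiable_def by blast
qed (use f in blast)

lemma foldr_dir_deriv_compose_affine:
  assumes L: "bounded_linear L" and f: "smooth f"
  shows "foldr dir_deriv vs (\<lambda>x. f (c + L x)) = (\<lambda>x. foldr dir_deriv (map L vs) f (c + L x))"
  by (induction vs)
    (auto intro!: ext dir_deriv_compose_affine[OF L] smooth_differentiable smooth_foldr_dir_deriv f)

lemma DERIV_along_line:
  fixes f :: "'a::euclidean_space \<Rightarrow> real"
  assumes "f differentiable (at (x + t *\<^sub>R v))"
  shows "((\<lambda>t. f (x + t *\<^sub>R v)) has_real_derivative dir_deriv v f (x + t *\<^sub>R v)) (at t)"
proof -
  obtain f' where f': "(f has_derivative f') (at (x + t *\<^sub>R v))"
    using assms unfolding differentiable_def by blast
  have g: "((\<lambda>t. x + t *\<^sub>R v) has_derivative (\<lambda>t. t *\<^sub>R v)) (at t)"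
    by (auto intro!: derivative_eq_intros)
  have "((\<lambda>t. f (x + t *\<^sub>R v)) has_derivative (\<lambda>t. f' (t *\<^sub>R v))) (at t)"
    using has_derivative_compose[OF g f'] .
  moreover have "f' (t *\<^sub>R v) = f' v * t" for t
    using linear_cmul[OF has_derivative_linear[OF f']] by simp
  ultimately show ?thesis
    by (simp add: dir_deriv_eq[OF f'] has_field_derivative_def)
qed

text \<open>Two applications of the mean value theorem, one per direction. The left-hand side of the
  equation is symmetric in \<open>a\<close> and \<open>b\<close>, which is what makes the two mixed
  derivatives comparable.\<close>

lemma mixed_difference_mvt:
  fixes f :: "'a::euclidean_space \<Rightarrow> real"
  assumes f: "smooth f" and h: "h > 0"
  shows "\<exists>s t. 0 < s \<and> s < h \<and> 0 < t \<and> t < h \<and>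
    f (x + h *\<^sub>R a + h *\<^sub>R b) - f (x + h *\<^sub>R a) - f (x + h *\<^sub>R b) + f x
      = h * h * dir_deriv b (dir_deriv a f) (x + s *\<^sub>R a + t *\<^sub>R b)"
proof -
  define u where "u s = f ((x + h *\<^sub>R b) + s *\<^sub>R a) - f (x + s *\<^sub>R a)" for s
  have u': "(u has_real_derivative (dir_deriv a f ((x + h *\<^sub>R b) + s *\<^sub>R a) - dir_deriv a f (x + s *\<^sub>R a))) (at s)" for s
    unfolding u_def by (intro DERIV_diff DERIV_along_line smooth_differentiable f)
  obtain s where s: "0 < s" "s < h"
    "u h - u 0 = h * (dir_deriv a f ((x + h *\<^sub>R b) + s *\<^sub>R a) - dir_deriv a f (x + s *\<^sub>R a))"
    using MVT2[OF h, of u, OF u'] by auto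
  define w where "w t = dir_deriv a f ((x + s *\<^sub>R a) + t *\<^sub>R b)" for t
  have w': "(w has_real_derivative dir_deriv b (dir_deriv a f) ((x + s *\<^sub>R a) + t *\<^sub>R b)) (at t)" for t
    unfolding w_def by (intro DERIV_along_line smooth_differentiable smooth_dir_deriv f)
  obtain t where t: "0 < t" "t < h" "w h - w 0 = h * dir_deriv b (dir_deriv a f) ((x + s *\<^sub>R a) + t *\<^sub>R b)"
    using MVT2[OF h, of w, OF w'] by auto
  have "u h - u 0 = h * h * dir_deriv b (dir_deriv a f) (x + s *\<^sub>R a + t *\<^sub>R b)"
    using s(3) t(3) by (simp add: w_def algebra_simps)
  moreover have "u h - u 0 = f (x + h *\<^sub>R a + h *\<^sub>R b) - f (x + h *\<^sub>R a) - f (x + h *\<^sub>R b) + f x"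
    by (simp add: u_def algebra_simps)
  ultimately show ?thesis using s t by auto
qed

text \<open>Applied in both orders, \<open>mixed_difference_mvt\<close> shows that the two mixed
  derivatives share a value at two points near \<open>x\<close>. If they differed at
  \<open>x\<close>, continuity would keep these values apart for a small step.\<close>

lemma dir_deriv_commute_real:
  fixes f :: "'a::euclidean_space \<Rightarrow> real"
  assumes f: "smooth f"
  shows "dir_deriv a (dir_deriv b f) x = dir_deriv b (dir_deriv a f) x"
proof (rule ccontr)
  let ?p = "dir_deriv a (dir_deriv b f)" and ?q = "dir_deriv b (dir_deriv a f)"
  assume "?p x \<noteq> ?q x"
  define e where "e = \<bar>?p x - ?q x\<bar> / 2"
  have e: "e > 0" using \<open>?p x \<noteq> ?q x\<close> by (simp add: e_def)
  have cp: "isCont ?p x" "isCont ?q x"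
    using smooth_continuous[OF smooth_dir_deriv[OF smooth_dir_deriv[OF f]]]
    by (auto simp: continuous_on_eq_continuous_at)
  obtain d1 where d1: "d1 > 0" "\<And>y. dist y x < d1 \<Longrightarrow> dist (?p y) (?p x) < e"
    using cp(1) e unfolding continuous_at_eps_delta by blast
  obtain d2 where d2: "d2 > 0" "\<And>y. dist y x < d2 \<Longrightarrow> dist (?q y) (?q x) < e"
    using cp(2) e unfolding continuous_at_eps_delta by blast
  \<comment> \<open>For coefficients in (0, h) the displacement along \<open>a\<close> and
    \<open>b\<close> has norm at most \<open>h * N\<close>, so both intermediate points lie within
    both continuity radii.\<close>
  define N where "N = 1 + norm a + norm b"
  define h where "h = min d1 d2 / (2 * N)"
  have N: "N \<ge> 1" by (simp add: N_def)
  have h: "h > 0" using d1 d2 N by (simp add: h_def)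
  have hN: "h * N < min d1 d2"
  proof -
    have "h * N = min d1 d2 / 2" using N by (simp add: h_def)
    then show ?thesis using d1(1) d2(1) by (simp add: min_def split: if_splits)
  qed
  have near: "dist (x + s *\<^sub>R v + t *\<^sub>R w) x < min d1 d2"
    if "0 < s" "s < h" "0 < t" "t < h" "norm v + norm w \<le> N" for s t :: real and v w
  proof -
    have "dist (x + s *\<^sub>R v + t *\<^sub>R w) x \<le> s * norm v + t * norm w"
      using norm_triangle_ineq[of "s *\<^sub>R v" "t *\<^sub>R w"] that by (simp add: dist_norm add.assoc)
    also have "\<dots> \<le> h * norm v + h * norm w"
      using that by (intro add_mono mult_right_mono) auto
    also have "\<dots> = h * (norm v + norm w)" by (simp add: algebra_simps)
    also have "\<dots> \<le> h * N" using that h by (intro mult_left_mono) auto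
    finally show ?thesis using hN by simp
  qed
  obtain s t where st: "0 < s" "s < h" "0 < t" "t < h"
    "f (x + h *\<^sub>R a + h *\<^sub>R b) - f (x + h *\<^sub>R a) - f (x + h *\<^sub>R b) + f x = h * h * ?q (x + s *\<^sub>R a + t *\<^sub>R b)"
    using mixed_difference_mvt[OF f h, of x a b] by blast
  obtain s' t' where st': "0 < s'" "s' < h" "0 < t'" "t' < h"
    "f (x + h *\<^sub>R b + h *\<^sub>R a) - f (x + h *\<^sub>R b) - f (x + h *\<^sub>R a) + f x = h * h * ?p (x + s' *\<^sub>R b + t' *\<^sub>R a)"
    using mixed_difference_mvt[OF f h, of x b a] by blast
  have "h * h * ?q (x + s *\<^sub>R a + t *\<^sub>R b) = h * h * ?p (x + s' *\<^sub>R b + t' *\<^sub>R a)"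
    using st(5) st'(5) by (simp add: algebra_simps)
  then have eq: "?q (x + s *\<^sub>R a + t *\<^sub>R b) = ?p (x + s' *\<^sub>R b + t' *\<^sub>R a)" using h by simp
  have "dist (?q (x + s *\<^sub>R a + t *\<^sub>R b)) (?q x) < e"
    using d2(2) near[OF st(1-4), of a b] by (simp add: N_def)
  moreover have "dist (?p (x + s' *\<^sub>R b + t' *\<^sub>R a)) (?p x) < e"
    using d1(2) near[OF st'(1-4), of b a] by (simp add: N_def)
  ultimately show False using eq by (simp add: dist_real_def e_def field_simps abs_if split: if_splits)
qed

text \<open>The mean value theorem fails for complex values, hence the detour through real and
  imaginary parts, bounded linear maps that commute with \<open>dir_deriv\<close>.\<close>

lemma dir_deriv_commute:
  fixes f :: "'a::euclidean_space \<Rightarrow> complex"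
  assumes f: "smooth f"
  shows "dir_deriv a (dir_deriv b f) = dir_deriv b (dir_deriv a f)"
proof
  fix x
  have *: "dir_deriv a (dir_deriv b (\<lambda>x. T (f x))) x = T (dir_deriv a (dir_deriv b f) x)"
    if T: "bounded_linear T" for T :: "complex \<Rightarrow> real" and a b x
  proof -
    have "dir_deriv b (\<lambda>x. T (f x)) = (\<lambda>x. T (dir_deriv b f x))"
      by (intro ext dir_deriv_bounded_linear[OF T] smooth_differentiable f)
    then show ?thesis
      by (simp add: dir_deriv_bounded_linear[OF T] smooth_differentiable smooth_dir_deriv f)
  qed
  have "T (dir_deriv a (dir_deriv b f) x) = T (dir_deriv b (dir_deriv a f) x)"
    if T: "bounded_linear T" for T :: "complex \<Rightarrow> real"
    using dir_deriv_commute_real[OF smooth_bounded_linear[OF T f], of a b x] by (simp add: *[OF T])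
  from this[OF bounded_linear_Re] this[OF bounded_linear_Im]
  show "dir_deriv a (dir_deriv b f) x = dir_deriv b (dir_deriv a f) x"
    by (rule complex_eqI)
qed

lemma foldr_dir_deriv_remove1:
  fixes f :: "'a::euclidean_space \<Rightarrow> complex"
  assumes "smooth f" "v \<in> set vs"
  shows "foldr dir_deriv vs f = dir_deriv v (foldr dir_deriv (remove1 v vs) f)"
  using assms(2)
proof (induction vs)
  case (Cons u vs)
  show ?case
  proof (cases "u = v")
    case False
    then have "foldr dir_deriv vs f = dir_deriv v (foldr dir_deriv (remove1 v vs) f)"
      using Cons by auto
    then show ?thesis
      using False dir_deriv_commute[OF smooth_foldr_dir_deriv[OF assms(1)]] by simp
  qed simp
qed simp

text \<open>Because directional derivatives commute, a word of directions matters only as a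
  multiset. This sorts arbitrary words into standard form and, at the end, merges words with equal
  letter counts.\<close>

lemma foldr_dir_deriv_mset_cong:
  fixes f :: "'a::euclidean_space \<Rightarrow> complex"
  assumes "smooth f" "mset us = mset vs"
  shows "foldr dir_deriv us f = foldr dir_deriv vs f"
  using assms(2)
proof (induction us arbitrary: vs)
  case (Cons u us)
  have "u \<in> set vs" using Cons.prems by (metis list.set_intros(1) set_mset_mset)
  moreover have "mset us = mset (remove1 u vs)"
    using Cons.prems by (metis add_mset_remove_trivial mset.simps(2) mset_remove1)
  ultimately show ?case
    using Cons.IH[of "remove1 u vs"] foldr_dir_deriv_remove1[OF assms(1), of u vs] by (simp del: mset_remove1)
qed simp

text \<open>The real Maclaurin formula yields the complex estimate after a rotation that makes the
  remainder real and nonnegative. The factor 1/M! is dropped from the bound, since constants do not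
  matter for the symbol estimates.\<close>

lemma taylor_along_line:
  fixes f :: "'a::euclidean_space \<Rightarrow> complex" and x v :: 'a
  assumes f: "smooth f"
    and B: "\<And>t::real. 0 \<le> t \<Longrightarrow> t \<le> 1 \<Longrightarrow> norm ((dir_deriv v ^^ M) f (x + t *\<^sub>R v)) \<le> B"
  shows "norm (f (x + v) - (\<Sum>k<M. (dir_deriv v ^^ k) f x / fact k)) \<le> B"
proof (cases "M = 0")
  case True then show ?thesis using B[of 1] by simp
next
  case False
  define z where "z = f (x + v) - (\<Sum>k<M. (dir_deriv v ^^ k) f x / fact k)"
  \<comment> \<open>The rotation: \<open>c * z\<close> is the norm of \<open>z\<close>. For
    \<open>z = 0\<close> division by zero gives \<open>c = 0\<close>, which serves equally
    well.\<close>
  define c where "c = cnj z / of_real (norm z)"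
  have c: "norm c \<le> 1" by (simp add: c_def norm_divide)
  define T where "T = (\<lambda>w. Re (c * w))"
  have T: "bounded_linear T"
    unfolding T_def by (intro bounded_linear_compose[OF bounded_linear_Re] bounded_linear_mult_right)
  define D where "D = (\<lambda>k t. T ((dir_deriv v ^^ k) f (x + t *\<^sub>R v)))"
  have D': "DERIV (D k) t :> D (Suc k) t" for k t
  proof -
    have s: "smooth (\<lambda>y. T ((dir_deriv v ^^ k) f y))"
      by (intro smooth_bounded_linear[OF T] smooth_funpow_dir_deriv f)
    show ?thesis
      using DERIV_along_line[OF smooth_differentiable[OF s], of x v t]
      by (simp add: D_def dir_deriv_bounded_linear[OF T] smooth_differentiable smooth_funpow_dir_deriv f)
  qed
  obtain t where t: "0 < t" "t < 1" "D 0 1 = (\<Sum>k<M. D k 0 / fact k * 1 ^ k) + D M t / fact M * 1 ^ M"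
    using Maclaurin[of 1 M D "D 0"] False D' by auto
  have "c * z = of_real (norm z)"
  proof (cases "z = 0")
    case False
    have "c * z = (z * cnj z) / of_real (norm z)" by (simp add: c_def mult.commute)
    also have "\<dots> = of_real ((norm z)\<^sup>2) / of_real (norm z)" by (simp only: complex_norm_square)
    also have "\<dots> = of_real (norm z)" using False by (simp add: power2_eq_square)
    finally show ?thesis .
  qed (simp add: c_def)
  then have "norm z = T z" unfolding T_def by (metis Re_complex_of_real)
  also have "\<dots> = D 0 1 - (\<Sum>k<M. D k 0 / fact k)"
  proof -
    interpret T: bounded_linear T by (rule T)
    have "T (w / fact k) = T w / fact k" for w k
      using T.scaleR[of "1 / fact k" w] by (simp add: scaleR_conv_of_real field_simps)
    then show ?thesis by (simp add: z_def T.diff T.sum D_def)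
  qed
  also have "\<dots> = D M t / fact M" using t(3) by simp
  also have "\<dots> \<le> B"
  proof -
    have "\<bar>D M t\<bar> \<le> norm (c * (dir_deriv v ^^ M) f (x + t *\<^sub>R v))"
      unfolding D_def T_def by (rule abs_Re_le_cmod)
    also have "\<dots> \<le> 1 * norm ((dir_deriv v ^^ M) f (x + t *\<^sub>R v))"
      unfolding norm_mult by (rule mult_right_mono[OF c]) simp
    also have "\<dots> \<le> B" using B[of t] t by simp
    finally have "\<bar>D M t\<bar> \<le> B" .
    moreover have "\<bar>D M t\<bar> / fact M \<le> \<bar>D M t\<bar>"
      by (simp add: divide_le_eq mult_le_cancel_left1 fact_ge_1)
    moreover have "D M t / fact M \<le> \<bar>D M t\<bar> / fact M" by (intro divide_right_mono) auto
    ultimately show ?thesis by linarith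
  qed
  finally show ?thesis by (simp add: z_def)
qed

section \<open>Powers of a directional derivative as sums over words\<close>

lemma finite_words: "finite {w :: 'a::finite list. length w = k}"
  using finite_lists_length_eq[of "UNIV :: 'a set" k] by simp

lemma sum_lists_Suc:
  "(\<Sum>w | length w = Suc k. g w) = (\<Sum>i\<in>UNIV. \<Sum>w | length w = k. g (i # w))"
  for g :: "'a::finite list \<Rightarrow> 'b::comm_monoid_add"
proof -
  have "(\<Sum>i\<in>UNIV. \<Sum>w | length w = k. g (i # w)) = (\<Sum>(i, w)\<in>UNIV \<times> {w. length w = k}. g (i # w))"
    by (simp add: sum.cartesian_product)
  also have "\<dots> = (\<Sum>w | length w = Suc k. g w)"
  proof (rule sum.reindex_cong[of "\<lambda>w. (hd w, tl w)"])
    show "inj_on (\<lambda>w. (hd w, tl w)) {w :: 'a list. length w = Suc k}"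
      by (rule inj_onI) (metis (mono_tags, lifting) list.collapse list.size(3) mem_Collect_eq nat.distinct(1) prod.inject)
    show "UNIV \<times> {w. length w = k} = (\<lambda>w. (hd w, tl w)) ` {w :: 'a list. length w = Suc k}"
      by (force intro: image_eqI[of _ _ "_ # _"])
    fix w :: "'a list" assume "w \<in> {w. length w = Suc k}"
    then show "(case (hd w, tl w) of (i, w) \<Rightarrow> g (i # w)) = g w"
      by (cases w) auto
  qed
  finally show ?thesis ..
qed

text \<open>The multinomial expansion before equal terms are collected: each word occurs exactly
  once, so no coefficients have to be carried through the estimates.\<close>

lemma funpow_dir_deriv_words:
  fixes f :: "'a::euclidean_space \<Rightarrow> complex" and e :: "'n::finite \<Rightarrow> 'a"
  assumes f: "smooth f" and v: "v = (\<Sum>i\<in>UNIV. s i *\<^sub>R e i)"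
  shows "(dir_deriv v ^^ k) f x =
    (\<Sum>w | length w = k. of_real (prod_list (map s w)) * foldr dir_deriv (map e w) f x)"
proof (induction k arbitrary: x)
  case (Suc k)
  define g where "g w = (\<lambda>x. of_real (prod_list (map s w)) * foldr dir_deriv (map e w) f x)" for w
  have g: "smooth (g w)" for w
    unfolding g_def by (intro smooth_cmult smooth_foldr_dir_deriv f)
  have "(dir_deriv v ^^ k) f = (\<lambda>x. \<Sum>w | length w = k. g w x)"
    by (intro ext) (simp add: Suc g_def)
  then have "(dir_deriv v ^^ Suc k) f x = dir_deriv v (\<lambda>x. \<Sum>w | length w = k. g w x) x" by simp
  also have "\<dots> = (\<Sum>w | length w = k. dir_deriv v (g w) x)"
    by (intro dir_deriv_sum smooth_differentiable g)
  also have "\<dots> = (\<Sum>w | length w = k. \<Sum>i\<in>UNIV. s i *\<^sub>R dir_deriv (e i) (g w) x)"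
  proof (rule sum.cong[OF refl])
    fix w :: "'n list"
    obtain g' where g': "(g w has_derivative g') (at x)"
      using smooth_differentiable[OF g] unfolding differentiable_def by blast
    show "dir_deriv v (g w) x = (\<Sum>i\<in>UNIV. s i *\<^sub>R dir_deriv (e i) (g w) x)"
      using has_derivative_linear[OF g'] by (simp add: dir_deriv_eq[OF g'] v linear_sum linear_cmul)
  qed
  also have "\<dots> = (\<Sum>i\<in>UNIV. \<Sum>w | length w = k. s i *\<^sub>R dir_deriv (e i) (g w) x)"
    by (rule sum.swap)
  also have "\<dots> = (\<Sum>w | length w = Suc k. of_real (prod_list (map s w)) * foldr dir_deriv (map e w) f x)"
    unfolding sum_lists_Suc
    by (simp add: g_def dir_deriv_cmult smooth_foldr_dir_deriv f scaleR_conv_of_real mult.assoc)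
  finally show ?case .
qed auto

section \<open>Symbol classes on phase space\<close>

type_synonym 'n phase = "(real^'n) \<times> (real^'n) \<times> (real^'n)"

definition wt :: "'n::finite phase \<Rightarrow> real"
  where "wt p = 1 + norm (fst (snd p)) + norm (snd (snd p))"

text \<open>Total change of order caused by the derivatives of a word. The test on the first
  component is meaningful for directions that lie wholly in x or wholly in the frequencies, which
  includes all basis vectors.\<close>

definition word_order :: "real \<Rightarrow> real \<Rightarrow> 'n::finite phase list \<Rightarrow> real"
  where "word_order \<rho> \<delta> ws = (\<Sum>v\<leftarrow>ws. if fst v = 0 then - \<rho> else \<delta>)"

text \<open>The class \<open>BS\<close> on the product space: arbitrary words of basis directions
  replace three multi-indices in a fixed order, so derivatives and linear substitutions can be
  handled without reordering. The equivalence is \<open>BS_iff_symbol_class\<close>.\<close>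

definition symbol_class :: "real \<Rightarrow> real \<Rightarrow> real \<Rightarrow> ('n::finite phase \<Rightarrow> complex) set"
  where "symbol_class \<rho> \<delta> m = {F. smooth F \<and> (\<forall>ws. set ws \<subseteq> Basis \<longrightarrow>
    (\<exists>C. \<forall>p. norm (foldr dir_deriv ws F p) \<le> C * wt p powr (m + word_order \<rho> \<delta> ws)))}"

lemma wt_ge_1: "1 \<le> wt p" and wt_pos: "0 < wt p" and wt_nonneg: "0 \<le> wt p"
proof -
  show "1 \<le> wt p" by (simp add: wt_def)
  then show "0 < wt p" "0 \<le> wt p" by linarith+
qed

lemma word_order_simps [simp]:
  "word_order \<rho> \<delta> [] = 0"
  "word_order \<rho> \<delta> (v # ws) = (if fst v = 0 then - \<rho> else \<delta>) + word_order \<rho> \<delta> ws"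
  "word_order \<rho> \<delta> (us @ ws) = word_order \<rho> \<delta> us + word_order \<rho> \<delta> ws"
  by (simp_all add: word_order_def)

lemma symbol_class_smooth: "F \<in> symbol_class \<rho> \<delta> m \<Longrightarrow> smooth F"
  by (simp add: symbol_class_def)

lemma symbol_class_bound:
  fixes F :: "'n::finite phase \<Rightarrow> complex"
  assumes "F \<in> symbol_class \<rho> \<delta> m"
  obtains C where "C > 0" "\<And>p :: 'n::finite phase. norm (F p) \<le> C * wt p powr m"
proof -
  obtain C where C: "\<And>p. norm (F p) \<le> C * wt p powr m"
    using assms unfolding symbol_class_def mem_Collect_eq by (metis add.right_neutral empty_subsetI foldr.simps(1) id_apply list.set(1) word_order_simps(1))
  show ?thesis
  proof (rule that[of "\<bar>C\<bar> + 1"])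
    fix p :: "'n phase"
    have "C * wt p powr m \<le> (\<bar>C\<bar> + 1) * wt p powr m" by (intro mult_right_mono) auto
    then show "norm (F p) \<le> (\<bar>C\<bar> + 1) * wt p powr m" using C[of p] by linarith
  qed auto
qed

lemma symbol_class_mono:
  fixes F :: "'n::finite phase \<Rightarrow> complex"
  assumes F: "F \<in> symbol_class \<rho> \<delta> m" and le: "m \<le> m'"
  shows "F \<in> symbol_class \<rho> \<delta> m'"
  unfolding symbol_class_def mem_Collect_eq
proof (intro conjI allI impI)
  show "smooth F" using F by (rule symbol_class_smooth)
  fix ws :: "'n phase list" assume ws: "set ws \<subseteq> Basis"
  obtain C where C: "\<And>p. norm (foldr dir_deriv ws F p) \<le> C * wt p powr (m + word_order \<rho> \<delta> ws)"
    using F ws unfolding symbol_class_def by blast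
  show "\<exists>C. \<forall>p. norm (foldr dir_deriv ws F p) \<le> C * wt p powr (m' + word_order \<rho> \<delta> ws)"
  proof (intro exI allI)
    fix p :: "'n phase"
    have "C * wt p powr (m + word_order \<rho> \<delta> ws) \<le> \<bar>C\<bar> * wt p powr (m + word_order \<rho> \<delta> ws)"
      by (intro mult_right_mono) auto
    also have "\<dots> \<le> \<bar>C\<bar> * wt p powr (m' + word_order \<rho> \<delta> ws)"
      using le wt_ge_1[of p] by (intro mult_left_mono powr_mono) auto
    finally show "norm (foldr dir_deriv ws F p) \<le> \<bar>C\<bar> * wt p powr (m' + word_order \<rho> \<delta> ws)"
      using C[of p] by linarith
  qed
qed

lemma symbol_class_add:
  fixes F G :: "'n::finite phase \<Rightarrow> complex"
  assumes F: "F \<in> symbol_class \<rho> \<delta> m" and G: "G \<in> symbol_class \<rho> \<delta> m"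
  shows "(\<lambda>p. F p + G p) \<in> symbol_class \<rho> \<delta> m"
  unfolding symbol_class_def mem_Collect_eq
proof (intro conjI allI impI)
  have s: "smooth F" "smooth G" using F G by (auto intro: symbol_class_smooth)
  then show "smooth (\<lambda>p. F p + G p)" by (rule smooth_add)
  fix ws :: "'n phase list" assume ws: "set ws \<subseteq> Basis"
  obtain C where C: "\<And>p. norm (foldr dir_deriv ws F p) \<le> C * wt p powr (m + word_order \<rho> \<delta> ws)"
    using F ws unfolding symbol_class_def by blast
  obtain D where D: "\<And>p. norm (foldr dir_deriv ws G p) \<le> D * wt p powr (m + word_order \<rho> \<delta> ws)"
    using G ws unfolding symbol_class_def by blast
  have "norm (foldr dir_deriv ws (\<lambda>p. F p + G p) p) \<le> (C + D) * wt p powr (m + word_order \<rho> \<delta> ws)" for p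
    unfolding foldr_dir_deriv_add[OF s] using C[of p] D[of p] norm_triangle_ineq[of "foldr dir_deriv ws F p" "foldr dir_deriv ws G p"]
    by (simp add: distrib_right)
  then show "\<exists>C. \<forall>p. norm (foldr dir_deriv ws (\<lambda>p. F p + G p) p) \<le> C * wt p powr (m + word_order \<rho> \<delta> ws)"
    by blast
qed

lemma symbol_class_cmult:
  fixes F :: "'n::finite phase \<Rightarrow> complex"
  assumes F: "F \<in> symbol_class \<rho> \<delta> m"
  shows "(\<lambda>p. c * F p) \<in> symbol_class \<rho> \<delta> m"
  unfolding symbol_class_def mem_Collect_eq
proof (intro conjI allI impI)
  have s: "smooth F" using F by (auto intro: symbol_class_smooth)
  then show "smooth (\<lambda>p. c * F p)" by (rule smooth_cmult)
  fix ws :: "'n phase list" assume ws: "set ws \<subseteq> Basis"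
  obtain C where C: "\<And>p. norm (foldr dir_deriv ws F p) \<le> C * wt p powr (m + word_order \<rho> \<delta> ws)"
    using F ws unfolding symbol_class_def by blast
  have "norm (foldr dir_deriv ws (\<lambda>p. c * F p) p) \<le> (norm c * C) * wt p powr (m + word_order \<rho> \<delta> ws)" for p
    unfolding foldr_dir_deriv_cmult[OF s] norm_mult mult.assoc by (intro mult_left_mono C) auto
  then show "\<exists>C. \<forall>p. norm (foldr dir_deriv ws (\<lambda>p. c * F p) p) \<le> C * wt p powr (m + word_order \<rho> \<delta> ws)"
    by blast
qed

lemma foldr_dir_deriv_zero: "foldr dir_deriv ws (\<lambda>p. 0) = (\<lambda>p. 0)"
  by (induction ws) auto

lemma symbol_class_zero: "(\<lambda>p. 0) \<in> symbol_class \<rho> \<delta> m"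
  unfolding symbol_class_def mem_Collect_eq by (auto simp: foldr_dir_deriv_zero intro!: exI[of _ 0])

lemma symbol_class_sum:
  assumes "\<And>i. i \<in> I \<Longrightarrow> F i \<in> symbol_class \<rho> \<delta> m"
  shows "(\<lambda>p. \<Sum>i\<in>I. F i p) \<in> symbol_class \<rho> \<delta> m"
proof (cases "finite I")
  case True
  then show ?thesis using assms
    by (induction I) (auto intro: symbol_class_add symbol_class_zero)
qed (simp add: symbol_class_zero)

lemma symbol_class_dir_deriv_Basis:
  fixes F :: "'n::finite phase \<Rightarrow> complex"
  assumes F: "F \<in> symbol_class \<rho> \<delta> m" and b: "b \<in> Basis"
  shows "dir_deriv b F \<in> symbol_class \<rho> \<delta> (m + word_order \<rho> \<delta> [b])"
  unfolding symbol_class_def mem_Collect_eq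
proof (intro conjI allI impI)
  show "smooth (dir_deriv b F)" using F by (auto intro: symbol_class_smooth smooth_dir_deriv)
  fix ws :: "'n phase list" assume ws: "set ws \<subseteq> Basis"
  then have "set (ws @ [b]) \<subseteq> Basis" using b by auto
  then obtain C where C: "\<And>p. norm (foldr dir_deriv (ws @ [b]) F p) \<le> C * wt p powr (m + word_order \<rho> \<delta> (ws @ [b]))"
    using F unfolding symbol_class_def by blast
  show "\<exists>C. \<forall>p. norm (foldr dir_deriv ws (dir_deriv b F) p) \<le> C * wt p powr (m + word_order \<rho> \<delta> [b] + word_order \<rho> \<delta> ws)"
    by (rule exI[of _ C]) (use C in \<open>simp add: algebra_simps del: word_order_simps(2)\<close>)
qed

text \<open>A derivative in a mixed direction is a sum of terms of different orders; a definite
  order can be attributed only to the directions singled out here.\<close>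

definition pure :: "'n::finite phase \<Rightarrow> bool"
  where "pure v \<longleftrightarrow> fst v = 0 \<or> snd v = 0"

lemma pure_Basis: "b \<in> Basis \<Longrightarrow> pure b"
  by (auto simp: pure_def Basis_prod_def)

lemma symbol_class_dir_deriv:
  fixes F :: "'n::finite phase \<Rightarrow> complex"
  assumes F: "F \<in> symbol_class \<rho> \<delta> m" and v: "pure v"
  shows "dir_deriv v F \<in> symbol_class \<rho> \<delta> (m + word_order \<rho> \<delta> [v])"
proof -
  have "dir_deriv v F = (\<lambda>p. \<Sum>b\<in>Basis. (v \<bullet> b) *\<^sub>R dir_deriv b F p)"
    by (intro ext dir_deriv_expand smooth_differentiable symbol_class_smooth[OF F])
  moreover have "(\<lambda>p. \<Sum>b\<in>Basis. (v \<bullet> b) *\<^sub>R dir_deriv b F p) \<in> symbol_class \<rho> \<delta> (m + word_order \<rho> \<delta> [v])"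
  proof (rule symbol_class_sum)
    fix b :: "'n phase" assume b: "b \<in> Basis"
    show "(\<lambda>p. (v \<bullet> b) *\<^sub>R dir_deriv b F p) \<in> symbol_class \<rho> \<delta> (m + word_order \<rho> \<delta> [v])"
    proof (cases "v \<bullet> b = 0")
      case False
      \<comment> \<open>Purity enters here: the basis vectors that occur in \<open>v\<close> lie on
        the same side as \<open>v\<close>, hence all summands have one order.\<close>
      then have "fst v = 0 \<longleftrightarrow> fst b = 0"
        using v b nonzero_Basis by (cases v, cases b) (fastforce simp: pure_def Basis_prod_def zero_prod_def)
      then show ?thesis
        using symbol_class_cmult[OF symbol_class_dir_deriv_Basis[OF F b], of "of_real (v \<bullet> b)"]
        by (simp add: scaleR_conv_of_real)
    qed (simp add: symbol_class_zero)
  qed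
  ultimately show ?thesis by simp
qed

lemma symbol_class_foldr_dir_deriv:
  assumes F: "F \<in> symbol_class \<rho> \<delta> m" and ws: "\<forall>v\<in>set ws. pure v"
  shows "foldr dir_deriv ws F \<in> symbol_class \<rho> \<delta> (m + word_order \<rho> \<delta> ws)"
  using ws
proof (induction ws)
  case (Cons v ws)
  then have "dir_deriv v (foldr dir_deriv ws F) \<in> symbol_class \<rho> \<delta> (m + word_order \<rho> \<delta> ws + word_order \<rho> \<delta> [v])"
    by (intro symbol_class_dir_deriv) auto
  then show ?case by (simp add: add.assoc add.commute)
qed (use F in simp)

text \<open>Exponents of both signs occur as orders; hence the two-sided comparability of the bases
  and the absolute value in the constant.\<close>

lemma powr_comparable:
  fixes a b K q :: real
  assumes "0 < a" "0 < b" "1 \<le> K" "a \<le> K * b" "b \<le> K * a"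
  shows "a powr q \<le> K powr \<bar>q\<bar> * b powr q"
proof (cases "q \<ge> 0")
  case True
  have "a powr q \<le> (K * b) powr q" using assms True by (intro powr_mono2) auto
  then show ?thesis using True assms by (simp add: powr_mult)
next
  case False
  have "a powr q \<le> (b / K) powr q"
    using assms False by (intro powr_mono2') (auto simp: field_simps)
  also have "\<dots> = K powr \<bar>q\<bar> * b powr q"
    using False assms by (simp add: powr_divide powr_minus divide_simps)
  finally show ?thesis .
qed

text \<open>By the chain rule a linear substitution maps words to words. Orders are preserved if
  x-directions and frequency directions are kept apart, growth rates if the weights stay comparable.
  It is applied to \<open>flip1\<close> and to the exchange of the two frequencies.\<close>

lemma symbol_class_compose_linear:
  fixes F :: "'n::finite phase \<Rightarrow> complex" and L :: "'n phase \<Rightarrow> 'n phase"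
  assumes F: "F \<in> symbol_class \<rho> \<delta> m" and L: "bounded_linear L"
    and fib: "\<And>b. b \<in> Basis \<Longrightarrow> pure (L b) \<and> (fst (L b) = 0 \<longleftrightarrow> fst b = 0)"
    and K: "1 \<le> K" "\<And>p. wt (L p) \<le> K * wt p" "\<And>p. wt p \<le> K * wt (L p)"
  shows "(\<lambda>p. F (L p)) \<in> symbol_class \<rho> \<delta> m"
  unfolding symbol_class_def mem_Collect_eq
proof (intro conjI allI impI)
  have eq: "(\<lambda>p. F (L p)) = (\<lambda>p. F (0 + L p))" by simp
  have s: "smooth F" using F by (rule symbol_class_smooth)
  then show "smooth (\<lambda>p. F (L p))" unfolding eq by (rule smooth_compose_affine[OF L])
  fix ws :: "'n phase list" assume ws: "set ws \<subseteq> Basis"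
  have w: "word_order \<rho> \<delta> (map L ws) = word_order \<rho> \<delta> ws"
    using ws fib by (induction ws) auto
  have "\<forall>v\<in>set (map L ws). pure v" using ws fib by auto
  from symbol_class_bound[OF symbol_class_foldr_dir_deriv[OF F this]]
  obtain C where C: "C > 0" "\<And>p. norm (foldr dir_deriv (map L ws) F p) \<le> C * wt p powr (m + word_order \<rho> \<delta> ws)"
    unfolding w by blast
  show "\<exists>C. \<forall>p. norm (foldr dir_deriv ws (\<lambda>p. F (L p)) p) \<le> C * wt p powr (m + word_order \<rho> \<delta> ws)"
  proof (intro exI allI)
    fix p :: "'n phase"
    let ?q = "m + word_order \<rho> \<delta> ws"
    have "norm (foldr dir_deriv ws (\<lambda>p. F (L p)) p) \<le> C * wt (L p) powr ?q"
      unfolding eq foldr_dir_deriv_compose_affine[OF L s] using C(2)[of "L p"] by simp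
    also have "\<dots> \<le> C * (K powr \<bar>?q\<bar> * wt p powr ?q)"
      using C(1) by (intro mult_left_mono powr_comparable[OF wt_pos wt_pos K]) simp
    finally show "norm (foldr dir_deriv ws (\<lambda>p. F (L p)) p) \<le> (C * K powr \<bar>?q\<bar>) * wt p powr ?q"
      by (simp add: mult.assoc)
  qed
qed

section \<open>Multi-indices as words of directions\<close>

definition mi_word :: "'n::finite multi_index \<Rightarrow> (real^'n) list"
  where "mi_word \<alpha> = concat (map (\<lambda>i. replicate (\<alpha> i) (axis i 1)) coords)"

lemma coords_distinct: "distinct (coords :: 'n::finite list)" and set_coords: "set (coords :: 'n list) = UNIV"
proof -
  obtain xs :: "'n list" where "set xs = UNIV" "distinct xs"
    using finite_distinct_list[of "UNIV :: 'n set"] by auto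
  then have "distinct (coords :: 'n list) \<and> set (coords :: 'n list) = UNIV"
    unfolding coords_def by (intro someI[of "\<lambda>is. distinct is \<and> set is = UNIV"]) auto
  then show "distinct (coords :: 'n list)" "set (coords :: 'n list) = UNIV" by auto
qed

lemma mi_deriv_eq: "mi_deriv (\<alpha> :: 'n::finite multi_index) f = foldr dir_deriv (mi_word \<alpha>) f"
proof -
  have "foldr (\<lambda>i. dir_deriv (axis i 1) ^^ \<alpha> i) js f =
      foldr dir_deriv (concat (map (\<lambda>i. replicate (\<alpha> i) (axis i 1)) js)) f" for js :: "'n list"
    by (induction js) auto
  then show ?thesis by (simp add: mi_deriv_def mi_word_def)
qed

lemma mset_mi_word: "mset (mi_word \<alpha>) = (\<Sum>i\<in>UNIV. replicate_mset (\<alpha> i) (axis i 1))"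
proof -
  have "mset (mi_word \<alpha>) = (\<Sum>i\<leftarrow>coords. replicate_mset (\<alpha> i) (axis i 1))"
    unfolding mi_word_def mset_concat by (simp add: comp_def)
  then show ?thesis
    by (simp add: sum_list_distinct_conv_sum_set coords_distinct set_coords)
qed

lemma set_mi_word: "set (mi_word \<alpha>) \<subseteq> Basis"
  by (auto simp: mi_word_def Basis_vec_def)

lemma length_mi_word: "length (mi_word \<alpha>) = mi_abs \<alpha>"
proof -
  have "length (mi_word \<alpha>) = (\<Sum>i\<leftarrow>coords. \<alpha> i)"
    unfolding mi_word_def length_concat by (simp add: comp_def)
  then show ?thesis
    by (simp add: sum_list_distinct_conv_sum_set coords_distinct set_coords mi_abs_def)
qed

lemma mset_mi_word_update:
  "mset (mi_word (\<alpha>(i := Suc (\<alpha> i)))) = add_mset (axis i 1) (mset (mi_word \<alpha>))"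
  unfolding mset_mi_word by (simp add: sum.remove[of UNIV i])

definition uncurry3 :: "'n::finite bisymbol \<Rightarrow> 'n phase \<Rightarrow> complex"
  where "uncurry3 \<sigma> = (\<lambda>(x, \<xi>, \<eta>). \<sigma> x \<xi> \<eta>)"

definition in_x :: "real^'n::finite \<Rightarrow> 'n phase" where "in_x v = (v, 0, 0)"
definition in_xi :: "real^'n::finite \<Rightarrow> 'n phase" where "in_xi v = (0, v, 0)"
definition in_eta :: "real^'n::finite \<Rightarrow> 'n phase" where "in_eta v = (0, 0, v)"

lemma bounded_linear_in:
  "bounded_linear (in_x :: real^'n::finite \<Rightarrow> _)" "bounded_linear (in_xi :: real^'n \<Rightarrow> _)" "bounded_linear (in_eta :: real^'n \<Rightarrow> _)"
  unfolding in_x_def in_xi_def in_eta_def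
  by (auto intro!: bounded_linear_Pair bounded_linear_ident bounded_linear_zero)

text \<open>Fixing two of the three variables is composition with an affine embedding, so a
  derivative in one slot is a derivative of the uncurried symbol along the embedded axes.\<close>

lemma uncurry3_deriv:
  fixes \<sigma> :: "'n::finite bisymbol"
  assumes s: "smooth (uncurry3 \<sigma>)"
  shows "uncurry3 (deriv_x \<alpha> \<sigma>) = foldr dir_deriv (map in_x (mi_word \<alpha>)) (uncurry3 \<sigma>)"
    and "uncurry3 (deriv_xi \<alpha> \<sigma>) = foldr dir_deriv (map in_xi (mi_word \<alpha>)) (uncurry3 \<sigma>)"
    and "uncurry3 (deriv_eta \<alpha> \<sigma>) = foldr dir_deriv (map in_eta (mi_word \<alpha>)) (uncurry3 \<sigma>)"
proof -
  have "uncurry3 (deriv_x \<alpha> \<sigma>) (x, \<xi>, \<eta>) = foldr dir_deriv (map in_x (mi_word \<alpha>)) (uncurry3 \<sigma>) (x, \<xi>, \<eta>)" for x \<xi> \<eta>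
    using foldr_dir_deriv_compose_affine[OF bounded_linear_in(1) s, of "mi_word \<alpha>" "(0, \<xi>, \<eta>)"]
    by (simp add: uncurry3_def deriv_x_def mi_deriv_eq in_x_def)
  then show "uncurry3 (deriv_x \<alpha> \<sigma>) = foldr dir_deriv (map in_x (mi_word \<alpha>)) (uncurry3 \<sigma>)" by auto
  have "uncurry3 (deriv_xi \<alpha> \<sigma>) (x, \<xi>, \<eta>) = foldr dir_deriv (map in_xi (mi_word \<alpha>)) (uncurry3 \<sigma>) (x, \<xi>, \<eta>)" for x \<xi> \<eta>
    using foldr_dir_deriv_compose_affine[OF bounded_linear_in(2) s, of "mi_word \<alpha>" "(x, 0, \<eta>)"]
    by (simp add: uncurry3_def deriv_xi_def mi_deriv_eq in_xi_def)
  then show "uncurry3 (deriv_xi \<alpha> \<sigma>) = foldr dir_deriv (map in_xi (mi_word \<alpha>)) (uncurry3 \<sigma>)" by auto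
  have "uncurry3 (deriv_eta \<alpha> \<sigma>) (x, \<xi>, \<eta>) = foldr dir_deriv (map in_eta (mi_word \<alpha>)) (uncurry3 \<sigma>) (x, \<xi>, \<eta>)" for x \<xi> \<eta>
    using foldr_dir_deriv_compose_affine[OF bounded_linear_in(3) s, of "mi_word \<alpha>" "(x, \<xi>, 0)"]
    by (simp add: uncurry3_def deriv_eta_def mi_deriv_eq in_eta_def)
  then show "uncurry3 (deriv_eta \<alpha> \<sigma>) = foldr dir_deriv (map in_eta (mi_word \<alpha>)) (uncurry3 \<sigma>)" by auto
qed

definition standard_word :: "'n::finite multi_index \<Rightarrow> 'n multi_index \<Rightarrow> 'n multi_index \<Rightarrow> 'n phase list"
  where "standard_word \<alpha> \<beta> \<gamma> =
    map in_x (mi_word \<alpha>) @ map in_xi (mi_word \<beta>) @ map in_eta (mi_word \<gamma>)"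

lemma uncurry3_deriv_standard_word:
  assumes s: "smooth (uncurry3 \<sigma>)"
  shows "uncurry3 (deriv_x \<alpha> (deriv_xi \<beta> (deriv_eta \<gamma> \<sigma>))) = foldr dir_deriv (standard_word \<alpha> \<beta> \<gamma>) (uncurry3 \<sigma>)"
proof -
  have "smooth (uncurry3 (deriv_eta \<gamma> \<sigma>))" "smooth (uncurry3 (deriv_xi \<beta> (deriv_eta \<gamma> \<sigma>)))"
    using s by (simp_all add: uncurry3_deriv smooth_foldr_dir_deriv)
  then show ?thesis using s by (simp add: uncurry3_deriv standard_word_def)
qed

lemma word_order_standard_word:
  fixes \<alpha> \<beta> \<gamma> :: "'n::finite multi_index"
  shows "word_order \<rho> \<delta> (standard_word \<alpha> \<beta> \<gamma>) = \<delta> * real (mi_abs \<alpha>) - \<rho> * real (mi_abs \<beta> + mi_abs \<gamma>)"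
proof -
  have "word_order \<rho> \<delta> (map in_x vs) = \<delta> * real (length vs)" if "set vs \<subseteq> Basis" for vs :: "(real^'n) list"
    using that by (induction vs) (auto simp: in_x_def algebra_simps nonzero_Basis)
  moreover have "word_order \<rho> \<delta> (map in_xi vs) = - \<rho> * real (length vs)" for vs :: "(real^'n) list"
    by (induction vs) (auto simp: in_xi_def algebra_simps)
  moreover have "word_order \<rho> \<delta> (map in_eta vs) = - \<rho> * real (length vs)" for vs :: "(real^'n) list"
    by (induction vs) (auto simp: in_eta_def algebra_simps)
  ultimately show ?thesis
    by (simp add: standard_word_def set_mi_word length_mi_word algebra_simps)
qed

lemma set_standard_word: "set (standard_word \<alpha> \<beta> \<gamma>) \<subseteq> Basis"
proof -
  have "in_x v \<in> Basis" "in_xi v \<in> Basis" "in_eta v \<in> Basis" if "v \<in> Basis" for v :: "real^'a"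
    using that by (auto simp: Basis_prod_def in_x_def in_xi_def in_eta_def zero_prod_def)
  then show ?thesis
    using set_mi_word[of \<alpha>] set_mi_word[of \<beta>] set_mi_word[of \<gamma>]
    by (auto simp: standard_word_def)
qed

text \<open>Each basis vector of phase space is an axis in exactly one of the three slots, so adding
  a letter raises one entry of one multi-index.\<close>

lemma exists_standard_word:
  fixes ws :: "'n::finite phase list"
  assumes "set ws \<subseteq> Basis"
  shows "\<exists>\<alpha> \<beta> \<gamma>. mset ws = mset (standard_word \<alpha> \<beta> \<gamma>)"
  using assms
proof (induction ws)
  case Nil
  have "mi_word (\<lambda>i. 0) = ([] :: (real^'n) list)" by (simp add: mi_word_def)
  then have "standard_word (\<lambda>i. 0) (\<lambda>i. 0) (\<lambda>i. 0) = ([] :: 'n phase list)"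
    by (simp add: standard_word_def)
  then show ?case by (metis mset.simps(1))
next
  case (Cons b ws)
  then obtain \<alpha> \<beta> \<gamma> where IH: "mset ws = mset (standard_word \<alpha> \<beta> \<gamma>)" by auto
  have "b \<in> Basis" using Cons.prems by simp
  then consider i where "b = in_x (axis i 1)" | i where "b = in_xi (axis i 1)" | i where "b = in_eta (axis i 1)"
    by (auto simp: Basis_prod_def Basis_vec_def in_x_def in_xi_def in_eta_def zero_prod_def)
  then show ?case
  proof cases
    case 1
    then have "mset (b # ws) = mset (standard_word (\<alpha>(i := Suc (\<alpha> i))) \<beta> \<gamma>)"
      using IH by (simp add: standard_word_def mset_mi_word_update del: fun_upd_apply)
    then show ?thesis by blast
  next
    case 2
    then have "mset (b # ws) = mset (standard_word \<alpha> (\<beta>(i := Suc (\<beta> i))) \<gamma>)"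
      using IH by (simp add: standard_word_def mset_mi_word_update del: fun_upd_apply)
    then show ?thesis by blast
  next
    case 3
    then have "mset (b # ws) = mset (standard_word \<alpha> \<beta> (\<gamma>(i := Suc (\<gamma> i))))"
      using IH by (simp add: standard_word_def mset_mi_word_update del: fun_upd_apply)
    then show ?thesis by blast
  qed
qed

lemma word_order_mset_cong:
  assumes "mset us = mset vs"
  shows "word_order \<rho> \<delta> us = word_order \<rho> \<delta> vs"
  unfolding word_order_def by (simp only: sum_mset_sum_list[symmetric] mset_map assms)

lemma wt_eq: "wt (x, \<xi>, \<eta>) = 1 + norm \<xi> + norm \<eta>"
  by (simp add: wt_def)

text \<open>Every word of basis directions is a permutation of a standard word, so by commutation
  the bounds in \<open>BS\<close> for ordered derivatives already cover all words.\<close>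

lemma BS_iff_symbol_class: "(\<sigma> :: 'n::finite bisymbol) \<in> BS m \<rho> \<delta> \<longleftrightarrow> uncurry3 \<sigma> \<in> symbol_class \<rho> \<delta> m"
proof
  assume \<sigma>: "\<sigma> \<in> BS m \<rho> \<delta>"
  then have s: "smooth (uncurry3 \<sigma>)"
    unfolding BS_def uncurry3_def mem_Collect_eq by (rule conjunct1)
  show "uncurry3 \<sigma> \<in> symbol_class \<rho> \<delta> m"
    unfolding symbol_class_def mem_Collect_eq
  proof (intro conjI allI impI s)
    fix ws :: "'n phase list" assume "set ws \<subseteq> Basis"
    then obtain \<alpha> \<beta> \<gamma> where w: "mset ws = mset (standard_word \<alpha> \<beta> \<gamma>)"
      using exists_standard_word by blast
    have "\<exists>C>0. \<forall>x \<xi> \<eta>. norm (deriv_x \<alpha> (deriv_xi \<beta> (deriv_eta \<gamma> \<sigma>)) x \<xi> \<eta>)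
        \<le> C * (1 + norm \<xi> + norm \<eta>) powr (m + \<delta> * real (mi_abs \<alpha>) - \<rho> * real (mi_abs \<beta> + mi_abs \<gamma>))"
      using \<sigma> unfolding BS_def mem_Collect_eq by (elim conjE allE)
    then obtain C where C: "\<And>x \<xi> \<eta>. norm (deriv_x \<alpha> (deriv_xi \<beta> (deriv_eta \<gamma> \<sigma>)) x \<xi> \<eta>)
        \<le> C * (1 + norm \<xi> + norm \<eta>) powr (m + \<delta> * real (mi_abs \<alpha>) - \<rho> * real (mi_abs \<beta> + mi_abs \<gamma>))"
      by (elim exE conjE) blast
    have "norm (foldr dir_deriv ws (uncurry3 \<sigma>) p) \<le> C * wt p powr (m + word_order \<rho> \<delta> ws)" for p
    proof -
      obtain x \<xi> \<eta> where p: "p = (x, \<xi>, \<eta>)" by (cases p) auto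
      have "foldr dir_deriv ws (uncurry3 \<sigma>) p = deriv_x \<alpha> (deriv_xi \<beta> (deriv_eta \<gamma> \<sigma>)) x \<xi> \<eta>"
        unfolding foldr_dir_deriv_mset_cong[OF s w] uncurry3_deriv_standard_word[OF s, symmetric] p
        by (simp add: uncurry3_def)
      then show ?thesis
        using C[of x \<xi> \<eta>]
        by (simp add: word_order_mset_cong[OF w] word_order_standard_word p wt_eq algebra_simps)
    qed
    then show "\<exists>C. \<forall>p. norm (foldr dir_deriv ws (uncurry3 \<sigma>) p) \<le> C * wt p powr (m + word_order \<rho> \<delta> ws)"
      by blast
  qed
next
  assume \<sigma>: "uncurry3 \<sigma> \<in> symbol_class \<rho> \<delta> m"
  then have s: "smooth (uncurry3 \<sigma>)" by (rule symbol_class_smooth)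
  show "\<sigma> \<in> BS m \<rho> \<delta>"
    unfolding BS_def mem_Collect_eq
  proof (intro conjI allI)
    show "smooth (\<lambda>(x, \<xi>, \<eta>). \<sigma> x \<xi> \<eta>)" using s by (simp add: uncurry3_def)
    fix \<alpha> \<beta> \<gamma> :: "'n multi_index"
    have "\<forall>v\<in>set (standard_word \<alpha> \<beta> \<gamma>). pure v"
      using set_standard_word pure_Basis by blast
    from symbol_class_bound[OF symbol_class_foldr_dir_deriv[OF \<sigma> this]]
    obtain C where C: "C > 0" "\<And>p. norm (foldr dir_deriv (standard_word \<alpha> \<beta> \<gamma>) (uncurry3 \<sigma>) p)
        \<le> C * wt p powr (m + word_order \<rho> \<delta> (standard_word \<alpha> \<beta> \<gamma>))" by blast
    have "norm (deriv_x \<alpha> (deriv_xi \<beta> (deriv_eta \<gamma> \<sigma>)) x \<xi> \<eta>)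
        \<le> C * (1 + norm \<xi> + norm \<eta>) powr (m + \<delta> * real (mi_abs \<alpha>) - \<rho> * real (mi_abs \<beta> + mi_abs \<gamma>))" for x \<xi> \<eta>
      using C(2)[of "(x, \<xi>, \<eta>)"] unfolding uncurry3_deriv_standard_word[OF s, symmetric]
      by (simp add: word_order_standard_word wt_eq uncurry3_def algebra_simps)
    then show "\<exists>C>0. \<forall>x \<xi> \<eta>. norm (deriv_x \<alpha> (deriv_xi \<beta> (deriv_eta \<gamma> \<sigma>)) x \<xi> \<eta>)
        \<le> C * (1 + norm \<xi> + norm \<eta>) powr (m + \<delta> * real (mi_abs \<alpha>) - \<rho> * real (mi_abs \<beta> + mi_abs \<gamma>))"
      using C(1) by blast
  qed
qed

section \<open>Decay of derivatives by interpolation\<close>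

lemma dir_deriv_scaleR:
  assumes "f differentiable (at x)"
  shows "dir_deriv (c *\<^sub>R v) f x = c *\<^sub>R dir_deriv v f x"
proof -
  obtain f' where f': "(f has_derivative f') (at x)"
    using assms unfolding differentiable_def by blast
  show ?thesis
    using linear_cmul[OF has_derivative_linear[OF f']] by (simp add: dir_deriv_eq[OF f'])
qed

text \<open>Landau's inequality with a free step: the first-order Taylor formula is solved for the
  derivative. The choice of \<open>h\<close> is left open so that the two terms can be balanced at
  each point.\<close>

lemma dir_deriv_interpolation:
  fixes u :: "'a::euclidean_space \<Rightarrow> complex"
  assumes u: "smooth u" and h: "0 < h"
    and B: "\<And>t. 0 \<le> t \<Longrightarrow> t \<le> 1 \<Longrightarrow> norm (dir_deriv b (dir_deriv b u) (x + (t * h) *\<^sub>R b)) \<le> B"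
  shows "norm (dir_deriv b u x) \<le> (norm (u (x + h *\<^sub>R b)) + norm (u x)) / h + h * B"
proof -
  have d1: "dir_deriv (h *\<^sub>R b) u = (\<lambda>x. of_real h * dir_deriv b u x)"
    by (intro ext) (simp add: dir_deriv_scaleR smooth_differentiable u scaleR_conv_of_real)
  have d2: "(dir_deriv (h *\<^sub>R b) ^^ 2) u x = of_real (h * h) * dir_deriv b (dir_deriv b u) x" for x
    by (simp add: numeral_2_eq_2 d1 dir_deriv_cmult smooth_dir_deriv u dir_deriv_scaleR smooth_differentiable scaleR_conv_of_real smooth_cmult)
  have "norm (u (x + h *\<^sub>R b) - (\<Sum>k<2. (dir_deriv (h *\<^sub>R b) ^^ k) u x / fact k)) \<le> h * h * B"
  proof (rule taylor_along_line[OF u])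
    fix t :: real assume "0 \<le> t" "t \<le> 1"
    from B[OF this] show "norm ((dir_deriv (h *\<^sub>R b) ^^ 2) u (x + t *\<^sub>R h *\<^sub>R b)) \<le> h * h * B"
      unfolding d2 using h by (simp add: norm_mult)
  qed
  then have *: "norm (u (x + h *\<^sub>R b) - (u x + of_real h * dir_deriv b u x)) \<le> h * h * B"
    by (simp add: numeral_2_eq_2 d1)
  have "h * norm (dir_deriv b u x) = norm (of_real h * dir_deriv b u x)" using h by (simp add: norm_mult)
  also have "\<dots> = norm (u (x + h *\<^sub>R b) - u x - (u (x + h *\<^sub>R b) - (u x + of_real h * dir_deriv b u x)))"
    by (simp add: algebra_simps)
  also have "\<dots> \<le> norm (u (x + h *\<^sub>R b)) + norm (u x) + h * h * B"
    using * norm_triangle_ineq4[of "u (x + h *\<^sub>R b) - u x" "u (x + h *\<^sub>R b) - (u x + of_real h * dir_deriv b u x)"]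
      norm_triangle_ineq4[of "u (x + h *\<^sub>R b)" "u x"] by linarith
  finally show ?thesis using h by (simp add: field_simps)
qed

text \<open>The step of the interpolation may point in a frequency direction. A step of length at
  most 1 changes the weight by a factor of at most 2, because the weight is at least 1.\<close>

lemma wt_shift:
  fixes b :: "'n::finite phase"
  assumes b: "b \<in> Basis" and t: "\<bar>t\<bar> \<le> 1"
  shows "wt (p + t *\<^sub>R b) \<le> 2 * wt p" "wt p \<le> 2 * wt (p + t *\<^sub>R b)"
proof -
  have "norm (fst (snd b)) + norm (snd (snd b)) \<le> 1"
    using b by (auto simp: Basis_prod_def)
  then have "\<bar>t\<bar> * (norm (fst (snd b)) + norm (snd (snd b))) \<le> 1 * 1"
    using t by (intro mult_mono) auto
  then have tb: "norm (t *\<^sub>R fst (snd b)) + norm (t *\<^sub>R snd (snd b)) \<le> 1"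
    by (simp add: distrib_left)
  have "wt (p + t *\<^sub>R b) \<le> wt p + (norm (t *\<^sub>R fst (snd b)) + norm (t *\<^sub>R snd (snd b)))"
    using norm_triangle_ineq[of "fst (snd p)" "t *\<^sub>R fst (snd b)"] norm_triangle_ineq[of "snd (snd p)" "t *\<^sub>R snd (snd b)"]
    by (simp add: wt_def)
  then show "wt (p + t *\<^sub>R b) \<le> 2 * wt p" using tb wt_ge_1[of p] by linarith
  have "wt p \<le> wt (p + t *\<^sub>R b) + (norm (t *\<^sub>R fst (snd b)) + norm (t *\<^sub>R snd (snd b)))"
    using norm_triangle_ineq4[of "fst (snd p) + t *\<^sub>R fst (snd b)" "t *\<^sub>R fst (snd b)"]
      norm_triangle_ineq4[of "snd (snd p) + t *\<^sub>R snd (snd b)" "t *\<^sub>R snd (snd b)"]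
    by (simp add: wt_def)
  then show "wt p \<le> 2 * wt (p + t *\<^sub>R b)" using tb wt_ge_1[of "p + t *\<^sub>R b"] by linarith
qed

text \<open>The number of terms needed may depend on the rate \<open>T\<close>, and the constant on
  \<open>M\<close>; no single remainder is required to decay at every rate.\<close>

definition rapidly_decaying :: "(nat \<Rightarrow> 'n::finite phase \<Rightarrow> complex) \<Rightarrow> bool"
  where "rapidly_decaying R \<longleftrightarrow>
    (\<forall>T. \<exists>M0. \<forall>M\<ge>M0. \<exists>C. \<forall>p. norm (R M p) \<le> C * wt p powr (- T))"

text \<open>All \<open>R M\<close> lie in one class of fixed order, so their second derivatives grow
  at a rate \<open>q\<close> that does not depend on \<open>M\<close>. Decay of the functions at
  rate 2T + q then yields decay of the first derivatives at rate T.\<close>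

lemma rapidly_decaying_dir_deriv:
  fixes R :: "nat \<Rightarrow> 'n::finite phase \<Rightarrow> complex"
  assumes R: "\<And>M. R M \<in> symbol_class \<rho> \<delta> m" and d: "rapidly_decaying R" and b: "b \<in> Basis"
  shows "rapidly_decaying (\<lambda>M. dir_deriv b (R M))"
  unfolding rapidly_decaying_def
proof
  fix T0 :: real
  define T where "T = max T0 0"
  define q where "q = \<bar>m + word_order \<rho> \<delta> [b] + word_order \<rho> \<delta> [b]\<bar>"
  define T' where "T' = T + T + q"
  have T'0: "T' \<ge> 0" by (simp add: T'_def T_def q_def del: word_order_simps)
  obtain M0 where M0: "\<And>M. M \<ge> M0 \<Longrightarrow> \<exists>C. \<forall>p. norm (R M p) \<le> C * wt p powr (- T')"
    using d unfolding rapidly_decaying_def by blast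
  show "\<exists>M0. \<forall>M\<ge>M0. \<exists>C. \<forall>p. norm (dir_deriv b (R M) p) \<le> C * wt p powr (- T0)"
  proof (intro exI[of _ M0] allI impI)
    fix M assume "M \<ge> M0"
    then obtain C where C: "\<And>p. norm (R M p) \<le> C * wt p powr (- T')" using M0 by blast
    have C0: "C \<ge> 0" using C[of 0] by (simp add: wt_def order_trans[OF norm_ge_zero])
    have "dir_deriv b (dir_deriv b (R M)) \<in> symbol_class \<rho> \<delta> q"
      using symbol_class_dir_deriv_Basis[OF symbol_class_dir_deriv_Basis[OF R b] b]
      by (rule symbol_class_mono) (simp add: q_def del: word_order_simps)
    then obtain D where D: "D > 0" "\<And>p. norm (dir_deriv b (dir_deriv b (R M)) p) \<le> D * wt p powr q"
      using symbol_class_bound by blast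
    have "norm (dir_deriv b (R M) p) \<le> (C * (2 powr T' + 1) + D * 2 powr q) * wt p powr (- T0)" for p
    proof -
      define w where "w = wt p"
      have w: "w \<ge> 1" unfolding w_def by (rule wt_ge_1)
      \<comment> \<open>With this step the second-derivative term has size h w^q = w^(-T), and
        dividing w^(-2T - q) by \<open>h\<close> leaves w^(-T) as well. Since T and q are
        nonnegative, \<open>h\<close> is at most 1, as \<open>wt_shift\<close> requires.\<close>
      define h where "h = w powr (- (T + q))"
      have h: "0 < h" "h \<le> 1"
        using w powr_mono[of "- (T + q)" 0 w] by (auto simp: h_def T_def q_def)
      have B: "norm (dir_deriv b (dir_deriv b (R M)) (p + (t * h) *\<^sub>R b)) \<le> D * (2 * w) powr q"
        if t: "0 \<le> t" "t \<le> 1" for t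
      proof -
        have "\<bar>t * h\<bar> \<le> 1" using t h mult_mono[of t 1 h 1] by simp
        from wt_shift(1)[OF b this, of p] have "wt (p + (t * h) *\<^sub>R b) powr q \<le> (2 * w) powr q"
          unfolding w_def by (intro powr_mono2) (auto simp: q_def wt_nonneg)
        then show ?thesis
          using D by (meson less_imp_le mult_left_mono order_trans)
      qed
      have "norm (R M (p + h *\<^sub>R b)) \<le> C * (2 powr T' * w powr (- T'))"
      proof -
        have h': "\<bar>h\<bar> \<le> 1" using h by simp
        have "norm (R M (p + h *\<^sub>R b)) \<le> C * wt (p + h *\<^sub>R b) powr (- T')" by (rule C)
        also have "\<dots> \<le> C * (2 powr \<bar>- T'\<bar> * wt p powr (- T'))"
          using C0 by (intro mult_left_mono powr_comparable[OF wt_pos wt_pos _ wt_shift[OF b h']]) auto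
        finally show ?thesis using T'0 by (simp add: w_def)
      qed
      moreover have "norm (R M p) \<le> C * w powr (- T')" unfolding w_def by (rule C)
      ultimately have "(norm (R M (p + h *\<^sub>R b)) + norm (R M p)) / h \<le> (C * (2 powr T' + 1) * w powr (- T')) / h"
        using h by (intro divide_right_mono) (auto simp: algebra_simps)
      also have "\<dots> = C * (2 powr T' + 1) * w powr (- T)"
      proof -
        have "w powr (- T') / h = w powr (- T)"
          unfolding h_def powr_diff[symmetric] by (simp add: T'_def)
        then show ?thesis by (simp only: times_divide_eq_right[symmetric])
      qed
      finally have 1: "(norm (R M (p + h *\<^sub>R b)) + norm (R M p)) / h \<le> C * (2 powr T' + 1) * w powr (- T)" .
      have 2: "h * (D * (2 * w) powr q) = D * 2 powr q * w powr (- T)"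
        using w by (simp add: h_def powr_mult powr_minus powr_add powr_diff field_simps)
      have "norm (dir_deriv b (R M) p) \<le> (C * (2 powr T' + 1) + D * 2 powr q) * w powr (- T)"
        using dir_deriv_interpolation[OF symbol_class_smooth[OF R] h(1) B] 1 unfolding 2
        by (simp add: distrib_right)
      also have "\<dots> \<le> (C * (2 powr T' + 1) + D * 2 powr q) * w powr (- T0)"
        using C0 D(1) w by (intro mult_left_mono powr_mono add_nonneg_nonneg mult_nonneg_nonneg) (auto simp: T_def)
      finally show ?thesis unfolding w_def .
    qed
    then show "\<exists>C. \<forall>p. norm (dir_deriv b (R M) p) \<le> C * wt p powr (- T0)" by blast
  qed
qed

lemma rapidly_decaying_foldr_dir_deriv:
  assumes R: "\<And>M. R M \<in> symbol_class \<rho> \<delta> m" and d: "rapidly_decaying R" and ws: "set ws \<subseteq> Basis"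
  shows "rapidly_decaying (\<lambda>M. foldr dir_deriv ws (R M))"
  using ws
proof (induction ws)
  case (Cons b ws)
  have "foldr dir_deriv ws (R M) \<in> symbol_class \<rho> \<delta> (m + word_order \<rho> \<delta> ws)" for M
    using Cons.prems by (intro symbol_class_foldr_dir_deriv R) (auto intro: pure_Basis)
  from rapidly_decaying_dir_deriv[OF this] Cons show ?case by simp
qed (use d in simp)

text \<open>Each derivative word is treated separately: a remainder with M terms, M large depending
  on the word, decays fast enough, and the extra terms from N to M that have to be added back are
  themselves of order at most m - \<theta> N.\<close>

lemma symbol_class_of_rapidly_decaying:
  fixes F :: "'n::finite phase \<Rightarrow> complex" and A :: "nat \<Rightarrow> 'n phase \<Rightarrow> complex"
  assumes F: "F \<in> symbol_class \<rho> \<delta> m" and A: "\<And>k. A k \<in> symbol_class \<rho> \<delta> (m - \<theta> * real k)"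
    and \<theta>: "\<theta> \<ge> 0" and d: "rapidly_decaying (\<lambda>M p. F p - (\<Sum>k<M. A k p))"
  shows "(\<lambda>p. F p - (\<Sum>k<N. A k p)) \<in> symbol_class \<rho> \<delta> (m - \<theta> * real N)"
proof -
  define R where "R = (\<lambda>M p. F p + (- 1) * (\<Sum>k<M. A k p))"
  have R: "R M \<in> symbol_class \<rho> \<delta> m" for M
    unfolding R_def using \<theta>
    by (intro symbol_class_add symbol_class_cmult symbol_class_sum F symbol_class_mono[OF A]) auto
  have dR: "rapidly_decaying R" using d by (simp add: R_def)
  have "R N \<in> symbol_class \<rho> \<delta> (m - \<theta> * real N)"
    unfolding symbol_class_def mem_Collect_eq
  proof (intro conjI allI impI)
    show "smooth (R N)" using R by (rule symbol_class_smooth)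
    fix ws :: "'n phase list" assume ws: "set ws \<subseteq> Basis"
    define q where "q = m - \<theta> * real N + word_order \<rho> \<delta> ws"
    obtain M0 where M0: "\<And>M. M \<ge> M0 \<Longrightarrow> \<exists>C. \<forall>p. norm (foldr dir_deriv ws (R M) p) \<le> C * wt p powr q"
      using rapidly_decaying_foldr_dir_deriv[OF R dR ws] unfolding rapidly_decaying_def
      by (metis minus_minus)
    define M where "M = max M0 N"
    obtain C where C: "\<And>p. norm (foldr dir_deriv ws (R M) p) \<le> C * wt p powr q"
      using M0[of M] by (auto simp: M_def)
    define S where "S = (\<lambda>p. \<Sum>k=N..<M. A k p)"
    have S: "S \<in> symbol_class \<rho> \<delta> (m - \<theta> * real N)"
      unfolding S_def using \<theta> by (intro symbol_class_sum symbol_class_mono[OF A]) (auto intro: mult_left_mono)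
    obtain D where D: "\<And>p. norm (foldr dir_deriv ws S p) \<le> D * wt p powr q"
      using S ws unfolding symbol_class_def q_def by blast
    have "R N = (\<lambda>p. R M p + S p)"
    proof
      fix p
      have "(\<Sum>k<M. A k p) = (\<Sum>k<N. A k p) + (\<Sum>k=N..<M. A k p)"
        using sum.atLeastLessThan_concat[of 0 N M "\<lambda>k. A k p"] by (simp add: M_def lessThan_atLeast0)
      then show "R N p = R M p + S p" by (simp add: R_def S_def)
    qed
    then have eq: "foldr dir_deriv ws (R N) = (\<lambda>p. foldr dir_deriv ws (R M) p + foldr dir_deriv ws S p)"
      using foldr_dir_deriv_add[OF symbol_class_smooth[OF R] symbol_class_smooth[OF S]] by metis
    have "norm (foldr dir_deriv ws (R N) p) \<le> (C + D) * wt p powr q" for p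
      unfolding eq using C[of p] D[of p] norm_triangle_ineq[of "foldr dir_deriv ws (R M) p" "foldr dir_deriv ws S p"]
      by (simp add: distrib_right)
    then show "\<exists>C. \<forall>p. norm (foldr dir_deriv ws (R N) p) \<le> C * wt p powr (m - \<theta> * real N + word_order \<rho> \<delta> ws)"
      unfolding q_def by blast
  qed
  then show ?thesis by (simp add: R_def)
qed

section \<open>Gaussian integrals\<close>

text \<open>Lebesgue measure on a Euclidean space is the image of a product of one-dimensional ones,
  which reduces Gaussian integrals to dimension one.\<close>

lemma integral_prod_Basis:
  fixes f :: "'a::euclidean_space \<Rightarrow> real \<Rightarrow> complex"
  assumes f: "\<And>b. b \<in> Basis \<Longrightarrow> integrable lborel (f b)"
  shows "integrable lborel (\<lambda>x. \<Prod>b\<in>Basis. f b (x \<bullet> b))"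
    and "(LINT x|lborel. (\<Prod>b\<in>Basis. f b (x \<bullet> b))) = (\<Prod>b\<in>Basis. LINT x|lborel. f b x)"
proof -
  interpret product_sigma_finite "\<lambda>_::'a. lborel :: real measure"
    by (simp add: product_sigma_finite_def sigma_finite_lborel)
  let ?g = "\<lambda>h. \<Sum>b\<in>Basis. h b *\<^sub>R (b::'a)"
  have [measurable]: "f b \<in> borel_measurable borel" if "b \<in> Basis" for b
    using borel_measurable_integrable[OF f[OF that]] by simp
  have L: "(lborel :: 'a measure) = distr (\<Pi>\<^sub>M b\<in>Basis. lborel) borel ?g"
    by (rule lborel_eq)
  have g: "?g \<in> measurable (\<Pi>\<^sub>M b\<in>Basis. lborel) borel" by measurable
  have F: "(\<lambda>x. \<Prod>b\<in>Basis. f b (x \<bullet> b)) \<in> borel_measurable borel" by measurable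
  have eq: "(\<Prod>b\<in>Basis. f b (?g h \<bullet> b)) = (\<Prod>b\<in>Basis. f b (h b))" for h
    by (intro prod.cong refl) (simp add: inner_sum_left inner_Basis if_distrib sum.delta cong: if_cong)
  show "integrable lborel (\<lambda>x. \<Prod>b\<in>Basis. f b (x \<bullet> b))"
    unfolding L integrable_distr_eq[OF g F] eq
    by (rule product_integrable_prod) (auto intro: f)
  show "(LINT x|lborel. (\<Prod>b\<in>Basis. f b (x \<bullet> b))) = (\<Prod>b\<in>Basis. LINT x|lborel. f b x)"
    unfolding L integral_distr[OF g F] eq
    by (rule product_integral_prod) (auto intro: f)
qed

lemma integrable_exp_square:
  assumes "c > 0"
  shows "integrable lborel (\<lambda>x::real. exp (- c * x\<^sup>2))"
proof -
  \<comment> \<open>The standard deviation for which the normal density is proportional to the given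
    exponential.\<close>
  define s where "s = sqrt (1 / (2 * c))"
  have s: "s > 0" "s\<^sup>2 = 1 / (2 * c)" using assms by (auto simp: s_def)
  have "integrable lborel (\<lambda>x. sqrt (2 * pi * s\<^sup>2) * (normal_density 0 s x * (x - 0) ^ 0))"
    by (intro integrable_mult_right integrable_normal_moment s)
  moreover have "sqrt (2 * pi * s\<^sup>2) * (normal_density 0 s x * (x - 0) ^ 0) = exp (- c * x\<^sup>2)" for x
    using assms by (simp add: normal_density_def s(2))
  ultimately show ?thesis by (simp only:)
qed

lemma norm_squared_Basis: "(norm (x::'a::euclidean_space))\<^sup>2 = (\<Sum>b\<in>Basis. (x \<bullet> b)\<^sup>2)"
  by (subst power2_norm_eq_inner, subst euclidean_inner) (simp add: power2_eq_square)

lemma integrable_gaussian: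
  assumes "c > 0"
  shows "integrable lborel (\<lambda>x::'a::euclidean_space. exp (- c * (norm x)\<^sup>2))"
proof -
  have "integrable lborel (\<lambda>x::'a. \<Prod>b\<in>Basis. complex_of_real (exp (- c * (x \<bullet> b)\<^sup>2)))"
    by (rule integral_prod_Basis(1)[of "\<lambda>_ x. complex_of_real (exp (- c * x\<^sup>2))"])
      (use integrable_exp_square[OF assms] in simp)
  moreover have "(\<Prod>b\<in>Basis. complex_of_real (exp (- c * (x \<bullet> b)\<^sup>2))) = complex_of_real (exp (- c * (norm x)\<^sup>2))" for x :: 'a
    by (simp add: norm_squared_Basis sum_distrib_left exp_sum flip: of_real_prod)
  ultimately have "integrable lborel (\<lambda>x::'a. complex_of_real (exp (- c * (norm x)\<^sup>2)))"
    by (simp only:)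
  from integrable_Re[OF this] show ?thesis by simp
qed

lemma power_le_fact_exp:
  fixes y :: real
  assumes "y \<ge> 0"
  shows "y ^ k \<le> fact k * exp y"
proof -
  obtain t where t: "exp y = (\<Sum>m<Suc k. y ^ m / fact m) + (exp t / fact (Suc k)) * y ^ Suc k"
    using Maclaurin_exp_le[of y "Suc k"] by blast
  have "y ^ k / fact k \<le> (\<Sum>m<Suc k. y ^ m / fact m)"
    using assms by (intro member_le_sum[of k "{..<Suc k}" "\<lambda>m. y ^ m / fact m"]) auto
  moreover have "0 \<le> (exp t / fact (Suc k)) * y ^ Suc k" using assms by simp
  ultimately have "y ^ k / fact k \<le> exp y" using t by linarith
  then show ?thesis by (simp add: field_simps)
qed

lemma power_exp_bound:
  fixes c r :: real
  assumes c: "c > 0" and r: "r \<ge> 0"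
  shows "(1 + r) ^ k * exp (- c * r\<^sup>2) \<le> (2 / c) ^ k * fact k * exp c"
proof -
  define q where "q = r\<^sup>2"
  have "q \<ge> 0" "2 * r \<le> 1 + q" using sum_squares_bound[of 1 r] by (simp_all add: q_def)
  then have "1 + r \<le> 2 * (1 + r\<^sup>2)" unfolding q_def[symmetric] by simp
  then have "(1 + r) ^ k \<le> (2 * (1 + r\<^sup>2)) ^ k" using r by (intro power_mono) auto
  also have "\<dots> = (2 / c) ^ k * (c * (1 + r\<^sup>2)) ^ k" using c by (simp flip: power_mult_distrib)
  also have "\<dots> \<le> (2 / c) ^ k * (fact k * exp (c * (1 + r\<^sup>2)))"
    using c by (intro mult_left_mono power_le_fact_exp) auto
  finally have "(1 + r) ^ k * exp (- c * r\<^sup>2) \<le> (2 / c) ^ k * (fact k * exp (c * (1 + r\<^sup>2))) * exp (- c * r\<^sup>2)"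
    by (intro mult_right_mono) auto
  also have "\<dots> = (2 / c) ^ k * fact k * (exp (c * (1 + r\<^sup>2)) * exp (- c * r\<^sup>2))" by simp
  also have "exp (c * (1 + r\<^sup>2)) * exp (- c * r\<^sup>2) = exp c"
    by (simp add: algebra_simps flip: exp_add)
  finally show ?thesis .
qed

text \<open>Common majorant for the integrals below. Its shape is stable under polynomial factors,
  which raise \<open>k\<close>, and under bounded translations, which halve \<open>c\<close>; so the
  estimates can all end in one form.\<close>

definition gauss_dom :: "nat \<Rightarrow> real \<Rightarrow> 'a::euclidean_space \<Rightarrow> real"
  where "gauss_dom k c x = (1 + norm x) ^ k * exp (- c * (norm x)\<^sup>2)"

lemma gauss_dom_nonneg: "0 \<le> gauss_dom k c x"
  by (simp add: gauss_dom_def)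

lemma borel_measurable_gauss_dom [measurable]: "gauss_dom k c \<in> borel_measurable borel"
  unfolding gauss_dom_def[abs_def] by measurable

text \<open>Half of the Gaussian exponent absorbs the polynomial factor.\<close>

lemma gauss_dom_bound:
  assumes "c > 0"
  obtains C where "C > 0" "\<And>x::'a::euclidean_space. gauss_dom k c x \<le> C * exp (- (c / 2) * (norm x)\<^sup>2)"
proof -
  obtain C where C: "\<And>r. r \<ge> 0 \<Longrightarrow> (1 + r) ^ k * exp (- (c / 2) * r\<^sup>2) \<le> C"
    using power_exp_bound[of "c / 2" _ k] assms by (metis half_gt_zero)
  have "gauss_dom k c x \<le> (\<bar>C\<bar> + 1) * exp (- (c / 2) * (norm x)\<^sup>2)" for x :: 'a
  proof -
    have "gauss_dom k c x = ((1 + norm x) ^ k * exp (- (c / 2) * (norm x)\<^sup>2)) * exp (- (c / 2) * (norm x)\<^sup>2)"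
      by (simp add: gauss_dom_def mult.assoc flip: exp_add)
    also have "\<dots> \<le> (\<bar>C\<bar> + 1) * exp (- (c / 2) * (norm x)\<^sup>2)"
      using C[of "norm x"] by (intro mult_right_mono) auto
    finally show ?thesis .
  qed
  then show ?thesis by (intro that[of "\<bar>C\<bar> + 1"]) auto
qed

lemma integrable_gauss_dom:
  assumes "c > 0"
  shows "integrable lborel (gauss_dom k c :: 'a::euclidean_space \<Rightarrow> real)"
proof -
  obtain C where C: "C > 0" "\<And>x::'a. gauss_dom k c x \<le> C * exp (- (c / 2) * (norm x)\<^sup>2)"
    using gauss_dom_bound[OF assms] by blast
  show ?thesis
  proof (rule Bochner_Integration.integrable_bound)
    show "integrable lborel (\<lambda>x::'a. C * exp (- (c / 2) * (norm x)\<^sup>2))"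
      using assms by (intro integrable_mult_right integrable_gaussian) auto
    show "AE x in lborel. norm (gauss_dom k c (x::'a)) \<le> norm (C * exp (- (c / 2) * (norm x)\<^sup>2))"
    proof (intro always_eventually allI)
      fix x :: 'a
      show "norm (gauss_dom k c x) \<le> norm (C * exp (- (c / 2) * (norm x)\<^sup>2))"
        using C(2)[of x] C(1) gauss_dom_nonneg[of k c x] by (simp add: abs_mult)
    qed
  qed auto
qed

lemma integrable_gauss_dominated:
  fixes f :: "'a::euclidean_space \<Rightarrow> complex"
  assumes "c > 0" and [measurable]: "f \<in> borel_measurable borel"
    and bd: "\<And>x. norm (f x) \<le> C * gauss_dom k c x"
  shows "integrable lborel f"
proof (rule Bochner_Integration.integrable_bound)
  show "integrable lborel (\<lambda>x::'a. C * gauss_dom k c x)"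
    using assms by (intro integrable_mult_right integrable_gauss_dom) auto
  show "AE x in lborel. norm (f x) \<le> norm (C * gauss_dom k c x)"
    using bd by (intro always_eventually allI) (metis abs_le_iff order_trans real_norm_def abs_ge_self)
qed auto

lemma norm_integral_gauss_dominated:
  fixes f :: "'a::euclidean_space \<Rightarrow> complex"
  assumes "c > 0" and bd: "\<And>x. norm (f x) \<le> C * gauss_dom k c x"
  shows "norm (LINT x|lborel. f x) \<le> C * (LINT x|lborel. gauss_dom k c (x::'a))"
proof -
  have "norm (LINT x|lborel. f x) \<le> (LINT x|lborel. C * gauss_dom k c (x::'a))"
    using assms(1) bd
    by (intro order_trans[OF integral_norm_bound] integral_mono' integrable_mult_right integrable_gauss_dom)
      (auto intro: order_trans[OF norm_ge_zero])
  then show ?thesis by simp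
qed

lemma gauss_dom_mult_le:
  assumes "norm a \<le> A * (1 + norm x) ^ j" "norm b \<le> D * gauss_dom k c x"
  shows "norm (a * b :: complex) \<le> (A * D) * gauss_dom (j + k) c x"
proof -
  have "norm (a * b) \<le> (A * (1 + norm x) ^ j) * (D * gauss_dom k c x)"
    unfolding norm_mult by (rule mult_mono'[OF assms]) auto
  also have "\<dots> = (A * D) * gauss_dom (j + k) c x" by (simp add: gauss_dom_def power_add)
  finally show ?thesis .
qed

text \<open>Rests on |x|^2 <= 2 |x + t v|^2 + 2 |v|^2. Uniformity in \<open>t\<close> is needed
  because Taylor remainders are evaluated at unknown points of a segment.\<close>

lemma gauss_dom_shift:
  fixes x v :: "'a::euclidean_space"
  assumes "c > 0" "0 \<le> t" "t \<le> 1"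
  shows "gauss_dom k c (x + t *\<^sub>R v) \<le> ((1 + norm v) ^ k * exp (c * (norm v)\<^sup>2)) * gauss_dom k (c / 2) x"
proof -
  have tv: "norm (t *\<^sub>R v) \<le> norm v" using assms by (simp add: mult_left_le_one_le)
  have "1 + norm (x + t *\<^sub>R v) \<le> (1 + norm v) * (1 + norm x)"
  proof -
    have "0 \<le> norm v * norm x" by simp
    then have "1 + norm (x + t *\<^sub>R v) \<le> 1 + norm v + norm x + norm v * norm x"
      using norm_triangle_ineq[of x "t *\<^sub>R v"] tv by linarith
    then show ?thesis by (simp add: algebra_simps)
  qed
  then have 1: "(1 + norm (x + t *\<^sub>R v)) ^ k \<le> (1 + norm v) ^ k * (1 + norm x) ^ k"
    by (metis power_mono power_mult_distrib add_nonneg_nonneg norm_ge_zero zero_le_one)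
  have "norm x \<le> norm (x + t *\<^sub>R v) + norm v"
    using norm_triangle_ineq4[of "x + t *\<^sub>R v" "t *\<^sub>R v"] tv by simp
  then have "(norm x)\<^sup>2 \<le> (norm (x + t *\<^sub>R v) + norm v)\<^sup>2" by (intro power_mono) auto
  also have "\<dots> \<le> 2 * (norm (x + t *\<^sub>R v))\<^sup>2 + 2 * (norm v)\<^sup>2"
    using sum_squares_bound[of "norm (x + t *\<^sub>R v)" "norm v"] by (simp add: power2_sum)
  finally have "(c / 2) * (norm x)\<^sup>2 \<le> (c / 2) * (2 * (norm (x + t *\<^sub>R v))\<^sup>2 + 2 * (norm v)\<^sup>2)"
    using assms by (intro mult_left_mono) auto
  then have "- c * (norm (x + t *\<^sub>R v))\<^sup>2 \<le> c * (norm v)\<^sup>2 + - (c / 2) * (norm x)\<^sup>2"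
    by (simp add: algebra_simps)
  then have 2: "exp (- c * (norm (x + t *\<^sub>R v))\<^sup>2) \<le> exp (c * (norm v)\<^sup>2) * exp (- (c / 2) * (norm x)\<^sup>2)"
    by (simp flip: exp_add)
  have "gauss_dom k c (x + t *\<^sub>R v) \<le> ((1 + norm v) ^ k * (1 + norm x) ^ k) * (exp (c * (norm v)\<^sup>2) * exp (- (c / 2) * (norm x)\<^sup>2))"
    unfolding gauss_dom_def by (rule mult_mono[OF 1 2]) auto
  then show ?thesis by (simp add: gauss_dom_def mult_ac)
qed

text \<open>The characteristic function of the standard normal distribution, with the normalising
  factor of the density removed.\<close>

lemma integral_iexp_gaussian_real:
  "(LINT x|lborel. exp (\<i> * of_real (t * x)) * complex_of_real (exp (- x\<^sup>2 / 2))) =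
    complex_of_real (sqrt (2 * pi) * exp (- t\<^sup>2 / 2))"
proof -
  have "complex_of_real (exp (- (t^2) / 2)) = char std_normal_distribution t"
    by (simp add: char_std_normal_distribution)
  also have "\<dots> = (LINT x|lborel. std_normal_density x *\<^sub>R exp (\<i> * of_real (t * x)))"
    unfolding char_def by (subst integral_density) auto
  also have "\<dots> = (LINT x|lborel. complex_of_real (1 / sqrt (2 * pi)) * (exp (\<i> * of_real (t * x)) * complex_of_real (exp (- x\<^sup>2 / 2))))"
    by (intro Bochner_Integration.integral_cong) (auto simp: std_normal_density_def scaleR_conv_of_real)
  also have "\<dots> = complex_of_real (1 / sqrt (2 * pi)) * (LINT x|lborel. exp (\<i> * of_real (t * x)) * complex_of_real (exp (- x\<^sup>2 / 2)))"
    by (rule integral_mult_right_zero)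
  finally show ?thesis by (simp add: field_simps)
qed

definition gauss :: "'a::euclidean_space \<Rightarrow> complex"
  where "gauss x = of_real (exp (- (norm x)\<^sup>2 / 2))"

definition gauss_mass :: "'a::euclidean_space itself \<Rightarrow> complex"
  where "gauss_mass _ = of_real (sqrt (2 * pi) ^ DIM('a))"

lemma gauss_mass_nonzero: "gauss_mass TYPE('a::euclidean_space) \<noteq> 0"
  by (simp add: gauss_mass_def)

lemma norm_gauss_le: "norm (gauss x) \<le> 1 * gauss_dom 0 (1 / 2) x"
  by (simp add: gauss_def gauss_dom_def)

lemma borel_measurable_gauss [measurable]: "gauss \<in> borel_measurable borel"
  unfolding gauss_def[abs_def] by measurable

lemma integral_iexp_gauss:
  "(LINT s|lborel. exp (\<i> * of_real (z \<bullet> s)) * gauss s) = gauss_mass TYPE('a) * gauss (z::'a::euclidean_space)"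
proof -
  define f where "f = (\<lambda>(b::'a) x. exp (\<i> * of_real ((z \<bullet> b) * x)) * complex_of_real (exp (- x\<^sup>2 / 2)))"
  have f: "integrable lborel (f b)" for b
  proof (rule Bochner_Integration.integrable_bound[OF integrable_exp_square[of "1/2"]])
    show "AE x in lborel. norm (f b x) \<le> norm (exp (- (1 / 2) * x\<^sup>2))"
      by (intro always_eventually allI) (simp add: f_def norm_mult)
  qed (auto simp: f_def)
  have "exp (\<i> * of_real (z \<bullet> s)) * gauss s = (\<Prod>b\<in>Basis. f b (s \<bullet> b))" for s :: 'a
  proof -
    have "(\<Prod>b\<in>Basis. f b (s \<bullet> b)) =
        exp (\<Sum>b\<in>Basis. \<i> * of_real ((z \<bullet> b) * (s \<bullet> b))) * complex_of_real (exp (\<Sum>b\<in>Basis. - (s \<bullet> b)\<^sup>2 / 2))"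
      by (simp add: f_def prod.distrib exp_sum)
    also have "(\<Sum>b\<in>Basis. \<i> * of_real ((z \<bullet> b) * (s \<bullet> b))) = \<i> * complex_of_real (z \<bullet> s)"
      by (simp add: euclidean_inner[of z s] sum_distrib_left)
    also have "(\<Sum>b\<in>Basis. - (s \<bullet> b)\<^sup>2 / 2) = - (norm s)\<^sup>2 / 2"
      by (simp add: norm_squared_Basis sum_negf sum_divide_distrib)
    finally show ?thesis by (simp add: gauss_def)
  qed
  then have "(LINT s|lborel. exp (\<i> * of_real (z \<bullet> s)) * gauss s) = (\<Prod>b\<in>Basis. LINT x|lborel. f b x)"
    using integral_prod_Basis(2)[of f] f by simp
  also have "\<dots> = (\<Prod>b\<in>(Basis::'a set). complex_of_real (sqrt (2 * pi)) * complex_of_real (exp (- (z \<bullet> b)\<^sup>2 / 2)))"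
    by (intro prod.cong refl) (simp only: f_def integral_iexp_gaussian_real, simp)
  also have "\<dots> = gauss_mass TYPE('a) * complex_of_real (exp (\<Sum>b\<in>Basis. - (z \<bullet> b)\<^sup>2 / 2))"
    by (simp add: prod.distrib gauss_mass_def exp_sum)
  also have "(\<Sum>b\<in>Basis. - (z \<bullet> b)\<^sup>2 / 2) = - (norm z)\<^sup>2 / 2"
    by (simp add: norm_squared_Basis sum_negf sum_divide_distrib)
  finally show ?thesis by (simp add: gauss_def)
qed

lemma integral_gauss: "(LINT s|lborel. gauss (s::'a)) = gauss_mass TYPE('a::euclidean_space)"
  using integral_iexp_gauss[of "0::'a"] by (simp add: gauss_def)

section \<open>Products, polynomials and Gaussian wave packets\<close>

lemma dir_deriv_mult:
  fixes f g :: "'a::euclidean_space \<Rightarrow> complex"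
  assumes "f differentiable (at x)" "g differentiable (at x)"
  shows "dir_deriv v (\<lambda>x. f x * g x) x = f x * dir_deriv v g x + dir_deriv v f x * g x"
proof -
  obtain f' g' where "(f has_derivative f') (at x)" "(g has_derivative g') (at x)"
    using assms unfolding differentiable_def by blast
  then show ?thesis
    using dir_deriv_eq[OF has_derivative_mult[of f f' x UNIV g g'], of v] by (simp add: dir_deriv_eq)
qed

text \<open>Products alone are not stable under differentiation, finite sums of products are; hence
  the lists of pairs in the coinduction, which Leibniz' rule doubles in length.\<close>

lemma smooth_mult:
  fixes f g :: "'a::euclidean_space \<Rightarrow> complex"
  assumes "smooth f" "smooth g"
  shows "smooth (\<lambda>x. f x * g x)"
proof (rule smooth_coinduct[where P="\<lambda>h. \<exists>L. (\<forall>(f, g)\<in>set L. smooth f \<and> smooth g) \<and> h = (\<lambda>x. \<Sum>(f, g)\<leftarrow>L. f x * g x)"])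
  show "\<exists>L. (\<forall>(f, g)\<in>set L. smooth f \<and> smooth g) \<and> (\<lambda>x. f x * g x) = (\<lambda>x. \<Sum>(f, g)\<leftarrow>L. f x * g x)"
    by (rule exI[of _ "[(f, g)]"]) (use assms in simp)
  have d: "(\<lambda>x. \<Sum>(f, g)\<leftarrow>L. f x * g x :: complex) differentiable (at x)"
    if "\<forall>(f, g)\<in>set L. smooth f \<and> smooth g" for L and x :: 'a
    using that
  proof (induction L)
    case (Cons p L)
    then show ?case
      by (cases p) (auto intro!: differentiable_add differentiable_mult intro: smooth_differentiable)
  qed simp
  {
    fix h :: "'a \<Rightarrow> complex" and x assume "\<exists>L. (\<forall>(f, g)\<in>set L. smooth f \<and> smooth g) \<and> h = (\<lambda>x. \<Sum>(f, g)\<leftarrow>L. f x * g x)"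
    then show "h differentiable (at x)" using d by auto
  }
  fix h :: "'a \<Rightarrow> complex" and b :: 'a
  assume "\<exists>L. (\<forall>(f, g)\<in>set L. smooth f \<and> smooth g) \<and> h = (\<lambda>x. \<Sum>(f, g)\<leftarrow>L. f x * g x)"
  then obtain L where L: "\<forall>(f, g)\<in>set L. smooth f \<and> smooth g" "h = (\<lambda>x. \<Sum>(f, g)\<leftarrow>L. f x * g x)" by auto
  have "dir_deriv b (\<lambda>x. \<Sum>(f, g)\<leftarrow>L. f x * g x) x =
      (\<Sum>(f, g)\<leftarrow>L. f x * dir_deriv b g x) + (\<Sum>(f, g)\<leftarrow>L. dir_deriv b f x * g x)" for x
    using L(1)
  proof (induction L)
    case (Cons p L)
    obtain f g where p: "p = (f, g)" by (cases p)
    have "dir_deriv b (\<lambda>x. f x * g x + (\<Sum>(f, g)\<leftarrow>L. f x * g x)) x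
      = dir_deriv b (\<lambda>x. f x * g x) x + dir_deriv b (\<lambda>x. \<Sum>(f, g)\<leftarrow>L. f x * g x) x"
      using Cons.prems p by (intro dir_deriv_add d differentiable_mult smooth_differentiable) auto
    then show ?case
      using Cons p by (simp add: dir_deriv_mult smooth_differentiable)
  qed simp
  then have "dir_deriv b h = (\<lambda>x. \<Sum>(f, g)\<leftarrow>map (\<lambda>(f, g). (f, dir_deriv b g)) L @ map (\<lambda>(f, g). (dir_deriv b f, g)) L. f x * g x)"
    unfolding L(2) by (auto simp: comp_def case_prod_unfold)
  moreover have "\<forall>(f, g)\<in>set (map (\<lambda>(f, g). (f, dir_deriv b g)) L @ map (\<lambda>(f, g). (dir_deriv b f, g)) L). smooth f \<and> smooth g"
    using L(1) by (auto simp: smooth_dir_deriv)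
  ultimately show "\<exists>L. (\<forall>(f, g)\<in>set L. smooth f \<and> smooth g) \<and> dir_deriv b h = (\<lambda>x. \<Sum>(f, g)\<leftarrow>L. f x * g x)"
    by blast
qed

text \<open>Polynomial functions, generated without reference to coefficients: stability under
  differentiation, continuity and polynomial growth are what is wanted of them.\<close>

inductive polyf :: "('a::euclidean_space \<Rightarrow> complex) \<Rightarrow> bool" where
  const: "polyf (\<lambda>x. c)"
| inner: "polyf (\<lambda>x. of_real (x \<bullet> b))"
| add: "polyf p \<Longrightarrow> polyf q \<Longrightarrow> polyf (\<lambda>x. p x + q x)"
| mult: "polyf p \<Longrightarrow> polyf q \<Longrightarrow> polyf (\<lambda>x. p x * q x)"

lemma has_derivative_of_real_inner:
  "((\<lambda>x. complex_of_real (x \<bullet> b)) has_derivative (\<lambda>h. complex_of_real (h \<bullet> b))) (at x)"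
  by (intro bounded_linear_imp_has_derivative bounded_linear_compose[OF bounded_linear_of_real] bounded_linear_inner_left)

lemma polyf_deriv:
  assumes "polyf p"
  shows "p differentiable (at x) \<and> polyf (dir_deriv v p)"
  using assms
proof (induction arbitrary: x)
  case (const c)
  then show ?case by (auto intro: polyf.const)
next
  case (inner b)
  have "dir_deriv v (\<lambda>x. complex_of_real (x \<bullet> b)) = (\<lambda>x. complex_of_real (v \<bullet> b))"
    by (intro ext dir_deriv_eq[OF has_derivative_of_real_inner])
  then show ?case using has_derivative_of_real_inner[of b x] by (auto simp: differentiable_def intro: polyf.const)
next
  case (add p q)
  then have "dir_deriv v (\<lambda>x. p x + q x) = (\<lambda>x. dir_deriv v p x + dir_deriv v q x)"
    by (intro ext dir_deriv_add) auto
  then show ?case using add by (auto intro: polyf.add)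
next
  case (mult p q)
  then have "dir_deriv v (\<lambda>x. p x * q x) = (\<lambda>x. p x * dir_deriv v q x + dir_deriv v p x * q x)"
    by (intro ext dir_deriv_mult) auto
  moreover have "polyf (\<lambda>x. p x * dir_deriv v q x + dir_deriv v p x * q x)"
    using mult by (intro polyf.add polyf.mult) auto
  ultimately show ?case using mult by auto
qed

lemma polyf_bound: "polyf (p :: 'a::euclidean_space \<Rightarrow> complex) \<Longrightarrow> \<exists>C\<ge>0. \<exists>k. \<forall>x. norm (p x) \<le> C * (1 + norm x) ^ k"
proof (induction rule: polyf.induct)
  case (const c)
  then show ?case by (intro exI[of _ "norm c"] conjI exI[of _ 0]) auto
next
  case (inner b)
  show ?case
  proof (intro exI[of _ "norm b"] conjI exI[of _ 1] allI)
    fix x :: 'a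
    have "norm (complex_of_real (x \<bullet> b)) \<le> norm x * norm b" by (simp add: Cauchy_Schwarz_ineq2)
    also have "\<dots> \<le> norm b * (1 + norm x) ^ 1" by (simp add: algebra_simps)
    finally show "norm (complex_of_real (x \<bullet> b)) \<le> norm b * (1 + norm x) ^ 1" .
  qed auto
next
  case (add p q)
  then obtain C k D l where *: "C \<ge> 0" "\<And>x. norm (p x) \<le> C * (1 + norm x) ^ k" "D \<ge> 0" "\<And>x. norm (q x) \<le> D * (1 + norm x) ^ l" by blast
  show ?case
  proof (intro exI[of _ "C + D"] conjI exI[of _ "k + l"] allI)
    fix x :: 'a
    have "C * (1 + norm x) ^ k \<le> C * (1 + norm x) ^ (k + l)" "D * (1 + norm x) ^ l \<le> D * (1 + norm x) ^ (k + l)"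
      using * by (auto intro!: mult_left_mono power_increasing)
    then show "norm (p x + q x) \<le> (C + D) * (1 + norm x) ^ (k + l)"
      using *(2)[of x] *(4)[of x] norm_triangle_ineq[of "p x" "q x"] by (simp add: distrib_right)
  qed (use * in auto)
next
  case (mult p q)
  then obtain C k D l where *: "C \<ge> 0" "\<And>x. norm (p x) \<le> C * (1 + norm x) ^ k" "D \<ge> 0" "\<And>x. norm (q x) \<le> D * (1 + norm x) ^ l" by blast
  show ?case
  proof (intro exI[of _ "C * D"] conjI exI[of _ "k + l"] allI)
    fix x :: 'a
    have "norm (p x * q x) \<le> (C * (1 + norm x) ^ k) * (D * (1 + norm x) ^ l)"
      unfolding norm_mult by (intro mult_mono' *) auto
    then show "norm (p x * q x) \<le> (C * D) * (1 + norm x) ^ (k + l)" by (simp add: power_add mult_ac)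
  qed (use * in auto)
qed

lemma polyf_continuous: "polyf p \<Longrightarrow> continuous_on UNIV p"
  by (meson polyf_deriv differentiable_imp_continuous_within continuous_at_imp_continuous_on)

text \<open>Gaussian wave packet with centre \<open>y\<close>, frequency \<theta> and width 1/a, its
  phase counted from the centre. \<open>gauss\<close> is the packet with a = 1, so the results on
  derivatives of packets serve for it as well.\<close>

definition packet :: "real \<Rightarrow> 'a::euclidean_space \<Rightarrow> 'a \<Rightarrow> 'a \<Rightarrow> complex"
  where "packet a y \<theta> x = exp (\<i> * of_real (\<theta> \<bullet> (x - y)) - of_real (a\<^sup>2 * (norm (x - y))\<^sup>2 / 2))"

lemma gauss_eq_packet: "gauss = packet 1 0 0"
proof
  fix x :: 'a
  show "gauss x = packet 1 0 0 x"
    unfolding gauss_def packet_def exp_of_real[symmetric] by simp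
qed

lemma packet_deriv:
  "packet a y \<theta> differentiable (at x)"
  "dir_deriv v (packet a y \<theta>) x = (\<i> * of_real (\<theta> \<bullet> v) + of_real (- a\<^sup>2) * (of_real (x \<bullet> v) + of_real (- (y \<bullet> v)))) * packet a y \<theta> x"
proof -
  define g where "g x = \<i> * complex_of_real (\<theta> \<bullet> (x - y)) - complex_of_real (a\<^sup>2 * (norm (x - y))\<^sup>2 / 2)" for x
  define g' where "g' h = \<i> * complex_of_real (\<theta> \<bullet> h) - complex_of_real (a\<^sup>2 * (h \<bullet> (x - y)))" for h
  have "((\<lambda>x. \<theta> \<bullet> (x - y)) has_derivative (\<lambda>h. \<theta> \<bullet> h)) (at x)"
    by (auto intro!: derivative_eq_intros)
  moreover have "((\<lambda>x. a\<^sup>2 * ((x - y) \<bullet> (x - y)) / 2) has_derivative (\<lambda>h. a\<^sup>2 * (h \<bullet> (x - y)))) (at x)"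
    by (auto intro!: derivative_eq_intros simp: inner_commute field_simps)
  ultimately have "(g has_derivative g') (at x)"
    unfolding g_def g'_def power2_norm_eq_inner
    by (intro has_derivative_diff has_derivative_mult_right has_derivative_of_real)
  from has_derivative_compose[OF this, of exp "\<lambda>h. exp (g x) * h"] DERIV_exp[of "g x"]
  have *: "((\<lambda>x. exp (g x)) has_derivative (\<lambda>h. exp (g x) * g' h)) (at x)"
    by (simp add: has_field_derivative_def)
  have eq: "packet a y \<theta> = (\<lambda>x. exp (g x))" by (auto simp: packet_def g_def)
  show "packet a y \<theta> differentiable (at x)" unfolding eq differentiable_def using * by blast
  show "dir_deriv v (packet a y \<theta>) x = (\<i> * of_real (\<theta> \<bullet> v) + of_real (- a\<^sup>2) * (of_real (x \<bullet> v) + of_real (- (y \<bullet> v)))) * packet a y \<theta> x"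
    unfolding eq dir_deriv_eq[OF *] g'_def
    by (simp add: inner_diff_right inner_commute[of v] algebra_simps)
qed

lemma dir_deriv_polyf_packet:
  assumes p: "polyf p"
  shows "\<exists>q. polyf q \<and> dir_deriv v (\<lambda>x. p x * packet a y \<theta> x) = (\<lambda>x. q x * packet a y \<theta> x)"
proof (intro exI conjI)
  let ?c = "\<lambda>x. \<i> * complex_of_real (\<theta> \<bullet> v) + of_real (- a\<^sup>2) * (of_real (x \<bullet> v) + of_real (- (y \<bullet> v)))"
  have "polyf ?c"
    by (rule polyf.add[OF polyf.const polyf.mult[OF polyf.const polyf.add[OF polyf.inner polyf.const]]])
  then show "polyf (\<lambda>x. p x * ?c x + dir_deriv v p x)"
    by (rule polyf.add[OF polyf.mult[OF p] conjunct2[OF polyf_deriv[OF p]]])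
  show "dir_deriv v (\<lambda>x. p x * packet a y \<theta> x) = (\<lambda>x. (p x * ?c x + dir_deriv v p x) * packet a y \<theta> x)"
    using dir_deriv_mult[OF conjunct1[OF polyf_deriv[OF p]] packet_deriv(1)] by (intro ext) (simp add: packet_deriv(2) algebra_simps)
qed

lemma foldr_dir_deriv_packet:
  "\<exists>p. polyf p \<and> foldr dir_deriv vs (packet a y \<theta>) = (\<lambda>x. p x * packet a y \<theta> x)"
proof (induction vs)
  case Nil
  show ?case by (rule exI[of _ "\<lambda>x. 1"]) (auto intro: polyf.const)
next
  case (Cons v vs)
  then obtain p where p: "polyf p" "foldr dir_deriv vs (packet a y \<theta>) = (\<lambda>x. p x * packet a y \<theta> x)" by auto
  show ?case
    using dir_deriv_polyf_packet[OF p(1), of v a y \<theta>] by (simp add: p(2))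
qed

lemma smooth_packet: "smooth (packet a y \<theta>)"
proof (rule smooth_coinduct[where P="\<lambda>f. \<exists>p. polyf p \<and> f = (\<lambda>x. p x * packet a y \<theta> x)"])
  show "\<exists>p. polyf p \<and> packet a y \<theta> = (\<lambda>x. p x * packet a y \<theta> x)"
    by (rule exI[of _ "\<lambda>x. 1"]) (auto intro: polyf.const)
next
  fix f :: "'a \<Rightarrow> complex" and x assume "\<exists>p. polyf p \<and> f = (\<lambda>x. p x * packet a y \<theta> x)"
  then obtain p where p: "polyf p" "f = (\<lambda>x. p x * packet a y \<theta> x)" by auto
  show "f differentiable (at x)"
    unfolding p(2) by (rule differentiable_mult[OF conjunct1[OF polyf_deriv[OF p(1)]] packet_deriv(1)])
next
  fix f :: "'a \<Rightarrow> complex" and b :: 'a assume "\<exists>p. polyf p \<and> f = (\<lambda>x. p x * packet a y \<theta> x)"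
  then obtain p where p: "polyf p" "f = (\<lambda>x. p x * packet a y \<theta> x)" by auto
  show "\<exists>p. polyf p \<and> dir_deriv b f = (\<lambda>x. p x * packet a y \<theta> x)"
    unfolding p(2) by (rule dir_deriv_polyf_packet[OF p(1)])
qed

lemma norm_packet: "norm (packet a y \<theta> x) = exp (- (a\<^sup>2 / 2) * (norm (x - y))\<^sup>2)"
  by (simp add: packet_def norm_exp_eq_Re)

text \<open>A derivative of a packet is a polynomial times the packet. The exponent drops from a^2/2
  to a^2/4 when the Gaussian is recentred at the origin by \<open>gauss_dom_shift\<close>.\<close>

lemma packet_derivs_bound:
  assumes a: "a \<noteq> 0"
  shows "\<exists>C\<ge>0. \<exists>k. \<forall>x. norm (foldr dir_deriv vs (packet a y \<theta>) x) \<le> C * gauss_dom k (a\<^sup>2 / 4) x"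
proof -
  obtain p where p: "polyf p" "foldr dir_deriv vs (packet a y \<theta>) = (\<lambda>x. p x * packet a y \<theta> x)"
    using foldr_dir_deriv_packet by blast
  obtain C k where C: "C \<ge> 0" "\<And>x. norm (p x) \<le> C * (1 + norm x) ^ k"
    using polyf_bound[OF p(1)] by blast
  define D where "D = exp ((a\<^sup>2 / 2) * (norm y)\<^sup>2)"
  have "norm (packet a y \<theta> x) \<le> D * gauss_dom 0 (a\<^sup>2 / 4) x" for x
    using gauss_dom_shift[of "a\<^sup>2 / 2" 1 0 x "- y"] a by (simp add: norm_packet gauss_dom_def D_def)
  from gauss_dom_mult_le[OF C(2) this]
  have "norm (foldr dir_deriv vs (packet a y \<theta>) x) \<le> (C * D) * gauss_dom k (a\<^sup>2 / 4) x" for x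
    unfolding p(2) by simp
  then show ?thesis using C(1) by (intro exI[of _ "C * D"] conjI exI[of _ k]) (auto simp: D_def)
qed

text \<open>The transposition identity is assumed for Schwartz functions only; this admits packets
  as test functions.\<close>

lemma packet_schwartz:
  assumes a: "a \<noteq> 0"
  shows "packet a y \<theta> \<in> schwartz"
  unfolding schwartz_def mem_Collect_eq
proof (intro conjI allI smooth_packet)
  fix j and \<alpha> :: "'a multi_index"
  obtain C k where C: "C \<ge> 0" "\<And>x. norm (mi_deriv \<alpha> (packet a y \<theta>) x) \<le> C * gauss_dom k (a\<^sup>2 / 4) x"
    using packet_derivs_bound[OF a, of "mi_word \<alpha>" y \<theta>] unfolding mi_deriv_eq by blast
  obtain D where D: "D > 0" "\<And>x::real^'a. gauss_dom (j + k) (a\<^sup>2 / 4) x \<le> D * exp (- (a\<^sup>2 / 4 / 2) * (norm x)\<^sup>2)"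
    using gauss_dom_bound[of "a\<^sup>2 / 4" "j + k"] a by auto
  have "(1 + norm x) ^ j * norm (mi_deriv \<alpha> (packet a y \<theta>) x) \<le> C * D" for x
  proof -
    have "(1 + norm x) ^ j * norm (mi_deriv \<alpha> (packet a y \<theta>) x) \<le> (1 + norm x) ^ j * (C * gauss_dom k (a\<^sup>2 / 4) x)"
      by (intro mult_left_mono C) auto
    also have "\<dots> = C * gauss_dom (j + k) (a\<^sup>2 / 4) x" by (simp add: gauss_dom_def power_add)
    also have "\<dots> \<le> C * (D * exp (- (a\<^sup>2 / 4 / 2) * (norm x)\<^sup>2))" by (intro mult_left_mono D C)
    also have "\<dots> \<le> C * (D * 1)"
      using C(1) D(1) by (intro mult_left_mono) auto
    finally show ?thesis by simp
  qed
  then show "\<exists>C. \<forall>x. (1 + norm x) ^ j * norm (mi_deriv \<alpha> (packet a y \<theta>) x) \<le> C" by blast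
qed

lemma gauss_derivs_bound: "\<exists>C\<ge>0. \<exists>k. \<forall>x. norm (foldr dir_deriv vs gauss x) \<le> C * gauss_dom k (1 / 4) x"
  using packet_derivs_bound[of 1 vs 0 0] by (simp add: gauss_eq_packet)

lemma smooth_gauss: "smooth gauss"
  by (simp add: gauss_eq_packet smooth_packet)

section \<open>Integration by parts against derivatives of the Gaussian\<close>

text \<open>By translation invariance the integral of F(x + h v) - F(x) vanishes, while Taylor's
  formula compares it with h times the integral of the derivative up to O(h^2). Dividing by h and
  letting h tend to 0 gives the claim in any direction, without integrating along lines.\<close>

lemma integral_dir_deriv_eq_0:
  fixes F :: "'a::euclidean_space \<Rightarrow> complex"
  assumes F: "smooth F" and c: "c > 0"
    and bd: "\<And>x. norm (F x) \<le> C * gauss_dom k c x" "\<And>x. norm (dir_deriv v F x) \<le> C * gauss_dom k c x"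
      "\<And>x. norm (dir_deriv v (dir_deriv v F) x) \<le> C * gauss_dom k c x"
  shows "(LINT x|lborel. dir_deriv v F x) = 0"
proof -
  have meas [measurable]: "F \<in> borel_measurable borel" "dir_deriv v F \<in> borel_measurable borel"
    using F by (auto intro!: borel_measurable_continuous_onI smooth_continuous smooth_dir_deriv)
  have C0: "C \<ge> 0" using bd(1)[of 0] by (simp add: gauss_dom_def order_trans[OF norm_ge_zero])
  define A where "A = (1 + norm v) ^ k * exp (c * (norm v)\<^sup>2)"
  define I where "I = (LINT x|lborel. gauss_dom k (c / 2) (x::'a))"
  have iF: "integrable lborel F" "integrable lborel (dir_deriv v F)"
    by (rule integrable_gauss_dominated[OF c meas(1) bd(1)], rule integrable_gauss_dominated[OF c meas(2) bd(2)])
  have sh: "integrable lborel (\<lambda>x. F (x + h *\<^sub>R v))" "(LINT x|lborel. F (x + h *\<^sub>R v)) = (LINT x|lborel. F x)" for h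
  proof -
    have t: "(\<lambda>x. h *\<^sub>R v + x) \<in> measurable lborel borel" by simp
    have L: "distr lborel borel (\<lambda>x. h *\<^sub>R v + x) = lborel" using lborel_distr_plus[of "h *\<^sub>R v"] by simp
    show "integrable lborel (\<lambda>x. F (x + h *\<^sub>R v))"
      using integrable_distr_eq[OF t meas(1)] iF(1) unfolding L by (simp add: add.commute)
    show "(LINT x|lborel. F (x + h *\<^sub>R v)) = (LINT x|lborel. F x)"
      using integral_distr[OF t meas(1)] unfolding L by (simp add: add.commute)
  qed
  have est: "norm (LINT x|lborel. dir_deriv v F x) \<le> h * (C * A * I)" if h: "0 < h" "h \<le> 1" for h :: real
  proof -
    have d1: "dir_deriv (h *\<^sub>R v) F = (\<lambda>x. of_real h * dir_deriv v F x)"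
      by (intro ext) (simp add: dir_deriv_scaleR smooth_differentiable F scaleR_conv_of_real)
    have d2: "(dir_deriv (h *\<^sub>R v) ^^ 2) F x = of_real (h * h) * dir_deriv v (dir_deriv v F) x" for x
      by (simp add: numeral_2_eq_2 d1 dir_deriv_cmult smooth_dir_deriv F dir_deriv_scaleR smooth_differentiable scaleR_conv_of_real smooth_cmult)
    have pt: "norm (F (x + h *\<^sub>R v) - F x - of_real h * dir_deriv v F x) \<le> (h * h * (C * A)) * gauss_dom k (c / 2) x" for x
    proof -
      have "norm (F (x + h *\<^sub>R v) - (\<Sum>j<2. (dir_deriv (h *\<^sub>R v) ^^ j) F x / fact j)) \<le> (h * h * (C * A)) * gauss_dom k (c / 2) x"
      proof (rule taylor_along_line[OF F])
        fix t :: real assume t: "0 \<le> t" "t \<le> 1"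
        have th: "0 \<le> t * h" "t * h \<le> 1" using t h by (auto intro: mult_le_one)
        have "norm (dir_deriv v (dir_deriv v F) (x + (t * h) *\<^sub>R v)) \<le> C * gauss_dom k c (x + (t * h) *\<^sub>R v)"
          by (rule bd(3))
        also have "\<dots> \<le> C * (A * gauss_dom k (c / 2) x)"
          unfolding A_def by (rule mult_left_mono[OF gauss_dom_shift[OF c th] C0])
        finally have "h * h * norm (dir_deriv v (dir_deriv v F) (x + (t * h) *\<^sub>R v)) \<le> h * h * (C * (A * gauss_dom k (c / 2) x))"
          using h by (intro mult_left_mono) auto
        then show "norm ((dir_deriv (h *\<^sub>R v) ^^ 2) F (x + t *\<^sub>R h *\<^sub>R v)) \<le> (h * h * (C * A)) * gauss_dom k (c / 2) x"
          unfolding d2 norm_mult using h by (simp add: mult_ac norm_mult)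
      qed
      then show ?thesis by (simp add: numeral_2_eq_2 d1 diff_diff_eq)
    qed
    have "norm (LINT x|lborel. (F (x + h *\<^sub>R v) - F x - of_real h * dir_deriv v F x)) \<le> (h * h * (C * A)) * I"
      unfolding I_def using c by (intro norm_integral_gauss_dominated pt) auto
    moreover have "(LINT x|lborel. (F (x + h *\<^sub>R v) - F x - of_real h * dir_deriv v F x)) = - (of_real h * (LINT x|lborel. dir_deriv v F x))"
      using iF sh[of h] by simp
    ultimately have "h * norm (LINT x|lborel. dir_deriv v F x) \<le> h * (h * (C * A * I))"
      using h by (simp add: norm_mult mult_ac)
    then show ?thesis using h by simp
  qed
  have "norm (LINT x|lborel. dir_deriv v F x) \<le> 0 + e" if e: "e > 0" for e
  proof -
    define h where "h = min 1 (e / (\<bar>C * A * I\<bar> + 1))"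
    have h: "0 < h" "h \<le> 1" using e by (auto simp: h_def)
    have "norm (LINT x|lborel. dir_deriv v F x) \<le> h * (C * A * I)" by (rule est[OF h])
    also have "\<dots> \<le> h * (\<bar>C * A * I\<bar> + 1)" using h by (intro mult_left_mono) auto
    also have "\<dots> \<le> (e / (\<bar>C * A * I\<bar> + 1)) * (\<bar>C * A * I\<bar> + 1)" by (intro mult_right_mono) (auto simp: h_def)
    also have "\<dots> = e" by simp
    finally show ?thesis by simp
  qed
  then have "norm (LINT x|lborel. dir_deriv v F x) \<le> 0" by (rule field_le_epsilon)
  then show ?thesis by simp
qed

lemma integral_by_parts:
  fixes u V :: "'a::euclidean_space \<Rightarrow> complex"
  assumes u: "smooth u" and V: "smooth V" and c: "c > 0"
    and A: "\<And>x. norm (u x) \<le> A" "\<And>x. norm (dir_deriv v u x) \<le> A" "\<And>x. norm (dir_deriv v (dir_deriv v u) x) \<le> A"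
    and D: "\<And>x. norm (V x) \<le> D * gauss_dom k c x" "\<And>x. norm (dir_deriv v V x) \<le> D * gauss_dom k c x"
      "\<And>x. norm (dir_deriv v (dir_deriv v V) x) \<le> D * gauss_dom k c x"
  shows "(LINT x|lborel. u x * dir_deriv v V x) = - (LINT x|lborel. dir_deriv v u x * V x)"
proof -
  note su = smooth_dir_deriv[OF u, of v] smooth_dir_deriv[OF smooth_dir_deriv[OF u], of v v]
  note sV = smooth_dir_deriv[OF V, of v] smooth_dir_deriv[OF smooth_dir_deriv[OF V], of v v]
  have b: "norm (f x * g x) \<le> (A * D) * gauss_dom k c x"
    if "\<And>x. norm (f x) \<le> A" "\<And>x. norm (g x) \<le> D * gauss_dom k c x" for f g :: "'a \<Rightarrow> complex" and x
    using gauss_dom_mult_le[where a="f x" and A=A and x=x and j=0 and b="g x" and D=D and k=k and c=c] that by simp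
  have d1: "dir_deriv v (\<lambda>x. u x * V x) = (\<lambda>x. u x * dir_deriv v V x + dir_deriv v u x * V x)"
    by (intro ext dir_deriv_mult smooth_differentiable u V)
  have d2: "dir_deriv v (dir_deriv v (\<lambda>x. u x * V x)) =
     (\<lambda>x. (u x * dir_deriv v (dir_deriv v V) x + dir_deriv v u x * dir_deriv v V x) + (dir_deriv v u x * dir_deriv v V x + dir_deriv v (dir_deriv v u) x * V x))"
    unfolding d1
    by (intro ext) (simp add: dir_deriv_add dir_deriv_mult smooth_differentiable u V su sV smooth_mult)
  have nn: "0 \<le> A * D * gauss_dom k c x" for x :: 'a
    using order_trans[OF norm_ge_zero b[of u V x, OF A(1) D(1)]] .
  have "(LINT x|lborel. dir_deriv v (\<lambda>x. u x * V x) x) = 0"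
  \<comment> \<open>The second derivative of the product consists of four products, each bounded by
    \<open>A * D\<close> times the majorant; hence the 4.\<close>
  proof (rule integral_dir_deriv_eq_0[OF smooth_mult[OF u V] c, of "4 * (A * D)" k])
    fix x
    show "norm (u x * V x) \<le> 4 * (A * D) * gauss_dom k c x"
      using b[of u V x, OF A(1) D(1)] nn[of x] by linarith
    show "norm (dir_deriv v (\<lambda>x. u x * V x) x) \<le> 4 * (A * D) * gauss_dom k c x"
      unfolding d1 using b[of u "dir_deriv v V" x, OF A(1) D(2)] b[of "dir_deriv v u" V x, OF A(2) D(1)] nn[of x]
        norm_triangle_ineq[of "u x * dir_deriv v V x" "dir_deriv v u x * V x"] by linarith
    show "norm (dir_deriv v (dir_deriv v (\<lambda>x. u x * V x)) x) \<le> 4 * (A * D) * gauss_dom k c x"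
      unfolding d2 using b[of u "dir_deriv v (dir_deriv v V)" x, OF A(1) D(3)] b[of "dir_deriv v u" "dir_deriv v V" x, OF A(2) D(2)] b[of "dir_deriv v (dir_deriv v u)" V x, OF A(3) D(1)]
        norm_triangle_ineq[of "u x * dir_deriv v (dir_deriv v V) x" "dir_deriv v u x * dir_deriv v V x"]
        norm_triangle_ineq[of "dir_deriv v u x * dir_deriv v V x" "dir_deriv v (dir_deriv v u) x * V x"]
        norm_triangle_ineq[of "u x * dir_deriv v (dir_deriv v V) x + dir_deriv v u x * dir_deriv v V x" "dir_deriv v u x * dir_deriv v V x + dir_deriv v (dir_deriv v u) x * V x"]
      by linarith
  qed
  moreover have "integrable lborel (\<lambda>x. f x * g x)"
    if "smooth f" "smooth g" "\<And>x. norm (f x) \<le> A" "\<And>x. norm (g x) \<le> D * gauss_dom k c x" for f g :: "'a \<Rightarrow> complex"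
    using that by (intro integrable_gauss_dominated[OF c _ b] borel_measurable_continuous_onI smooth_continuous smooth_mult)
  then have "integrable lborel (\<lambda>x. u x * dir_deriv v V x)" "integrable lborel (\<lambda>x. dir_deriv v u x * V x)"
    using u V su sV A D by blast+
  ultimately show ?thesis
    unfolding d1 by (simp add: eq_neg_iff_add_eq_0)
qed

text \<open>Derivatives move one at a time from the Gaussian to \<open>u\<close>. Bounds on the
  derivatives of \<open>u\<close> of every order are assumed so that the hypothesis passes to
  \<open>dir_deriv v u\<close> in the induction.\<close>

lemma integral_by_parts_gauss:
  fixes u :: "'a::euclidean_space \<Rightarrow> complex"
  assumes u: "smooth u" and bd: "\<And>ws. \<exists>A. \<forall>x. norm (foldr dir_deriv ws u x) \<le> A"
  shows "(LINT x|lborel. u x * foldr dir_deriv vs gauss x) =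
    (- 1) ^ length vs * (LINT x|lborel. foldr dir_deriv vs u x * gauss x)"
  using u bd
proof (induction vs arbitrary: u)
  case (Cons v vs)
  have bd': "\<And>ws. \<exists>A. \<forall>x. norm (foldr dir_deriv ws (dir_deriv v u) x) \<le> A"
  proof -
    fix ws show "\<exists>A. \<forall>x. norm (foldr dir_deriv ws (dir_deriv v u) x) \<le> A"
      using Cons.prems(2)[of "ws @ [v]"] by simp
  qed
  let ?V = "foldr dir_deriv vs gauss"
  obtain A1 where A1: "\<And>x. norm (u x) \<le> A1" using Cons.prems(2)[of "[]"] by auto
  obtain A2 where A2: "\<And>x. norm (dir_deriv v u x) \<le> A2" using Cons.prems(2)[of "[v]"] by auto
  obtain A3 where A3: "\<And>x. norm (dir_deriv v (dir_deriv v u) x) \<le> A3" using Cons.prems(2)[of "[v, v]"] by auto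
  define A where "A = max A1 (max A2 A3)"
  obtain D1 k1 where D1: "D1 \<ge> 0" "\<And>x. norm (?V x) \<le> D1 * gauss_dom k1 (1 / 4) x" using gauss_derivs_bound[of vs] by auto
  obtain D2 k2 where D2: "D2 \<ge> 0" "\<And>x. norm (dir_deriv v ?V x) \<le> D2 * gauss_dom k2 (1 / 4) x" using gauss_derivs_bound[of "v # vs"] by auto
  obtain D3 k3 where D3: "D3 \<ge> 0" "\<And>x. norm (dir_deriv v (dir_deriv v ?V) x) \<le> D3 * gauss_dom k3 (1 / 4) x" using gauss_derivs_bound[of "v # v # vs"] by auto
  define D where "D = max D1 (max D2 D3)"
  define k where "k = max k1 (max k2 k3)"
  have gd: "D' * gauss_dom k' (1 / 4) x \<le> D * gauss_dom k (1 / 4) x" if "0 \<le> D'" "D' \<le> D" "k' \<le> k" for D' k' and x :: 'a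
    using that unfolding gauss_dom_def by (intro mult_mono mult_right_mono power_increasing) auto
  have "(LINT x|lborel. u x * dir_deriv v ?V x) = - (LINT x|lborel. dir_deriv v u x * ?V x)"
  proof (rule integral_by_parts[OF Cons.prems(1) smooth_foldr_dir_deriv[OF smooth_gauss], where c="1/4" and A=A and D=D and k=k])
    fix x
    show "norm (u x) \<le> A" "norm (dir_deriv v u x) \<le> A" "norm (dir_deriv v (dir_deriv v u) x) \<le> A"
      using A1[of x] A2[of x] A3[of x] by (auto simp: A_def)
    show "norm (?V x) \<le> D * gauss_dom k (1 / 4) x"
      using D1 by (intro order_trans[OF D1(2) gd]) (auto simp: D_def k_def)
    show "norm (dir_deriv v ?V x) \<le> D * gauss_dom k (1 / 4) x"
      using D2 by (intro order_trans[OF D2(2) gd]) (auto simp: D_def k_def)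
    show "norm (dir_deriv v (dir_deriv v ?V) x) \<le> D * gauss_dom k (1 / 4) x"
      using D3 by (intro order_trans[OF D3(2) gd]) (auto simp: D_def k_def)
  qed simp
  \<comment> \<open>The induction hands \<open>v\<close> to \<open>u\<close> as the innermost
    derivative, whereas the claim has it outermost.\<close>
  moreover have "foldr dir_deriv vs (dir_deriv v u) = foldr dir_deriv (v # vs) u"
    using foldr_dir_deriv_mset_cong[OF Cons.prems(1), of "vs @ [v]" "v # vs"] by simp
  ultimately show ?case
    using Cons.IH[OF smooth_dir_deriv[OF Cons.prems(1)] bd'] by simp
qed simp

lemma polyf_prod_list: "polyf (\<lambda>s. of_real (prod_list (map (\<lambda>v. v \<bullet> s) vs)))"
proof (induction vs)
  case (Cons v vs)
  then show ?case
    using polyf.mult[OF polyf.inner[of v] Cons] by (simp add: inner_commute)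
qed (auto intro: polyf.const)

text \<open>Differentiation under the integral sign. The first-order expansion of the exponential
  has an error of size t^2 (u . s)^2, which the Gaussian majorant absorbs, so the difference
  quotient converges with an explicit rate.\<close>

lemma has_vector_derivative_fourier:
  fixes f :: "'a::euclidean_space \<Rightarrow> complex" and z u :: 'a
  assumes [measurable]: "f \<in> borel_measurable borel" and c: "c > 0" and f: "\<And>s. norm (f s) \<le> C * gauss_dom k c s"
  shows "((\<lambda>t. LINT s|lborel. f s * exp (\<i> * of_real ((z + t *\<^sub>R u) \<bullet> s))) has_vector_derivative
    (LINT s|lborel. \<i> * of_real (u \<bullet> s) * f s * exp (\<i> * of_real (z \<bullet> s)))) (at 0)"
proof -
  have C0: "C \<ge> 0" using f[of 0] by (simp add: gauss_dom_def order_trans[OF norm_ge_zero])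
  have us: "norm (complex_of_real (u \<bullet> s)) \<le> norm u * (1 + norm s) ^ 1" for s
  proof -
    have "norm (complex_of_real (u \<bullet> s)) \<le> norm u * norm s" by (simp add: Cauchy_Schwarz_ineq2)
    also have "\<dots> \<le> norm u * (1 + norm s) ^ 1" by (intro mult_left_mono) auto
    finally show ?thesis .
  qed
  have us2: "norm (complex_of_real ((u \<bullet> s)\<^sup>2)) \<le> (norm u)\<^sup>2 * (1 + norm s) ^ 2" for s
    using power_mono[OF us[of s], of 2] by (simp add: power_mult_distrib norm_power)
  have i0: "integrable lborel (\<lambda>s. f s * exp (\<i> * of_real (w \<bullet> s)))" for w
    using f by (intro integrable_gauss_dominated[OF c, of _ C k]) (auto simp: norm_mult)
  have i1: "integrable lborel (\<lambda>s. \<i> * of_real (u \<bullet> s) * f s * exp (\<i> * of_real (z \<bullet> s)))"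
    using gauss_dom_mult_le[OF us f]
    by (intro integrable_gauss_dominated[OF c, of _ "norm u * C" "1 + k"]) (auto simp: norm_mult)
  define I where "I = (LINT s|lborel. gauss_dom (2 + k) c (s::'a))"
  have est: "norm ((LINT s|lborel. f s * exp (\<i> * of_real ((z + t *\<^sub>R u) \<bullet> s))) - (LINT s|lborel. f s * exp (\<i> * of_real (z \<bullet> s)))
      - t *\<^sub>R (LINT s|lborel. \<i> * of_real (u \<bullet> s) * f s * exp (\<i> * of_real (z \<bullet> s)))) \<le> (t\<^sup>2 * ((norm u)\<^sup>2 * C)) * I" for t
  proof -
    define g where "g s = f s * exp (\<i> * of_real ((z + t *\<^sub>R u) \<bullet> s)) - f s * exp (\<i> * of_real (z \<bullet> s))
        - t *\<^sub>R (\<i> * of_real (u \<bullet> s) * f s * exp (\<i> * of_real (z \<bullet> s)))" for s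
    have "g s = f s * exp (\<i> * of_real (z \<bullet> s)) * (exp (\<i> * of_real (t * (u \<bullet> s))) - (\<Sum>j\<le>1. (\<i> * of_real (t * (u \<bullet> s))) ^ j / fact j))" for s
      by (simp add: g_def inner_add_left distrib_left exp_add scaleR_conv_of_real algebra_simps)
    then have "norm (g s) \<le> norm (f s) * (\<bar>t * (u \<bullet> s)\<bar> ^ Suc 1 / fact (Suc 1))" for s
      using iexp_approx1[of "t * (u \<bullet> s)" 1] by (simp only: norm_mult norm_exp_i_times mult_1_right) (intro mult_left_mono, auto)
    moreover have "norm (f s) * (\<bar>t * (u \<bullet> s)\<bar> ^ Suc 1 / fact (Suc 1)) \<le> (t\<^sup>2 * ((norm u)\<^sup>2 * C)) * gauss_dom (2 + k) c s" for s
    proof -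
      have "norm (f s) * (\<bar>t * (u \<bullet> s)\<bar> ^ Suc 1 / fact (Suc 1)) \<le> t\<^sup>2 * norm (complex_of_real ((u \<bullet> s)\<^sup>2) * f s)"
      proof -
        have "\<bar>a\<bar> ^ Suc 1 / fact (Suc 1) \<le> a\<^sup>2" for a :: real by (simp add: fact_numeral power2_eq_square)
        then have "\<bar>t * (u \<bullet> s)\<bar> ^ Suc 1 / fact (Suc 1) \<le> t\<^sup>2 * (u \<bullet> s)\<^sup>2" by (metis power_mult_distrib)
        then have "norm (f s) * (\<bar>t * (u \<bullet> s)\<bar> ^ Suc 1 / fact (Suc 1)) \<le> norm (f s) * (t\<^sup>2 * (u \<bullet> s)\<^sup>2)"
          by (rule mult_left_mono) simp
        also have "\<dots> = t\<^sup>2 * norm (complex_of_real ((u \<bullet> s)\<^sup>2) * f s)"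
          by (simp add: norm_mult norm_power)
        finally show ?thesis .
      qed
      also have "\<dots> \<le> t\<^sup>2 * ((norm u)\<^sup>2 * C * gauss_dom (2 + k) c s)"
        by (intro mult_left_mono gauss_dom_mult_le us2 f) auto
      finally show ?thesis by (simp add: mult_ac)
    qed
    ultimately have "norm (g s) \<le> (t\<^sup>2 * ((norm u)\<^sup>2 * C)) * gauss_dom (2 + k) c s" for s
      using order_trans by blast
    then have "norm (LINT s|lborel. g s) \<le> (t\<^sup>2 * ((norm u)\<^sup>2 * C)) * I"
      unfolding I_def by (rule norm_integral_gauss_dominated[OF c])
    moreover have "(LINT s|lborel. g s) = (LINT s|lborel. f s * exp (\<i> * of_real ((z + t *\<^sub>R u) \<bullet> s))) - (LINT s|lborel. f s * exp (\<i> * of_real (z \<bullet> s)))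
      - t *\<^sub>R (LINT s|lborel. \<i> * of_real (u \<bullet> s) * f s * exp (\<i> * of_real (z \<bullet> s)))"
      unfolding g_def using i0 i1 by (simp add: Bochner_Integration.integral_diff Bochner_Integration.integrable_diff)
    ultimately show ?thesis by simp
  qed
  define Q where "Q = ((norm u)\<^sup>2 * C) * I"
  let ?\<Phi> = "\<lambda>t. LINT s|lborel. f s * exp (\<i> * of_real ((z + t *\<^sub>R u) \<bullet> s))"
  let ?d = "LINT s|lborel. \<i> * of_real (u \<bullet> s) * f s * exp (\<i> * of_real (z \<bullet> s))"
  show ?thesis
    unfolding has_vector_derivative_def has_derivative_at
  proof (intro conjI bounded_linear_scaleR_left)
    show "(\<lambda>t. norm (?\<Phi> (0 + t) - ?\<Phi> 0 - t *\<^sub>R ?d) / norm t) \<midarrow>0\<rightarrow> 0"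
    proof (rule Lim_null_comparison[of _ "\<lambda>t. \<bar>t\<bar> * Q"])
      have "norm (norm (?\<Phi> (0 + t) - ?\<Phi> 0 - t *\<^sub>R ?d) / norm t) \<le> \<bar>t\<bar> * Q" if "t \<noteq> 0" for t
        using est[of t] that by (simp add: Q_def divide_le_eq power2_eq_square mult_ac)
      then show "\<forall>\<^sub>F t in at 0. norm (norm (?\<Phi> (0 + t) - ?\<Phi> 0 - t *\<^sub>R ?d) / norm t) \<le> \<bar>t\<bar> * Q"
        unfolding eventually_at_filter by (intro always_eventually) auto
      show "((\<lambda>t. \<bar>t\<bar> * Q) \<longlongrightarrow> 0) (at (0::real))"
        by (rule tendsto_eq_intros refl)+ auto
    qed
  qed
qed

text \<open>The Gaussian is, up to \<open>gauss_mass\<close>, its own Fourier transform, and a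
  factor v . s under the integral, multiplied by i, amounts to a derivative of that transform in the
  direction v.\<close>

lemma fourier_poly_gauss:
  fixes z :: "'a::euclidean_space"
  shows "\<i> ^ length vs * (LINT s|lborel. of_real (prod_list (map (\<lambda>v. v \<bullet> s) vs)) * gauss s * exp (\<i> * of_real (z \<bullet> s))) =
    gauss_mass TYPE('a) * foldr dir_deriv vs gauss z"
proof (induction vs arbitrary: z)
  case Nil
  then show ?case using integral_iexp_gauss[of z] by (simp add: mult.commute)
next
  case (Cons u vs)
  define f :: "'a \<Rightarrow> complex" where "f s = of_real (prod_list (map (\<lambda>v. v \<bullet> s) vs)) * gauss s" for s
  have p: "polyf (\<lambda>s. complex_of_real (prod_list (map (\<lambda>v. v \<bullet> s) vs)))" by (rule polyf_prod_list)
  have fm: "f \<in> borel_measurable borel"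
    unfolding f_def[abs_def] using borel_measurable_continuous_onI[OF polyf_continuous[OF p]] by measurable
  obtain C k where C: "C \<ge> 0" "\<And>s. norm (complex_of_real (prod_list (map (\<lambda>v. v \<bullet> s) vs))) \<le> C * (1 + norm s) ^ k"
    using polyf_bound[OF p] by blast
  have fb: "norm (f s) \<le> (C * 1) * gauss_dom (k + 0) (1 / 2) s" for s
    unfolding f_def by (rule gauss_dom_mult_le[OF C(2) norm_gauss_le])
  have "\<i> ^ length (u # vs) * (LINT s|lborel. of_real (prod_list (map (\<lambda>v. v \<bullet> s) (u # vs))) * gauss s * exp (\<i> * of_real (z \<bullet> s)))
      = \<i> ^ length vs * (LINT s|lborel. \<i> * of_real (u \<bullet> s) * f s * exp (\<i> * of_real (z \<bullet> s)))"
    by (simp add: f_def mult.assoc)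
  also have "\<dots> = \<i> ^ length vs * vector_derivative (\<lambda>t. LINT s|lborel. f s * exp (\<i> * of_real ((z + t *\<^sub>R u) \<bullet> s))) (at 0)"
    using vector_derivative_at[OF has_vector_derivative_fourier[OF fm _ fb, of z u]] by simp
  also have "\<dots> = dir_deriv u (\<lambda>z. \<i> ^ length vs * (LINT s|lborel. f s * exp (\<i> * of_real (z \<bullet> s)))) z"
    unfolding dir_deriv_def
    by (intro vector_derivative_at[symmetric] has_vector_derivative_mult_right)
      (use vector_derivative_at[OF has_vector_derivative_fourier[OF fm _ fb, of z u]] has_vector_derivative_fourier[OF fm _ fb, of z u] in simp)
  \<comment> \<open>The induction hypothesis holds at every point, so it may be differentiated in
    \<open>z\<close>.\<close>
  also have "(\<lambda>z. \<i> ^ length vs * (LINT s|lborel. f s * exp (\<i> * of_real (z \<bullet> s)))) = (\<lambda>z. gauss_mass TYPE('a) * foldr dir_deriv vs gauss z)"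
    unfolding f_def by (intro ext Cons)
  also have "dir_deriv u (\<lambda>z. gauss_mass TYPE('a) * foldr dir_deriv vs gauss z) z = gauss_mass TYPE('a) * foldr dir_deriv (u # vs) gauss z"
    by (simp add: dir_deriv_cmult smooth_foldr_dir_deriv smooth_gauss)
  finally show ?case .
qed

section \<open>Wave packets and the transposition identity\<close>

text \<open>Stated without integrability or measurability: a function that is not measurable stays
  so under the substitution, and both integrals then have the default value 0. The integrals in
  \<open>bilinear_op\<close> and \<open>pairing\<close> can thus be rescaled before any convergence
  is established.\<close>

lemma integral_lborel_affine:
  fixes f :: "'a::euclidean_space \<Rightarrow> complex"
  assumes c: "c \<noteq> 0"
  shows "(LINT x|lborel. f x) = of_real (\<bar>c\<bar> ^ DIM('a)) * (LINT x|lborel. f (t + c *\<^sub>R x))"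
proof (cases "f \<in> borel_measurable borel")
  case True
  have T: "(\<lambda>x. t + c *\<^sub>R x) \<in> measurable lborel borel" by simp
  have m: "f \<in> borel_measurable (distr lborel borel (\<lambda>x. t + c *\<^sub>R x))" using True by simp
  have "(LINT x|lborel. f x) = (LINT x|density (distr lborel borel (\<lambda>x. t + c *\<^sub>R x)) (\<lambda>_. ennreal (\<bar>c\<bar> ^ DIM('a))). f x)"
    using lborel_affine[OF c, of t] by (simp add: ennreal_power)
  also have "\<dots> = (LINT x|distr lborel borel (\<lambda>x. t + c *\<^sub>R x). \<bar>c\<bar> ^ DIM('a) *\<^sub>R f x)"
    by (subst integral_density[OF m]) auto
  also have "\<dots> = (LINT x|lborel. \<bar>c\<bar> ^ DIM('a) *\<^sub>R f (t + c *\<^sub>R x))"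
    using True by (subst integral_distr[OF T]) auto
  finally show ?thesis by (simp add: scaleR_conv_of_real)
next
  case False
  have "(\<lambda>x. f (t + c *\<^sub>R x)) \<notin> borel_measurable borel"
  proof
    assume m: "(\<lambda>x. f (t + c *\<^sub>R x)) \<in> borel_measurable borel"
    have "(\<lambda>x. f (t + c *\<^sub>R ((1 / c) *\<^sub>R (x - t)))) \<in> borel_measurable borel"
      by (rule measurable_compose[OF _ m]) simp
    then show False using False c by simp
  qed
  then have "\<not> integrable lborel f" "\<not> integrable lborel (\<lambda>x. f (t + c *\<^sub>R x))"
    using False borel_measurable_integrable by fastforce+
  then show ?thesis by (simp add: not_integrable_integral_eq)
qed

lemma gauss_minus: "gauss (- x) = gauss x"
  by (simp add: gauss_def)

lemma packet_rescaled:
  "packet a y \<theta> (y + u) = exp (\<i> * of_real (\<theta> \<bullet> u)) * gauss (a *\<^sub>R u)"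
  unfolding packet_def gauss_def exp_of_real[symmetric] exp_add[symmetric] by (simp add: power_mult_distrib)

text \<open>The factor carried by every transform of a packet. It occurs equally on both sides of
  the transposition identity, so what matters is that it does not vanish.\<close>

definition packet_const :: "'n::finite itself \<Rightarrow> complex"
  where "packet_const _ = of_real (1 / (2 * pi) ^ CARD('n)) * gauss_mass TYPE(real^'n)"

lemma packet_const_nonzero: "packet_const TYPE('n::finite) \<noteq> 0"
  by (simp add: packet_const_def gauss_mass_nonzero)

text \<open>A packet of width 1/a has a Gaussian transform of width \<open>a\<close> about its
  frequency. The power of \<open>a\<close> on the left is the Jacobian of the substitution \<theta>
  + a s, which is absorbed when the formula is used inside an integral.\<close>

lemma fourier_packet:
  fixes y \<theta> s :: "real^'n::finite"
  assumes a: "a > 0"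
  shows "of_real (a ^ CARD('n)) * fourier (packet a y \<theta>) (\<theta> + a *\<^sub>R s) =
    packet_const TYPE('n) * exp (- \<i> * of_real (y \<bullet> (\<theta> + a *\<^sub>R s))) * gauss s"
proof -
  let ?\<xi> = "\<theta> + a *\<^sub>R s"
  have "(LINT x|lborel. packet a y \<theta> x * exp (- \<i> * of_real (x \<bullet> ?\<xi>))) =
      of_real (\<bar>1 / a\<bar> ^ CARD('n)) * (LINT u|lborel. packet a y \<theta> (y + (1 / a) *\<^sub>R u) * exp (- \<i> * of_real ((y + (1 / a) *\<^sub>R u) \<bullet> ?\<xi>)))"
    using a by (subst integral_lborel_affine[where c="1 / a" and t=y]) simp_all
  also have "(\<lambda>u. packet a y \<theta> (y + (1 / a) *\<^sub>R u) * exp (- \<i> * of_real ((y + (1 / a) *\<^sub>R u) \<bullet> ?\<xi>))) =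
      (\<lambda>u. exp (- \<i> * of_real (y \<bullet> ?\<xi>)) * (exp (\<i> * of_real ((- s) \<bullet> u)) * gauss u))"
  proof
    fix u
    have "packet a y \<theta> (y + (1 / a) *\<^sub>R u) * exp (- \<i> * of_real ((y + (1 / a) *\<^sub>R u) \<bullet> ?\<xi>)) =
      exp (\<i> * of_real (\<theta> \<bullet> ((1 / a) *\<^sub>R u)) + - \<i> * of_real ((y + (1 / a) *\<^sub>R u) \<bullet> ?\<xi>)) * gauss u"
      using a by (simp only: packet_rescaled exp_add) (simp add: mult_ac)
    also have "\<i> * complex_of_real (\<theta> \<bullet> ((1 / a) *\<^sub>R u)) + - \<i> * of_real ((y + (1 / a) *\<^sub>R u) \<bullet> ?\<xi>) =
      - \<i> * of_real (y \<bullet> ?\<xi>) + \<i> * of_real ((- s) \<bullet> u)"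
    proof -
      have "\<theta> \<bullet> ((1 / a) *\<^sub>R u) - (y + (1 / a) *\<^sub>R u) \<bullet> ?\<xi> = - (y \<bullet> ?\<xi>) + (- s) \<bullet> u"
        using a by (simp add: inner_add_left inner_add_right inner_commute field_simps)
      then have "complex_of_real (\<theta> \<bullet> ((1 / a) *\<^sub>R u)) - of_real ((y + (1 / a) *\<^sub>R u) \<bullet> ?\<xi>) = - of_real (y \<bullet> ?\<xi>) + of_real ((- s) \<bullet> u)"
        by (simp only: flip: of_real_diff of_real_add of_real_minus)
      then have "\<i> * (complex_of_real (\<theta> \<bullet> ((1 / a) *\<^sub>R u)) - of_real ((y + (1 / a) *\<^sub>R u) \<bullet> ?\<xi>)) = \<i> * (- of_real (y \<bullet> ?\<xi>) + of_real ((- s) \<bullet> u))"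
        by (simp only:)
      then show ?thesis by (simp only: ring_distribs) simp
    qed
    finally show "packet a y \<theta> (y + (1 / a) *\<^sub>R u) * exp (- \<i> * of_real ((y + (1 / a) *\<^sub>R u) \<bullet> ?\<xi>)) =
      exp (- \<i> * of_real (y \<bullet> ?\<xi>)) * (exp (\<i> * of_real ((- s) \<bullet> u)) * gauss u)"
      by (simp only: exp_add mult.assoc)
  qed
  also have "(LINT u|lborel. exp (- \<i> * of_real (y \<bullet> ?\<xi>)) * (exp (\<i> * of_real ((- s) \<bullet> u)) * gauss u)) =
      exp (- \<i> * of_real (y \<bullet> ?\<xi>)) * (gauss_mass TYPE(real^'n) * gauss s)"
    by (simp only: integral_mult_right_zero integral_iexp_gauss gauss_minus)
  finally show ?thesis
    using a by (simp add: fourier_def packet_const_def power_one_over field_simps)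
qed

lemma bilinear_op_packets:
  fixes \<sigma> :: "'n::finite bisymbol"
  assumes r: "r > 0" and \<nu>: "\<nu> > 0"
  shows "bilinear_op \<sigma> (packet r y c) (packet \<nu> y e) x = (packet_const TYPE('n))\<^sup>2 *
    (LINT t|lborel. LINT s|lborel. \<sigma> x (c + r *\<^sub>R s) (e + \<nu> *\<^sub>R t) * gauss s * gauss t *
      exp (\<i> * of_real ((x - y) \<bullet> (c + r *\<^sub>R s + e + \<nu> *\<^sub>R t))))"
proof -
  let ?n = "CARD('n)" and ?k = "packet_const TYPE('n)"
  have "bilinear_op \<sigma> (packet r y c) (packet \<nu> y e) x = of_real (\<bar>\<nu>\<bar> ^ ?n) * (LINT t|lborel. of_real (\<bar>r\<bar> ^ ?n) * (LINT s|lborel.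
     \<sigma> x (c + r *\<^sub>R s) (e + \<nu> *\<^sub>R t) * fourier (packet r y c) (c + r *\<^sub>R s) * fourier (packet \<nu> y e) (e + \<nu> *\<^sub>R t) *
      exp (\<i> * complex_of_real (x \<bullet> (c + r *\<^sub>R s + (e + \<nu> *\<^sub>R t))))))"
    unfolding bilinear_op_def
    by (subst integral_lborel_affine[where c=\<nu> and t=e], use \<nu> in simp,
        subst integral_lborel_affine[where c=r and t=c], use r in simp, simp)
  also have "\<dots> = (LINT t|lborel. LINT s|lborel.
     \<sigma> x (c + r *\<^sub>R s) (e + \<nu> *\<^sub>R t) * (of_real (r ^ ?n) * fourier (packet r y c) (c + r *\<^sub>R s)) * (of_real (\<nu> ^ ?n) * fourier (packet \<nu> y e) (e + \<nu> *\<^sub>R t)) *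
      exp (\<i> * complex_of_real (x \<bullet> (c + r *\<^sub>R s + (e + \<nu> *\<^sub>R t)))))"
    using r \<nu> by (simp only: integral_mult_right_zero[symmetric] abs_of_pos) (simp add: mult_ac)
  also have "\<dots> = (LINT t|lborel. LINT s|lborel. ?k\<^sup>2 * (\<sigma> x (c + r *\<^sub>R s) (e + \<nu> *\<^sub>R t) * gauss s * gauss t *
      exp (\<i> * of_real ((x - y) \<bullet> (c + r *\<^sub>R s + e + \<nu> *\<^sub>R t)))))"
  proof (intro Bochner_Integration.integral_cong refl)
    fix s t
    let ?\<xi> = "c + r *\<^sub>R s" and ?\<eta> = "e + \<nu> *\<^sub>R t"
    have "exp (- \<i> * of_real (y \<bullet> ?\<xi>)) * exp (- \<i> * of_real (y \<bullet> ?\<eta>)) * exp (\<i> * of_real (x \<bullet> (?\<xi> + ?\<eta>))) =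
       exp (- \<i> * of_real (y \<bullet> ?\<xi>) + - \<i> * of_real (y \<bullet> ?\<eta>) + \<i> * of_real (x \<bullet> (?\<xi> + ?\<eta>)))"
      by (simp only: exp_add)
    also have "- \<i> * of_real (y \<bullet> ?\<xi>) + - \<i> * of_real (y \<bullet> ?\<eta>) + \<i> * of_real (x \<bullet> (?\<xi> + ?\<eta>)) = \<i> * complex_of_real ((x - y) \<bullet> (c + r *\<^sub>R s + e + \<nu> *\<^sub>R t))"
      by (simp add: inner_add_right inner_diff_left algebra_simps)
    finally have E: "exp (- \<i> * of_real (y \<bullet> ?\<xi>)) * exp (- \<i> * of_real (y \<bullet> ?\<eta>)) * exp (\<i> * of_real (x \<bullet> (?\<xi> + ?\<eta>))) =
       exp (\<i> * complex_of_real ((x - y) \<bullet> (c + r *\<^sub>R s + e + \<nu> *\<^sub>R t)))" .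
    show "\<sigma> x ?\<xi> ?\<eta> * (of_real (r ^ ?n) * fourier (packet r y c) ?\<xi>) * (of_real (\<nu> ^ ?n) * fourier (packet \<nu> y e) ?\<eta>) *
      exp (\<i> * complex_of_real (x \<bullet> (?\<xi> + ?\<eta>))) = ?k\<^sup>2 * (\<sigma> x ?\<xi> ?\<eta> * gauss s * gauss t *
      exp (\<i> * of_real ((x - y) \<bullet> (c + r *\<^sub>R s + e + \<nu> *\<^sub>R t))))"
      unfolding fourier_packet[OF r] fourier_packet[OF \<nu>] E[symmetric] by (simp add: power2_eq_square mult_ac)
  qed
  finally show ?thesis by (simp only: integral_mult_right_zero)
qed

definition packet_integrand ::
  "('n::finite phase \<Rightarrow> complex) \<Rightarrow> real^'n \<Rightarrow> real^'n \<Rightarrow> real^'n \<Rightarrow> real \<Rightarrow> real \<Rightarrow> real \<Rightarrow> real \<Rightarrow> 'n phase \<Rightarrow> complex"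
  where "packet_integrand F y c e r l q \<nu> = (\<lambda>(z, t, s). F (y + (1 / l) *\<^sub>R z, c + r *\<^sub>R s, e + \<nu> *\<^sub>R t) *
    gauss s * gauss t * exp (\<i> * of_real ((1 / l) * (z \<bullet> (r *\<^sub>R s + \<nu> *\<^sub>R t)))) * gauss (q *\<^sub>R z))"

text \<open>The third packet has frequency - c - e, which cancels the carrier oscillation of the
  other two; only the rescaled deviations r s + \<nu> t remain in the phase.\<close>

lemma pairing_packets:
  fixes \<sigma> :: "'n::finite bisymbol"
  assumes r: "r > 0" and \<nu>: "\<nu> > 0" and l: "l > 0"
  shows "of_real (l ^ CARD('n)) * pairing (bilinear_op \<sigma> (packet r y c) (packet \<nu> y e)) (packet (l * q) y (- c - e)) =
    (packet_const TYPE('n))\<^sup>2 * (LINT z|lborel. LINT t|lborel. LINT s|lborel. packet_integrand (uncurry3 \<sigma>) y c e r l q \<nu> (z, t, s))"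
proof -
  let ?n = "CARD('n)" and ?k = "packet_const TYPE('n)"
  let ?I = "\<lambda>x s t. \<sigma> x (c + r *\<^sub>R s) (e + \<nu> *\<^sub>R t) * gauss s * gauss t *
      exp (\<i> * of_real ((x - y) \<bullet> (c + r *\<^sub>R s + e + \<nu> *\<^sub>R t)))"
  have "pairing (bilinear_op \<sigma> (packet r y c) (packet \<nu> y e)) (packet (l * q) y (- c - e)) =
    of_real (\<bar>1 / l\<bar> ^ ?n) * (LINT z|lborel. ?k\<^sup>2 * (LINT t|lborel. LINT s|lborel. ?I (y + (1 / l) *\<^sub>R z) s t) * packet (l * q) y (- c - e) (y + (1 / l) *\<^sub>R z))"
    unfolding pairing_def bilinear_op_packets[OF r \<nu>]
    using l by (subst integral_lborel_affine[where c="1 / l" and t=y]) simp_all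
  also have "\<dots> = of_real (\<bar>1 / l\<bar> ^ ?n) * (?k\<^sup>2 * (LINT z|lborel. LINT t|lborel. LINT s|lborel. ?I (y + (1 / l) *\<^sub>R z) s t * packet (l * q) y (- c - e) (y + (1 / l) *\<^sub>R z)))"
    by (simp only: mult.assoc integral_mult_right_zero, simp only: mult.assoc integral_mult_left_zero[symmetric])
  also have "(\<lambda>z s t. ?I (y + (1 / l) *\<^sub>R z) s t * packet (l * q) y (- c - e) (y + (1 / l) *\<^sub>R z)) =
      (\<lambda>z s t. packet_integrand (uncurry3 \<sigma>) y c e r l q \<nu> (z, t, s))"
  proof (intro ext)
    fix z s t
    have "exp (\<i> * complex_of_real (((1 / l) *\<^sub>R z) \<bullet> (c + r *\<^sub>R s + e + \<nu> *\<^sub>R t))) * exp (\<i> * of_real ((- c - e) \<bullet> ((1 / l) *\<^sub>R z))) =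
       exp (\<i> * complex_of_real (((1 / l) *\<^sub>R z) \<bullet> (c + r *\<^sub>R s + e + \<nu> *\<^sub>R t)) + \<i> * of_real ((- c - e) \<bullet> ((1 / l) *\<^sub>R z)))"
      by (simp only: exp_add)
    also have "\<i> * complex_of_real (((1 / l) *\<^sub>R z) \<bullet> (c + r *\<^sub>R s + e + \<nu> *\<^sub>R t)) + \<i> * of_real ((- c - e) \<bullet> ((1 / l) *\<^sub>R z)) =
       \<i> * of_real ((1 / l) * (z \<bullet> (r *\<^sub>R s + \<nu> *\<^sub>R t)))"
      by (simp add: inner_add_right inner_diff_left inner_commute algebra_simps)
    finally have E: "exp (\<i> * complex_of_real (((1 / l) *\<^sub>R z) \<bullet> (c + r *\<^sub>R s + e + \<nu> *\<^sub>R t))) * exp (\<i> * of_real ((- c - e) \<bullet> ((1 / l) *\<^sub>R z))) =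
      exp (\<i> * of_real ((1 / l) * (z \<bullet> (r *\<^sub>R s + \<nu> *\<^sub>R t))))" .
    have L: "(l * q) *\<^sub>R ((1 / l) *\<^sub>R z) = q *\<^sub>R z" using l by simp
    have d: "y + (1 / l) *\<^sub>R z - y = (1 / l) *\<^sub>R z" by simp
    show "?I (y + (1 / l) *\<^sub>R z) s t * packet (l * q) y (- c - e) (y + (1 / l) *\<^sub>R z) = packet_integrand (uncurry3 \<sigma>) y c e r l q \<nu> (z, t, s)"
      unfolding packet_rescaled L d packet_integrand_def uncurry3_def prod.case E[symmetric] by (simp only: mult_ac)
  qed
  finally show ?thesis using l by (simp add: power_one_over)
qed

lemma integral_lborel_iterated:
  fixes f :: "'a::euclidean_space \<times> 'b::euclidean_space \<Rightarrow> complex"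
  assumes "integrable lborel f"
  shows "(LINT x|lborel. LINT y|lborel. f (x, y)) = (LINT p|lborel. f p)"
  using lborel_pair.integral_fst'[of f] assms unfolding lborel_prod by simp

text \<open>Where only integrability is at stake an integer power is enough, and it fits the
  majorant \<open>gauss_dom\<close>.\<close>

lemma wt_power_bound:
  assumes F: "F \<in> symbol_class \<rho> \<delta> m"
  obtains C k where "C > 0" "\<And>p. norm (F p) \<le> C * wt p ^ k"
proof -
  obtain C where C: "C > 0" "\<And>p. norm (F p) \<le> C * wt p powr m"
    using symbol_class_bound[OF F] by blast
  define k where "k = nat \<lceil>\<bar>m\<bar>\<rceil>"
  have "norm (F p) \<le> C * wt p ^ k" for p
  proof -
    have "m \<le> real k" unfolding k_def by linarith
    then have "wt p powr m \<le> wt p powr real k" by (intro powr_mono wt_ge_1)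
    also have "\<dots> = wt p ^ k" by (rule powr_realpow[OF wt_pos])
    finally show ?thesis using C(2)[of p] C(1) by (meson less_imp_le mult_left_mono order_trans)
  qed
  then show ?thesis using that C(1) by blast
qed

lemma packet_integrand_continuous:
  assumes F: "smooth F"
  shows "continuous_on UNIV (packet_integrand F y c e r l q \<nu>)"
proof -
  note cF = continuous_on_compose2[OF smooth_continuous[OF F] _ subset_UNIV]
  note cg = continuous_on_compose2[OF smooth_continuous[OF smooth_gauss] _ subset_UNIV]
  show ?thesis
    unfolding packet_integrand_def case_prod_unfold
    by (intro continuous_on_mult cF cg continuous_on_exp continuous_on_of_real continuous_intros)
qed

text \<open>Uniform in \<nu>, as dominated convergence demands. The symbol contributes polynomial
  growth in \<open>s\<close> and \<open>t\<close>; decay in \<open>z\<close> comes from the third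
  packet, hence \<open>q \<noteq> 0\<close>.\<close>

lemma packet_integrand_bound:
  fixes F :: "'n::finite phase \<Rightarrow> complex"
  assumes F: "F \<in> symbol_class \<rho> \<delta> m" and q: "q \<noteq> 0"
  shows "\<exists>C k a. a > 0 \<and> (\<forall>\<nu> p. 0 \<le> \<nu> \<longrightarrow> \<nu> \<le> 1 \<longrightarrow> norm (packet_integrand F y c e r l q \<nu> p) \<le> C * gauss_dom k a p)"
proof -
  obtain C k where C: "C > 0" "\<And>p. norm (F p) \<le> C * wt p ^ k" using wt_power_bound[OF F] by blast
  define K where "K = 1 + norm c + \<bar>r\<bar> + norm e + 1"
  \<comment> \<open>The smallest of the three Gaussian exponents 1/2, 1/2 and q^2/2.\<close>
  define a where "a = min 1 (q\<^sup>2) / 2"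
  have a: "a > 0" "a \<le> 1 / 2" "a \<le> q\<^sup>2 / 2" using q by (auto simp: a_def)
  have "norm (packet_integrand F y c e r l q \<nu> p) \<le> (C * K ^ k) * gauss_dom k a p" if \<nu>: "0 \<le> \<nu>" "\<nu> \<le> 1" for \<nu> p
  proof -
    obtain z t s where p: "p = (z, t, s)" by (cases p)
    have np: "norm s \<le> norm p" "norm t \<le> norm p"
      using norm_snd_le[of "(t, s)" z] norm_snd_le[of s t] norm_fst_le[of t s] unfolding p by (auto intro: order_trans)
    have sq: "(norm p)\<^sup>2 = (norm z)\<^sup>2 + ((norm t)\<^sup>2 + (norm s)\<^sup>2)"
      by (simp add: p norm_Pair)
    have "wt (y + (1 / l) *\<^sub>R z, c + r *\<^sub>R s, e + \<nu> *\<^sub>R t) \<le> 1 + (norm c + \<bar>r\<bar> * norm s) + (norm e + \<bar>\<nu>\<bar> * norm t)"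
      using norm_triangle_ineq[of c "r *\<^sub>R s"] norm_triangle_ineq[of e "\<nu> *\<^sub>R t"] by (simp add: wt_eq)
    also have "\<dots> \<le> 1 + (norm c + \<bar>r\<bar> * norm p) + (norm e + 1 * norm p)"
      using \<nu> np by (intro add_mono mult_mono mult_left_mono order_refl) auto
    also have "\<dots> \<le> K * (1 + norm p)"
      by (simp add: K_def algebra_simps)
    finally have "wt (y + (1 / l) *\<^sub>R z, c + r *\<^sub>R s, e + \<nu> *\<^sub>R t) ^ k \<le> (K * (1 + norm p)) ^ k"
      by (intro power_mono wt_nonneg)
    then have 1: "norm (F (y + (1 / l) *\<^sub>R z, c + r *\<^sub>R s, e + \<nu> *\<^sub>R t)) \<le> C * (K * (1 + norm p)) ^ k"
      using C by (meson less_imp_le mult_left_mono order_trans)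
    have "a * (norm s)\<^sup>2 \<le> 1 / 2 * (norm s)\<^sup>2" "a * (norm t)\<^sup>2 \<le> 1 / 2 * (norm t)\<^sup>2" "a * (norm z)\<^sup>2 \<le> q\<^sup>2 / 2 * (norm z)\<^sup>2"
      by (rule mult_right_mono[OF a(2) zero_le_power2] mult_right_mono[OF a(3) zero_le_power2])+
    then have "- (norm s)\<^sup>2 / 2 + - (norm t)\<^sup>2 / 2 + - (norm (q *\<^sub>R z))\<^sup>2 / 2 \<le> - a * (norm p)\<^sup>2"
      unfolding sq by (simp add: distrib_left power_mult_distrib)
    then have 2: "norm (gauss s * gauss t * gauss (q *\<^sub>R z)) \<le> exp (- a * (norm p)\<^sup>2)"
      by (simp add: gauss_def norm_mult flip: exp_add)
    have "norm (packet_integrand F y c e r l q \<nu> p) = norm (F (y + (1 / l) *\<^sub>R z, c + r *\<^sub>R s, e + \<nu> *\<^sub>R t)) * norm (gauss s * gauss t * gauss (q *\<^sub>R z))"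
      unfolding packet_integrand_def p prod.case norm_mult norm_exp_i_times by simp
    also have "\<dots> \<le> (C * (K * (1 + norm p)) ^ k) * exp (- a * (norm p)\<^sup>2)"
      by (rule mult_mono'[OF 1 2]) auto
    also have "\<dots> = (C * K ^ k) * gauss_dom k a p" by (simp add: gauss_dom_def power_mult_distrib)
    finally show ?thesis .
  qed
  then show ?thesis using a(1) by blast
qed

text \<open>The case \<nu> = 0 with the Gaussian in \<open>t\<close> integrated out: the second
  frequency is exactly \<open>e\<close>, while the first still ranges over a Gaussian of width
  \<open>r\<close> about \<open>c\<close>.\<close>

definition packet_form ::
  "('n::finite phase \<Rightarrow> complex) \<Rightarrow> real^'n \<Rightarrow> real^'n \<Rightarrow> real^'n \<Rightarrow> real \<Rightarrow> real \<Rightarrow> real \<Rightarrow> complex"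
  where "packet_form F y c e r l q = (LINT z|lborel. LINT s|lborel. F (y + (1 / l) *\<^sub>R z, c + r *\<^sub>R s, e) *
    gauss s * exp (\<i> * of_real ((r / l) * (z \<bullet> s))) * gauss (q *\<^sub>R z))"

text \<open>Dominated convergence is applied on the product space; this links it with the iterated
  integrals that come from \<open>pairing\<close> and \<open>bilinear_op\<close>.\<close>

lemma packet_integrand_iterated:
  fixes F :: "'n::finite phase \<Rightarrow> complex"
  assumes F: "F \<in> symbol_class \<rho> \<delta> m" and q: "q \<noteq> 0" and \<nu>: "0 \<le> \<nu>" "\<nu> \<le> 1"
  shows "(LINT z|lborel. LINT t|lborel. LINT s|lborel. packet_integrand F y c e r l q \<nu> (z, t, s)) =
    (LINT p|lborel. packet_integrand F y c e r l q \<nu> p)"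
proof -
  let ?\<Phi> = "packet_integrand F y c e r l q \<nu>"
  obtain C k a where a: "a > 0" and b: "\<And>p. norm (?\<Phi> p) \<le> C * gauss_dom k a p"
    using packet_integrand_bound[OF F q, of y c e r l] \<nu> by blast
  have cont: "continuous_on UNIV ?\<Phi>" by (rule packet_integrand_continuous[OF symbol_class_smooth[OF F]])
  have i: "integrable lborel ?\<Phi>"
    by (rule integrable_gauss_dominated[OF a borel_measurable_continuous_onI[OF cont] b])
  have C0: "C \<ge> 0" using b[of 0] by (simp add: gauss_dom_def order_trans[OF norm_ge_zero])
  have "integrable lborel (\<lambda>p'. ?\<Phi> (z, p'))" for z
  proof (rule integrable_gauss_dominated[OF a])
    show "(\<lambda>p'. ?\<Phi> (z, p')) \<in> borel_measurable borel"
      by (intro borel_measurable_continuous_onI continuous_on_compose2[OF cont] continuous_intros) auto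
    fix p' :: "(real^'n) \<times> (real^'n)"
    have n: "norm (z, p') \<le> (1 + norm z) * (1 + norm p') - 1"
    proof -
      have "(1 + norm z) * (1 + norm p') - 1 = norm z + norm p' + norm z * norm p'" by (simp add: algebra_simps)
      then show ?thesis using norm_Pair_le[of z p'] by (simp add: add_increasing2)
    qed
    have "gauss_dom k a (z, p') \<le> (1 + norm z) ^ k * gauss_dom k a p'"
    proof -
      have "(1 + norm (z, p')) ^ k \<le> ((1 + norm z) * (1 + norm p')) ^ k"
        using n by (intro power_mono) auto
      moreover have "exp (- a * (norm (z, p'))\<^sup>2) \<le> exp (- a * (norm p')\<^sup>2)"
        using a by (simp add: norm_Pair)
      ultimately have "gauss_dom k a (z, p') \<le> ((1 + norm z) * (1 + norm p')) ^ k * exp (- a * (norm p')\<^sup>2)"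
        unfolding gauss_dom_def by (intro mult_mono) auto
      then show ?thesis by (simp add: gauss_dom_def power_mult_distrib)
    qed
    from mult_left_mono[OF this C0] b[of "(z, p')"]
    show "norm (?\<Phi> (z, p')) \<le> (C * (1 + norm z) ^ k) * gauss_dom k a p'" by (simp add: mult.assoc)
  qed
  then have "(LINT t|lborel. LINT s|lborel. ?\<Phi> (z, t, s)) = (LINT p'|lborel. ?\<Phi> (z, p'))" for z
    using integral_lborel_iterated[of "\<lambda>p'. ?\<Phi> (z, p')"] by simp
  then show ?thesis using integral_lborel_iterated[OF i] by simp
qed

text \<open>With \<nu> = 1/(j + 1) the second packet spreads out to a plane wave. At \<nu> = 0 the
  variable \<open>t\<close> separates and contributes the factor \<open>gauss_mass\<close>.\<close>

lemma packet_integrand_limit: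
  fixes F :: "'n::finite phase \<Rightarrow> complex"
  assumes F: "F \<in> symbol_class \<rho> \<delta> m" and q: "q \<noteq> 0"
  shows "(\<lambda>j. LINT z|lborel. LINT t|lborel. LINT s|lborel. packet_integrand F y c e r l q (1 / real (Suc j)) (z, t, s))
    \<longlonglongrightarrow> gauss_mass TYPE(real^'n) * packet_form F y c e r l q"
proof -
  let ?\<Phi> = "packet_integrand F y c e r l q"
  obtain C k a where a: "a > 0" and b: "\<And>\<nu> p. 0 \<le> \<nu> \<Longrightarrow> \<nu> \<le> 1 \<Longrightarrow> norm (?\<Phi> \<nu> p) \<le> C * gauss_dom k a p"
    using packet_integrand_bound[OF F q, of y c e r l] by blast
  have m: "?\<Phi> \<nu> \<in> borel_measurable lborel" for \<nu>
    using borel_measurable_continuous_onI[OF packet_integrand_continuous[OF symbol_class_smooth[OF F]]] by simp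
  have nu: "0 \<le> 1 / real (Suc j)" "1 / real (Suc j) \<le> 1" for j by (auto simp: divide_simps)
  have "(\<lambda>j. LINT p|lborel. ?\<Phi> (1 / real (Suc j)) p) \<longlonglongrightarrow> (LINT p|lborel. ?\<Phi> 0 p)"
  proof (rule integral_dominated_convergence[where w="\<lambda>p. C * gauss_dom k a p"])
    show "integrable lborel (\<lambda>p. C * gauss_dom k a p :: real)" for p :: "'n phase"
      using a by (intro integrable_mult_right integrable_gauss_dom)
    show "AE p in lborel. (\<lambda>j. ?\<Phi> (1 / real (Suc j)) p) \<longlonglongrightarrow> ?\<Phi> 0 p"
    proof (intro always_eventually allI)
      fix p :: "'n phase"
      obtain z t s where p: "p = (z, t, s)" by (cases p)
      have "isCont F w" for w
        using smooth_continuous[OF symbol_class_smooth[OF F]] continuous_on_eq_continuous_at[OF open_UNIV] by (metis UNIV_I)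
      note Ft = isCont_tendsto_compose[OF this]
      have n0: "(\<lambda>j. 1 / real (Suc j)) \<longlonglongrightarrow> 0" by (rule LIMSEQ_Suc[OF lim_1_over_n])
      have "(\<lambda>j. F (y + (1 / l) *\<^sub>R z, c + r *\<^sub>R s, e + (1 / real (Suc j)) *\<^sub>R t)) \<longlonglongrightarrow> F (y + (1 / l) *\<^sub>R z, c + r *\<^sub>R s, e + 0 *\<^sub>R t)"
        by (intro Ft tendsto_intros n0)
      moreover have "(\<lambda>j. exp (\<i> * complex_of_real ((1 / l) * (z \<bullet> (r *\<^sub>R s + (1 / real (Suc j)) *\<^sub>R t))))) \<longlonglongrightarrow> exp (\<i> * of_real ((1 / l) * (z \<bullet> (r *\<^sub>R s + 0 *\<^sub>R t))))"
        by (intro tendsto_intros n0)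
      ultimately show "(\<lambda>j. ?\<Phi> (1 / real (Suc j)) p) \<longlonglongrightarrow> ?\<Phi> 0 p"
        unfolding packet_integrand_def p prod.case by (intro tendsto_mult tendsto_const)
    qed
    show "AE p in lborel. norm (?\<Phi> (1 / real (Suc j)) p) \<le> C * gauss_dom k a p" for j
      using b[OF nu] by (intro always_eventually allI)
  qed (use m in auto)
  moreover have "(LINT p|lborel. ?\<Phi> 0 p) = gauss_mass TYPE(real^'n) * packet_form F y c e r l q"
  proof -
    have inner: "(LINT s|lborel. ?\<Phi> 0 (z, t, s)) = gauss t * (LINT s|lborel. F (y + (1 / l) *\<^sub>R z, c + r *\<^sub>R s, e) *
        gauss s * exp (\<i> * of_real ((r / l) * (z \<bullet> s))) * gauss (q *\<^sub>R z))" for z t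
      unfolding packet_integrand_def prod.case
      by (subst integral_mult_right_zero[symmetric], rule Bochner_Integration.integral_cong) (simp_all add: mult_ac)
    have "(LINT p|lborel. ?\<Phi> 0 p) = (LINT z|lborel. LINT t|lborel. LINT s|lborel. ?\<Phi> 0 (z, t, s))"
      using packet_integrand_iterated[OF F q] by simp
    also have "\<dots> = (LINT z|lborel. LINT t|lborel. gauss (t::real^'n) * (LINT s|lborel. F (y + (1 / l) *\<^sub>R z, c + r *\<^sub>R s, e) *
        gauss s * exp (\<i> * of_real ((r / l) * (z \<bullet> s))) * gauss (q *\<^sub>R z)))"
      unfolding inner by (rule refl)
    also have "\<dots> = gauss_mass TYPE(real^'n) * packet_form F y c e r l q"
      unfolding packet_form_def by (simp only: integral_mult_left_zero integral_mult_right_zero integral_gauss)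
    finally show ?thesis .
  qed
  ultimately show ?thesis
    using packet_integrand_iterated[OF F q nu] by simp
qed

text \<open>The three packets have inverse widths l, \<nu>, q l and frequencies - \<xi> - \<eta>,
  \<eta>, \<xi>. Transposition exchanges the first and the third: on the right the frequency spread
  is q l, and the Gaussian in space is that of the packet of inverse width l, hence the last
  argument 1.\<close>

lemma packet_form_transpose:
  fixes \<sigma> \<sigma>' :: "'n::finite bisymbol"
  assumes F: "uncurry3 \<sigma> \<in> symbol_class \<rho> \<delta> m" and F': "uncurry3 \<sigma>' \<in> symbol_class \<rho> \<delta> m'"
    and T: "\<And>y a \<theta> b \<eta> d \<zeta>. a > 0 \<Longrightarrow> b > 0 \<Longrightarrow> d > 0 \<Longrightarrow>
      pairing (bilinear_op \<sigma> (packet a y \<theta>) (packet b y \<eta>)) (packet d y \<zeta>) =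
      pairing (bilinear_op \<sigma>' (packet d y \<zeta>) (packet b y \<eta>)) (packet a y \<theta>)"
    and l: "l > 0" and q: "q > 0"
  shows "packet_form (uncurry3 \<sigma>) y (- \<xi> - \<eta>) \<eta> l l q = packet_form (uncurry3 \<sigma>') y \<xi> \<eta> (q * l) l 1"
proof -
  have "(LINT z|lborel. LINT t|lborel. LINT s|lborel. packet_integrand (uncurry3 \<sigma>) y (- \<xi> - \<eta>) \<eta> l l q \<nu> (z, t, s)) =
    (LINT z|lborel. LINT t|lborel. LINT s|lborel. packet_integrand (uncurry3 \<sigma>') y \<xi> \<eta> (q * l) l 1 \<nu> (z, t, s))" if \<nu>: "\<nu> > 0" for \<nu>
  proof -
    have ql: "q * l > 0" "l * q > 0" using q l by auto
    have "(packet_const TYPE('n))\<^sup>2 * (LINT z|lborel. LINT t|lborel. LINT s|lborel. packet_integrand (uncurry3 \<sigma>) y (- \<xi> - \<eta>) \<eta> l l q \<nu> (z, t, s)) =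
      (packet_const TYPE('n))\<^sup>2 * (LINT z|lborel. LINT t|lborel. LINT s|lborel. packet_integrand (uncurry3 \<sigma>') y \<xi> \<eta> (q * l) l 1 \<nu> (z, t, s))"
      unfolding pairing_packets[OF l \<nu> l, symmetric] pairing_packets[OF ql(1) \<nu> l, symmetric]
      using T[OF l \<nu> ql(2), of y "- \<xi> - \<eta>" \<eta> \<xi>] by (simp add: mult.commute)
    then show ?thesis using packet_const_nonzero[where 'n='n] by simp
  qed
  then have "(\<lambda>j. LINT z|lborel. LINT t|lborel. LINT s|lborel. packet_integrand (uncurry3 \<sigma>) y (- \<xi> - \<eta>) \<eta> l l q (1 / real (Suc j)) (z, t, s)) =
    (\<lambda>j. LINT z|lborel. LINT t|lborel. LINT s|lborel. packet_integrand (uncurry3 \<sigma>') y \<xi> \<eta> (q * l) l 1 (1 / real (Suc j)) (z, t, s))"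
    by auto
  then have "gauss_mass TYPE(real^'n) * packet_form (uncurry3 \<sigma>) y (- \<xi> - \<eta>) \<eta> l l q = gauss_mass TYPE(real^'n) * packet_form (uncurry3 \<sigma>') y \<xi> \<eta> (q * l) l 1"
    using packet_integrand_limit[OF F, of q y "- \<xi> - \<eta>" \<eta> l l] packet_integrand_limit[OF F', of 1 y \<xi> \<eta> "q * l" l] q
    by (metis LIMSEQ_unique less_irrefl zero_neq_one)
  then show ?thesis using gauss_mass_nonzero[where 'a="real^'n"] by simp
qed

section \<open>Estimates for the packet forms\<close>

lemma norm_iterated_integral_le:
  fixes f :: "'a::euclidean_space \<times> 'b::euclidean_space \<Rightarrow> complex"
  assumes "a > 0" "b > 0" and bd: "\<And>z s. norm (f (z, s)) \<le> B * gauss_dom j a z * gauss_dom k b s"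
  shows "norm (LINT z|lborel. LINT s|lborel. f (z, s)) \<le> B * (LINT z|lborel. gauss_dom j a (z::'a)) * (LINT s|lborel. gauss_dom k b (s::'b))"
proof -
  have "norm (LINT s|lborel. f (z, s)) \<le> (B * (LINT s|lborel. gauss_dom k b (s::'b))) * gauss_dom j a z" for z
    using norm_integral_gauss_dominated[OF \<open>b > 0\<close> bd, of z] by (simp add: mult_ac)
  from norm_integral_gauss_dominated[OF \<open>a > 0\<close> this] show ?thesis by (simp add: mult_ac)
qed

text \<open>Tailored to linearity of the iterated integral, one variable at a time.\<close>

definition iterated_integrable :: "('a::euclidean_space \<times> 'b::euclidean_space \<Rightarrow> complex) \<Rightarrow> bool"
  where "iterated_integrable f \<longleftrightarrow>
    (\<forall>z. integrable lborel (\<lambda>s. f (z, s))) \<and> integrable lborel (\<lambda>z. LINT s|lborel. f (z, s))"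

lemma iterated_integrableI:
  fixes f :: "'a::euclidean_space \<times> 'b::euclidean_space \<Rightarrow> complex"
  assumes f: "continuous_on UNIV f" and a: "a > 0" and b: "b > 0"
    and bd: "\<And>z s. norm (f (z, s)) \<le> B * gauss_dom j a z * gauss_dom k b s"
  shows "iterated_integrable f"
  unfolding iterated_integrable_def
proof (intro conjI allI)
  fix z
  show "integrable lborel (\<lambda>s. f (z, s))"
  proof (rule integrable_gauss_dominated[OF b _ bd])
    show "(\<lambda>s. f (z, s)) \<in> borel_measurable borel"
      by (intro borel_measurable_continuous_onI continuous_on_compose2[OF f] continuous_intros) auto
  qed
next
  have "f \<in> borel_measurable (lborel \<Otimes>\<^sub>M lborel)"
    using borel_measurable_continuous_onI[OF f] unfolding lborel_prod by simp
  then have m: "(\<lambda>z. LINT s|lborel. f (z, s)) \<in> borel_measurable borel"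
    using lborel.borel_measurable_lebesgue_integral[of "\<lambda>z s. f (z, s)" lborel] by simp
  have "norm (LINT s|lborel. f (z, s)) \<le> (B * (LINT s|lborel. gauss_dom k b (s::'b))) * gauss_dom j a z" for z
    using norm_integral_gauss_dominated[OF b bd, of z] by (simp add: mult_ac)
  then show "integrable lborel (\<lambda>z. LINT s|lborel. f (z, s))"
    by (rule integrable_gauss_dominated[OF a m])
qed

lemma iterated_integral_diff:
  assumes "iterated_integrable f" "iterated_integrable g"
  shows "(LINT z|lborel. LINT s|lborel. f (z, s) - g (z, s)) =
    (LINT z|lborel. LINT s|lborel. f (z, s)) - (LINT z|lborel. LINT s|lborel. g (z, s))"
  using assms by (simp add: iterated_integrable_def)

lemma iterated_integral_sum:
  assumes "\<And>i. i \<in> I \<Longrightarrow> iterated_integrable (f i)"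
  shows "iterated_integrable (\<lambda>p. \<Sum>i\<in>I. f i p)"
    and "(LINT z|lborel. LINT s|lborel. (\<Sum>i\<in>I. f i (z, s))) = (\<Sum>i\<in>I. LINT z|lborel. LINT s|lborel. f i (z, s))"
  using assms by (auto simp: iterated_integrable_def)

lemma iterated_integrable_cmult:
  "iterated_integrable f \<Longrightarrow> iterated_integrable (\<lambda>p. c * f p)"
  by (simp add: iterated_integrable_def)

lemma powr_le_power_nat:
  assumes "1 \<le> (w::real)"
  shows "w powr a \<le> w ^ nat \<lceil>\<bar>a\<bar>\<rceil>"
proof -
  define n where "n = nat \<lceil>\<bar>a\<bar>\<rceil>"
  have "a \<le> real n" unfolding n_def by linarith
  then have "w powr a \<le> w powr real n" using assms by (intro powr_mono) auto
  also have "\<dots> = w ^ n" using assms by (intro powr_realpow) auto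
  finally show ?thesis unfolding n_def .
qed

definition xi_word :: "'n::finite list \<Rightarrow> 'n phase list"
  where "xi_word w = map (\<lambda>i. in_xi (axis i 1)) w"

definition x_word :: "'n::finite list \<Rightarrow> 'n phase list"
  where "x_word w = map (\<lambda>i. in_x (axis i 1)) w"

lemma word_order_xi_word: "word_order \<rho> \<delta> (xi_word w) = - \<rho> * real (length w)"
  by (induction w) (auto simp: xi_word_def in_xi_def algebra_simps)

lemma word_order_x_word: "word_order \<rho> \<delta> (x_word w) = \<delta> * real (length w)"
  by (induction w) (auto simp: x_word_def in_x_def algebra_simps)

lemma pure_xi_word: "\<forall>v\<in>set (xi_word w). pure v" and pure_x_word: "\<forall>v\<in>set (x_word w). pure v"
  by (auto simp: xi_word_def x_word_def pure_def in_xi_def in_x_def zero_prod_def)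

lemma symbol_class_xi_word:
  "F \<in> symbol_class \<rho> \<delta> m \<Longrightarrow> foldr dir_deriv (xi_word w) F \<in> symbol_class \<rho> \<delta> (m - \<rho> * real (length w))"
  using symbol_class_foldr_dir_deriv[OF _ pure_xi_word, of F \<rho> \<delta> m w] by (simp add: word_order_xi_word)

lemma symbol_class_x_xi_word:
  assumes "F \<in> symbol_class \<rho> \<delta> m"
  shows "foldr dir_deriv (x_word w @ xi_word w) F \<in> symbol_class \<rho> \<delta> (m - (\<rho> - \<delta>) * real (length w))"
  using symbol_class_foldr_dir_deriv[OF symbol_class_xi_word[OF assms] pure_x_word, of w w]
  by (simp add: word_order_x_word algebra_simps)

lemma abs_prod_list_components_le:
  "\<bar>prod_list (map (\<lambda>i. (s::real^'n::finite) $ i) w)\<bar> \<le> norm s ^ length w"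
  by (induction w) (auto simp: abs_mult intro!: mult_mono component_le_norm_cart)

lemma vec_expand_axis: "(s::real^'n::finite) = (\<Sum>i\<in>UNIV. s $ i *\<^sub>R axis i 1)"
  by (simp add: vec_eq_iff axis_def if_distrib cong: if_cong)

lemma funpow_dir_deriv_in_xi:
  fixes F :: "'n::finite phase \<Rightarrow> complex"
  assumes "smooth F"
  shows "(dir_deriv (in_xi (a *\<^sub>R s)) ^^ k) F p =
    (\<Sum>w | length w = k. of_real (a ^ k * prod_list (map (($) s) w)) * foldr dir_deriv (xi_word w) F p)"
proof -
  have L: "linear (in_xi :: real^'n \<Rightarrow> 'n phase)"
    by (rule bounded_linear.linear[OF bounded_linear_in(2)])
  have "in_xi (a *\<^sub>R s) = in_xi (\<Sum>i\<in>UNIV. (a * s $ i) *\<^sub>R axis i 1)"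
    by (subst vec_expand_axis) (simp add: scaleR_sum_right)
  also have "\<dots> = (\<Sum>i\<in>UNIV. (a * s $ i) *\<^sub>R in_xi (axis i 1))"
    using L by (simp only: linear_sum linear_cmul)
  finally have v: "in_xi (a *\<^sub>R s) = (\<Sum>i\<in>UNIV. (a * s $ i) *\<^sub>R in_xi (axis i 1))" .
  have "prod_list (map (\<lambda>i. a * s $ i) w) = a ^ length w * prod_list (map (($) s) w)" for w
    by (induction w) auto
  then show ?thesis
    unfolding funpow_dir_deriv_words[OF assms v] xi_word_def by (intro sum.cong) auto
qed

text \<open>Only frequency directions occur, so each of the k derivatives lowers the order by
  \<rho>; the constant is uniform in the direction and its length.\<close>

lemma xi_deriv_bound:
  fixes F :: "'n::finite phase \<Rightarrow> complex"
  assumes F: "F \<in> symbol_class \<rho> \<delta> m"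
  obtains C where "C > 0" "\<And>p a s. norm ((dir_deriv (in_xi (a *\<^sub>R s)) ^^ k) F p) \<le> C * (\<bar>a\<bar> * norm s) ^ k * wt p powr (m - \<rho> * real k)"
proof -
  have "\<exists>C>0. \<forall>p. norm (foldr dir_deriv (xi_word w) F p) \<le> C * wt p powr (m - \<rho> * real (length w))" for w
    using symbol_class_bound[OF symbol_class_xi_word[OF F]] by metis
  then obtain C where C: "\<And>w. C w > 0" "\<And>w p. norm (foldr dir_deriv (xi_word w) F p) \<le> C w * wt p powr (m - \<rho> * real (length w))"
    by metis
  define D where "D = (\<Sum>w | length (w::'n list) = k. C w)"
  have D0: "D \<ge> 0" unfolding D_def using C(1) by (intro sum_nonneg) (simp add: less_imp_le)
  show ?thesis
  proof (rule that[of "D + 1"])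
    fix p a and s :: "real^'n"
    have "norm ((dir_deriv (in_xi (a *\<^sub>R s)) ^^ k) F p) \<le>
      (\<Sum>w | length w = k. norm (of_real (a ^ k * prod_list (map (($) s) w)) * foldr dir_deriv (xi_word w) F p))"
      unfolding funpow_dir_deriv_in_xi[OF symbol_class_smooth[OF F]] by (rule norm_sum)
    also have "\<dots> \<le> (\<Sum>w | length w = k. C w * ((\<bar>a\<bar> * norm s) ^ k * wt p powr (m - \<rho> * real k)))"
    proof (rule sum_mono)
      fix w :: "'n list" assume w: "w \<in> {w. length w = k}"
      have "\<bar>a\<bar> ^ k * \<bar>prod_list (map (($) s) w)\<bar> \<le> \<bar>a\<bar> ^ k * norm s ^ k"
        using abs_prod_list_components_le[of s w] w by (intro mult_left_mono) auto
      then have "norm (complex_of_real (a ^ k * prod_list (map (($) s) w))) \<le> (\<bar>a\<bar> * norm s) ^ k"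
        by (simp add: norm_mult norm_power power_mult_distrib)
      moreover have "norm (foldr dir_deriv (xi_word w) F p) \<le> C w * wt p powr (m - \<rho> * real k)"
        using C(2)[of w p] w by simp
      ultimately have "norm (of_real (a ^ k * prod_list (map (($) s) w)) * foldr dir_deriv (xi_word w) F p)
        \<le> (\<bar>a\<bar> * norm s) ^ k * (C w * wt p powr (m - \<rho> * real k))"
        unfolding norm_mult by (rule mult_mono') auto
      then show "norm (of_real (a ^ k * prod_list (map (($) s) w)) * foldr dir_deriv (xi_word w) F p)
        \<le> C w * ((\<bar>a\<bar> * norm s) ^ k * wt p powr (m - \<rho> * real k))" by (simp add: mult_ac)
    qed
    also have "\<dots> = D * ((\<bar>a\<bar> * norm s) ^ k * wt p powr (m - \<rho> * real k))"
      by (simp add: D_def sum_distrib_right)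
    also have "\<dots> \<le> (D + 1) * ((\<bar>a\<bar> * norm s) ^ k * wt p powr (m - \<rho> * real k))"
      by (intro mult_right_mono) auto
    finally show "norm ((dir_deriv (in_xi (a *\<^sub>R s)) ^^ k) F p) \<le> (D + 1) * (\<bar>a\<bar> * norm s) ^ k * wt p powr (m - \<rho> * real k)"
      by (simp add: mult.assoc)
  qed (use D0 in simp)
qed

section \<open>Freezing the frequency on the side of the transpose\<close>

definition gauss_average ::
  "('n::finite phase \<Rightarrow> complex) \<Rightarrow> real^'n \<Rightarrow> real^'n \<Rightarrow> real^'n \<Rightarrow> real \<Rightarrow> complex"
  where "gauss_average F y c e l = (LINT z|lborel. F (y + (1 / l) *\<^sub>R z, c, e) * gauss z)"

lemma gauss_eq_gauss_dom: "norm (gauss x) = gauss_dom 0 (1 / 2) x"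
  by (simp add: gauss_def gauss_dom_def)

lemma norm_gauss_scaled: "norm (gauss (q *\<^sub>R z)) = gauss_dom 0 (q\<^sup>2 / 2) z"
  by (simp add: gauss_def gauss_dom_def power_mult_distrib)

lemma gauss_dom_absorb: "(1 + norm x) ^ j * gauss_dom k c x = gauss_dom (j + k) c x"
  by (simp add: gauss_dom_def power_add)

lemma packet_form_integrand_integrable:
  fixes F :: "'n::finite phase \<Rightarrow> complex"
  assumes F: "F \<in> symbol_class \<rho> \<delta> m" and q: "q \<noteq> 0"
  shows "iterated_integrable (\<lambda>(z, s). F (y + (1 / l) *\<^sub>R z, c + r *\<^sub>R s, e) * gauss s * exp (\<i> * of_real (t * (z \<bullet> s))) * gauss (q *\<^sub>R z))"
proof -
  note cF = continuous_on_compose2[OF smooth_continuous[OF symbol_class_smooth[OF F]] _ subset_UNIV]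
  note cg = continuous_on_compose2[OF smooth_continuous[OF smooth_gauss] _ subset_UNIV]
  obtain C k where C: "C > 0" "\<And>p. norm (F p) \<le> C * wt p ^ k" using wt_power_bound[OF F] by blast
  define K where "K = 1 + norm c + \<bar>r\<bar> + norm e"
  show ?thesis
  proof (rule iterated_integrableI)
    show "continuous_on UNIV (\<lambda>(z, s). F (y + (1 / l) *\<^sub>R z, c + r *\<^sub>R s, e) * gauss s * exp (\<i> * of_real (t * (z \<bullet> s))) * gauss (q *\<^sub>R z))"
      unfolding case_prod_unfold
      by (intro continuous_on_mult cF cg continuous_on_exp continuous_on_of_real continuous_intros)
    show "q\<^sup>2 / 2 > 0" "(1 / 2 :: real) > 0" using q by auto
    fix z s :: "real^'n"
    have "wt (y + (1 / l) *\<^sub>R z, c + r *\<^sub>R s, e) \<le> 1 + (norm c + \<bar>r\<bar> * norm s) + norm e"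
      using norm_triangle_ineq[of c "r *\<^sub>R s"] by (simp add: wt_eq)
    also have "\<dots> \<le> K * (1 + norm s)"
      by (simp add: K_def algebra_simps)
    finally have "wt (y + (1 / l) *\<^sub>R z, c + r *\<^sub>R s, e) ^ k \<le> (K * (1 + norm s)) ^ k"
      by (intro power_mono wt_nonneg)
    then have 1: "norm (F (y + (1 / l) *\<^sub>R z, c + r *\<^sub>R s, e)) \<le> C * (K * (1 + norm s)) ^ k"
      using C by (meson less_imp_le mult_left_mono order_trans)
    have "norm (F (y + (1 / l) *\<^sub>R z, c + r *\<^sub>R s, e) * gauss s * exp (\<i> * of_real (t * (z \<bullet> s))) * gauss (q *\<^sub>R z)) =
      norm (F (y + (1 / l) *\<^sub>R z, c + r *\<^sub>R s, e)) * (gauss_dom 0 (1 / 2) s * gauss_dom 0 (q\<^sup>2 / 2) z)"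
      unfolding norm_mult norm_exp_i_times norm_gauss_scaled unfolding gauss_eq_gauss_dom by simp
    also have "\<dots> \<le> (C * (K * (1 + norm s)) ^ k) * (gauss_dom 0 (1 / 2) s * gauss_dom 0 (q\<^sup>2 / 2) z)"
      by (intro mult_right_mono 1) (simp add: gauss_dom_nonneg)
    also have "\<dots> = (C * K ^ k) * gauss_dom 0 (q\<^sup>2 / 2) z * ((1 + norm s) ^ k * gauss_dom 0 (1 / 2) s)"
      by (simp add: power_mult_distrib mult_ac)
    finally show "norm ((\<lambda>(z, s). F (y + (1 / l) *\<^sub>R z, c + r *\<^sub>R s, e) * gauss s * exp (\<i> * of_real (t * (z \<bullet> s))) * gauss (q *\<^sub>R z)) (z, s))
      \<le> (C * K ^ k) * gauss_dom 0 (q\<^sup>2 / 2) z * gauss_dom (k + 0) (1 / 2) s"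
      unfolding gauss_dom_absorb by simp
  qed
qed

text \<open>For small \<open>q\<close> both the frequency shift q l s and the phase q z . s are O(q)
  up to polynomial factors, so the symbol may be evaluated at \<xi> and the integral over
  \<open>s\<close> splits off. The lost power P of the weight depends on the symbol but not on
  \<open>q\<close> or \<open>l\<close>; it may be crude, since q will be a high negative power of
  the weight.\<close>

lemma packet_form_freeze:
  fixes F :: "'n::finite phase \<Rightarrow> complex"
  assumes F: "F \<in> symbol_class \<rho> \<delta> m"
  shows "\<exists>C>0. \<exists>P::nat. \<forall>y \<xi> \<eta> l q. 0 < l \<longrightarrow> l \<le> wt (y, \<xi>, \<eta>) \<longrightarrow> 0 < q \<longrightarrow> q \<le> 1 \<longrightarrow>
    norm (packet_form F y \<xi> \<eta> (q * l) l 1 - gauss_mass TYPE(real^'n) * gauss_average F y \<xi> \<eta> l)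
      \<le> C * q * wt (y, \<xi>, \<eta>) ^ P"
proof -
  obtain C1 where C1: "C1 > 0" "\<And>p a s. norm ((dir_deriv (in_xi (a *\<^sub>R s)) ^^ 1) F p) \<le> C1 * (\<bar>a\<bar> * norm s) ^ 1 * wt p powr (m - \<rho> * real 1)"
    using xi_deriv_bound[OF F, of 1] by blast
  define k where "k = nat \<lceil>\<bar>m - \<rho>\<bar>\<rceil>"
  obtain C2 k2 where C2: "C2 > 0" "\<And>p. norm (F p) \<le> C2 * wt p ^ k2" using wt_power_bound[OF F] by blast
  define P where "P = k + 1 + k2"
  define I where "I = (LINT z|lborel. gauss_dom 1 (1 / 2) (z::real^'n)) * (LINT s|lborel. gauss_dom (k + 1) (1 / 2) (s::real^'n))"
  have I: "I \<ge> 0" unfolding I_def by (intro mult_nonneg_nonneg integral_nonneg_AE) (auto simp: gauss_dom_nonneg)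
  have main: "norm (packet_form F y \<xi> \<eta> (q * l) l 1 - gauss_mass TYPE(real^'n) * gauss_average F y \<xi> \<eta> l)
      \<le> ((C1 + C2) * q * wt (y, \<xi>, \<eta>) ^ P) * I"
    if l: "0 < l" "l \<le> wt (y, \<xi>, \<eta>)" and q: "0 < q" "q \<le> 1" for y \<xi> \<eta> l q
  proof -
    define X where "X = wt (y, \<xi>, \<eta>)"
    have X: "X \<ge> 1" unfolding X_def by (rule wt_ge_1)
    have wtX: "wt (y', \<xi>, \<eta>) = X" for y' by (simp add: X_def wt_eq)
    define g1 where "g1 = (\<lambda>(z, s). F (y + (1 / l) *\<^sub>R z, \<xi> + (q * l) *\<^sub>R s, \<eta>) * gauss s * exp (\<i> * of_real ((q * l / l) * (z \<bullet> s))) * gauss (1 *\<^sub>R z))"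
    define g2 where "g2 = (\<lambda>(z, s). F (y + (1 / l) *\<^sub>R z, \<xi> + 0 *\<^sub>R s, \<eta>) * gauss s * exp (\<i> * of_real (0 * (z \<bullet> s))) * gauss (1 *\<^sub>R z))"
    have i: "iterated_integrable g1" "iterated_integrable g2"
      unfolding g1_def g2_def by (rule packet_form_integrand_integrable[OF F], simp)+
    have 1: "packet_form F y \<xi> \<eta> (q * l) l 1 = (LINT z|lborel. LINT s|lborel. g1 (z, s))"
      by (simp add: packet_form_def g1_def)
    have 2: "gauss_mass TYPE(real^'n) * gauss_average F y \<xi> \<eta> l = (LINT z|lborel. LINT s|lborel. g2 (z, s))"
    proof -
      have "(LINT s|lborel. g2 (z, s)) = (F (y + (1 / l) *\<^sub>R z, \<xi>, \<eta>) * gauss z) * gauss_mass TYPE(real^'n)" for z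
        unfolding integral_gauss[symmetric] g2_def prod.case
        by (subst integral_mult_right_zero[symmetric], rule Bochner_Integration.integral_cong) (simp_all add: mult_ac)
      then show ?thesis by (simp add: gauss_average_def mult.commute)
    qed
    have "norm (LINT z|lborel. LINT s|lborel. (\<lambda>p. g1 p - g2 p) (z, s)) \<le> ((C1 + C2) * q * X ^ P) * (LINT z|lborel. gauss_dom 1 (1 / 2) (z::real^'n)) * (LINT s|lborel. gauss_dom (k + 1) (1 / 2) (s::real^'n))"
    proof (rule norm_iterated_integral_le)
      fix z s :: "real^'n"
      let ?p = "(y + (1 / l) *\<^sub>R z, \<xi>, \<eta>)" and ?a = "q * l"
      have a: "0 \<le> ?a" "?a \<le> q * X" "?a \<le> X"
        using q l X mult_left_mono[of l X q] mult_mono[of q 1 l X] unfolding X_def[symmetric] by auto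
      have pv: "?p + in_xi (?a *\<^sub>R s) = (y + (1 / l) *\<^sub>R z, \<xi> + ?a *\<^sub>R s, \<eta>)" by (simp add: in_xi_def)
      have S: "1 + norm s \<ge> 1" by simp
      have "norm (F (?p + in_xi (?a *\<^sub>R s)) - (\<Sum>j<1. (dir_deriv (in_xi (?a *\<^sub>R s)) ^^ j) F ?p / fact j)) \<le> C1 * (q * X * (1 + norm s)) * (X * (1 + norm s)) ^ k"
      proof (rule taylor_along_line[OF symbol_class_smooth[OF F]])
        fix t :: real assume t: "0 \<le> t" "t \<le> 1"
        have tp: "?p + t *\<^sub>R in_xi (?a *\<^sub>R s) = (y + (1 / l) *\<^sub>R z, \<xi> + (t * ?a) *\<^sub>R s, \<eta>)" by (simp add: in_xi_def)
        have "norm ((t * ?a) *\<^sub>R s) \<le> X * norm s"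
        proof -
          have "0 \<le> t * ?a" "t * ?a \<le> 1 * X" using t a mult_right_mono[of t 1 ?a] by auto
          then have "\<bar>t * ?a\<bar> \<le> X" by simp
          then show ?thesis unfolding norm_scaleR by (rule mult_right_mono) simp
        qed
        then have "wt (y + (1 / l) *\<^sub>R z, \<xi> + (t * ?a) *\<^sub>R s, \<eta>) \<le> X * (1 + norm s)"
          using norm_triangle_ineq[of \<xi> "(t * ?a) *\<^sub>R s"] by (simp add: X_def wt_eq algebra_simps)
        then have "wt (y + (1 / l) *\<^sub>R z, \<xi> + (t * ?a) *\<^sub>R s, \<eta>) ^ k \<le> (X * (1 + norm s)) ^ k"
          by (intro power_mono wt_nonneg)
        then have w: "wt (y + (1 / l) *\<^sub>R z, \<xi> + (t * ?a) *\<^sub>R s, \<eta>) powr (m - \<rho> * real 1) \<le> (X * (1 + norm s)) ^ k"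
          using powr_le_power_nat[OF wt_ge_1, of "(y + (1 / l) *\<^sub>R z, \<xi> + (t * ?a) *\<^sub>R s, \<eta>)" "m - \<rho>"] by (simp add: k_def)
        have "(\<bar>?a\<bar> * norm s) ^ 1 \<le> (q * X) * (1 + norm s)"
          unfolding power_one_right using a by (intro mult_mono) auto
        then have "C1 * (\<bar>?a\<bar> * norm s) ^ 1 * wt (y + (1 / l) *\<^sub>R z, \<xi> + (t * ?a) *\<^sub>R s, \<eta>) powr (m - \<rho> * real 1) \<le> C1 * (q * X * (1 + norm s)) * (X * (1 + norm s)) ^ k"
          using w C1(1) q X by (intro mult_mono mult_left_mono) auto
        then show "norm ((dir_deriv (in_xi (?a *\<^sub>R s)) ^^ 1) F (?p + t *\<^sub>R in_xi (?a *\<^sub>R s))) \<le> C1 * (q * X * (1 + norm s)) * (X * (1 + norm s)) ^ k"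
          unfolding tp using C1(2) order_trans by blast
      qed
      then have d1: "norm (F (y + (1 / l) *\<^sub>R z, \<xi> + ?a *\<^sub>R s, \<eta>) - F ?p) \<le> C1 * q * (X * (1 + norm s)) ^ (k + 1)"
        unfolding pv by (simp add: mult_ac)
      have e: "norm (exp (\<i> * of_real (q * (z \<bullet> s))) - 1) \<le> q * ((1 + norm z) * (1 + norm s))"
      proof -
        have "norm (exp (\<i> * of_real (q * (z \<bullet> s))) - 1) \<le> \<bar>q * (z \<bullet> s)\<bar>"
          using iexp_approx1[of "q * (z \<bullet> s)" 0] by simp
        also have "\<dots> \<le> q * (norm z * norm s)"
          using q Cauchy_Schwarz_ineq2[of z s] by (simp add: abs_mult)
        also have "\<dots> \<le> q * ((1 + norm z) * (1 + norm s))"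
          using q by (intro mult_left_mono mult_mono) auto
        finally show ?thesis .
      qed
      \<comment> \<open>Separates the change of the symbol from the change of the phase.\<close>
      have eqd: "F (y + (1 / l) *\<^sub>R z, \<xi> + ?a *\<^sub>R s, \<eta>) * exp (\<i> * of_real (q * (z \<bullet> s))) - F ?p =
        (F (y + (1 / l) *\<^sub>R z, \<xi> + ?a *\<^sub>R s, \<eta>) - F ?p) * exp (\<i> * of_real (q * (z \<bullet> s))) + F ?p * (exp (\<i> * of_real (q * (z \<bullet> s))) - 1)"
        by (simp add: algebra_simps)
      have "norm (F (y + (1 / l) *\<^sub>R z, \<xi> + ?a *\<^sub>R s, \<eta>) * exp (\<i> * of_real (q * (z \<bullet> s))) - F ?p) \<le>
        C1 * q * (X * (1 + norm s)) ^ (k + 1) * 1 + (C2 * X ^ k2) * (q * ((1 + norm z) * (1 + norm s)))"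
        unfolding eqd using C2(2)[of ?p] d1 e
        by (intro norm_triangle_mono) (auto simp: norm_mult wtX intro!: mult_mono' simp del: of_real_mult)
      also have "\<dots> \<le> C1 * q * (X ^ P * ((1 + norm s) ^ (k + 1) * (1 + norm z) ^ 1)) + C2 * q * (X ^ P * ((1 + norm s) ^ (k + 1) * (1 + norm z) ^ 1))"
      proof (rule add_mono)
        have "(X * (1 + norm s)) ^ (k + 1) = X ^ (k + 1) * ((1 + norm s) ^ (k + 1) * 1)" by (simp add: power_mult_distrib)
        also have "\<dots> \<le> X ^ P * ((1 + norm s) ^ (k + 1) * (1 + norm z) ^ 1)"
          using X by (intro mult_mono power_increasing mult_left_mono) (auto simp: P_def)
        finally show "C1 * q * (X * (1 + norm s)) ^ (k + 1) * 1 \<le> C1 * q * (X ^ P * ((1 + norm s) ^ (k + 1) * (1 + norm z) ^ 1))"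
          using C1(1) q by (simp only: mult_1_right) (intro mult_left_mono, auto)
        have "X ^ k2 * ((1 + norm s) ^ 1 * (1 + norm z) ^ 1) \<le> X ^ P * ((1 + norm s) ^ (k + 1) * (1 + norm z) ^ 1)"
          using X by (intro mult_mono power_increasing) (auto simp: P_def)
        then have "(C2 * q) * (X ^ k2 * ((1 + norm s) ^ 1 * (1 + norm z) ^ 1)) \<le> (C2 * q) * (X ^ P * ((1 + norm s) ^ (k + 1) * (1 + norm z) ^ 1))"
          using C2(1) q by (intro mult_left_mono) auto
        then show "(C2 * X ^ k2) * (q * ((1 + norm z) * (1 + norm s))) \<le> C2 * q * (X ^ P * ((1 + norm s) ^ (k + 1) * (1 + norm z) ^ 1))"
          by (simp add: mult_ac)
      qed
      also have "\<dots> = ((C1 + C2) * q * X ^ P) * (1 + norm z) ^ 1 * (1 + norm s) ^ (k + 1)"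
        by (simp add: algebra_simps)
      finally have d: "norm (F (y + (1 / l) *\<^sub>R z, \<xi> + ?a *\<^sub>R s, \<eta>) * exp (\<i> * of_real (q * (z \<bullet> s))) - F ?p) \<le>
        ((C1 + C2) * q * X ^ P) * (1 + norm z) ^ 1 * (1 + norm s) ^ (k + 1)" .
      have "g1 (z, s) - g2 (z, s) = (F (y + (1 / l) *\<^sub>R z, \<xi> + ?a *\<^sub>R s, \<eta>) * exp (\<i> * of_real (q * (z \<bullet> s))) - F ?p) * (gauss s * gauss z)"
        using l by (simp add: g1_def g2_def algebra_simps)
      then have "norm (g1 (z, s) - g2 (z, s)) \<le> (((C1 + C2) * q * X ^ P) * (1 + norm z) ^ 1 * (1 + norm s) ^ (k + 1)) * (gauss_dom 0 (1 / 2) s * gauss_dom 0 (1 / 2) z)"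
        by (simp only: norm_mult gauss_eq_gauss_dom) (intro mult_right_mono d, simp add: gauss_dom_nonneg)
      also have "\<dots> = ((C1 + C2) * q * X ^ P) * ((1 + norm z) ^ 1 * gauss_dom 0 (1 / 2) z) * ((1 + norm s) ^ (k + 1) * gauss_dom 0 (1 / 2) s)"
        by (simp only: mult_ac)
      finally show "norm (g1 (z, s) - g2 (z, s)) \<le> ((C1 + C2) * q * X ^ P) * gauss_dom 1 (1 / 2) z * gauss_dom (k + 1) (1 / 2) s"
        unfolding gauss_dom_absorb by simp
    qed auto
    then show ?thesis
      unfolding 1 2 iterated_integral_diff[OF i, symmetric] I_def X_def by (simp add: mult.assoc)
  qed
  have "(C1 + C2) * q * wt (y, \<xi>, \<eta>) ^ P * I \<le> ((C1 + C2) * (I + 1)) * q * wt (y, \<xi>, \<eta>) ^ P" if "0 < q" for q and y \<xi> \<eta> :: "real^'n"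
  proof -
    have "(C1 + C2) * q * wt (y, \<xi>, \<eta>) ^ P * I \<le> (C1 + C2) * q * wt (y, \<xi>, \<eta>) ^ P * (I + 1)"
      using C1(1) C2(1) that by (intro mult_left_mono) (auto simp: wt_nonneg)
    then show ?thesis by (simp only: mult_ac)
  qed
  note fin = this
  show ?thesis
  proof (rule exI[of _ "(C1 + C2) * (I + 1)"], rule conjI, use C1(1) C2(1) I in simp, rule exI[of _ P], intro allI impI)
    fix y \<xi> \<eta> :: "real^'n" and l q :: real
    assume "0 < l" "l \<le> wt (y, \<xi>, \<eta>)" "0 < q" "q \<le> 1"
    then show "norm (packet_form F y \<xi> \<eta> (q * l) l 1 - gauss_mass TYPE(real^'n) * gauss_average F y \<xi> \<eta> l)
      \<le> ((C1 + C2) * (I + 1)) * q * wt (y, \<xi>, \<eta>) ^ P"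
      by (intro order_trans[OF main fin])
  qed
qed

text \<open>A frequency shift of size l |s| with l <= 2 X^\<kappa> either is at most half the weight
  X, and then the weights are comparable, or forces X^(1 - \<kappa>) <= 4 (1 + |s|). As \<kappa> <
  1, the second case bounds X by a power of 1 + |s|, which the Gaussian in \<open>s\<close> later
  absorbs.\<close>

lemma wt_segment_powr:
  assumes \<kappa>: "0 \<le> \<kappa>" "\<kappa> < 1"
  shows "\<exists>C>0. \<exists>P::nat. \<forall>y (c::real^'n::finite) e s l t. 0 < l \<longrightarrow> l \<le> 2 * wt (y, c, e) powr \<kappa> \<longrightarrow> 0 \<le> t \<longrightarrow> t \<le> 1 \<longrightarrow>
    wt (y, c + (t * l) *\<^sub>R s, e) powr a \<le> C * wt (y, c, e) powr a * (1 + norm s) ^ P"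
proof -
  \<comment> \<open>The exponent that solves X^(1 - \<kappa>) <= 4 (1 + |s|) for X.\<close>
  define r where "r = 1 / (1 - \<kappa>)"
  have r: "r \<ge> 1" "r * (1 - \<kappa>) = 1" using \<kappa> by (auto simp: r_def)
  define P where "P = nat \<lceil>\<bar>r * \<bar>a\<bar>\<bar>\<rceil>"
  define C where "C = (2 * 4 powr r) powr \<bar>a\<bar>"
  have C: "C > 0" by (simp add: C_def)
  have K1: "1 \<le> 2 * 4 powr r" using ge_one_powr_ge_zero[of 4 r] r by simp
  have "wt (y, c + (t * l) *\<^sub>R s, e) powr a \<le> C * wt (y, c, e) powr a * (1 + norm s) ^ P"
    if l: "0 < l" "l \<le> 2 * wt (y, c, e) powr \<kappa>" and t: "0 \<le> t" "t \<le> 1" for y c e and s :: "real^'n" and l t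
  proof -
    define X where "X = wt (y, c, e)"
    define Y where "Y = wt (y, c + (t * l) *\<^sub>R s, e)"
    have X: "X \<ge> 1" and Y: "Y \<ge> 1" unfolding X_def Y_def by (rule wt_ge_1)+
    have tl: "\<bar>t * l\<bar> * norm s \<le> l * norm s"
      using t l mult_right_mono[of t 1 l] by (intro mult_right_mono) auto
    have YX: "Y \<le> X + l * norm s" "X \<le> Y + l * norm s"
      using tl norm_triangle_ineq[of c "(t * l) *\<^sub>R s"] norm_triangle_ineq4[of "c + (t * l) *\<^sub>R s" "(t * l) *\<^sub>R s"]
      by (auto simp: X_def Y_def wt_eq)
    define S where "S = 1 + norm s"
    have S: "S \<ge> 1" by (simp add: S_def)
    \<comment> \<open>One constant for both cases: it is at least 2, as the comparable case
      requires, and twice the bound for X in the other case.\<close>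
    define K where "K = 2 * (4 * S) powr r"
    have K: "K \<ge> 2" using S r ge_one_powr_ge_zero[of "4 * S" r] by (simp add: K_def)
    have "Y \<le> K * X \<and> X \<le> K * Y"
    proof (cases "l * norm s \<le> X / 2")
      case True
      have "Y \<le> 2 * X" "X \<le> 2 * Y" using YX True X by linarith+
      moreover have "2 * X \<le> K * X" "2 * Y \<le> K * Y" using K X Y by (auto intro!: mult_right_mono)
      ultimately show ?thesis by linarith
    next
      case False
      have "X powr \<kappa> * X powr (1 - \<kappa>) = X" using X by (simp flip: powr_add)
      moreover have "X < 2 * (l * norm s)" using False by simp
      moreover have "l * norm s \<le> (2 * X powr \<kappa>) * S"
        using l unfolding X_def[symmetric] by (intro mult_mono) (auto simp: S_def)
      ultimately have "X powr \<kappa> * X powr (1 - \<kappa>) \<le> X powr \<kappa> * (4 * S)" by (simp add: mult_ac)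
      then have "X powr (1 - \<kappa>) \<le> 4 * S" using X by simp
      then have "(X powr (1 - \<kappa>)) powr r \<le> (4 * S) powr r" using r X by (intro powr_mono2) auto
      then have XS: "X \<le> (4 * S) powr r" using r X by (simp add: powr_powr mult.commute)
      have "X \<le> K * Y"
      proof -
        have "X \<le> K * 1" using XS K unfolding K_def by simp
        also have "\<dots> \<le> K * Y" using K Y by (intro mult_left_mono) auto
        finally show ?thesis .
      qed
      moreover have "Y \<le> K * X"
      proof -
        have "X powr \<kappa> \<le> X powr 1" using X \<kappa> by (intro powr_mono) auto
        then have "l * norm s \<le> (2 * X) * S"
          using l X unfolding X_def[symmetric] by (intro mult_mono) (auto simp: S_def)
        then have "Y \<le> X * 1 + (2 * S) * X" using YX by (simp add: mult_ac)
        also have "\<dots> \<le> X * S + (2 * S) * X" using X S by (intro add_mono mult_left_mono) auto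
        also have "\<dots> \<le> (4 * S) * X" using X S by simp
        also have "\<dots> \<le> K * X"
        proof (rule mult_right_mono)
          have "(4 * S) powr 1 \<le> (4 * S) powr r" using S r by (intro powr_mono) auto
          then show "4 * S \<le> K" using S unfolding K_def by simp
        qed (use X in simp)
        finally show ?thesis .
      qed
      ultimately show ?thesis by simp
    qed
    then have "Y powr a \<le> K powr \<bar>a\<bar> * X powr a"
      using K X Y by (intro powr_comparable) auto
    also have "K powr \<bar>a\<bar> = C * S powr (r * \<bar>a\<bar>)"
      using S by (simp add: K_def C_def powr_mult powr_powr)
    also have "S powr (r * \<bar>a\<bar>) \<le> S ^ P" unfolding P_def using S by (rule powr_le_power_nat)
    finally have "Y powr a \<le> C * S ^ P * X powr a" using C by (simp add: mult_left_mono mult_right_mono)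
    then show ?thesis unfolding X_def Y_def S_def by (simp add: mult_ac)
  qed
  then show ?thesis using C by blast
qed

text \<open>A shift in x leaves the weight unchanged, so along x every derivative of a symbol is
  bounded. This supplies the hypotheses of \<open>integral_by_parts_gauss\<close>.\<close>

lemma in_x_affine_derivs_bounded:
  fixes F :: "'n::finite phase \<Rightarrow> complex"
  assumes F: "F \<in> symbol_class \<rho> \<delta> m"
  shows "smooth (\<lambda>z. F (y + a *\<^sub>R z, c, e))"
    and "foldr dir_deriv vs (\<lambda>z. F (y + a *\<^sub>R z, c, e)) = (\<lambda>z. of_real (a ^ length vs) * foldr dir_deriv (map in_x vs) F (y + a *\<^sub>R z, c, e))"
    and "\<exists>A. \<forall>z. norm (foldr dir_deriv vs (\<lambda>z. F (y + a *\<^sub>R z, c, e)) z) \<le> A"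
proof -
  define L where "L z = in_x (a *\<^sub>R z)" for z :: "real^'n"
  have L: "bounded_linear L"
    unfolding L_def by (intro bounded_linear_compose[OF bounded_linear_in(1)] bounded_linear_scaleR_right)
  have eq: "(\<lambda>z. G (y + a *\<^sub>R z, c, e)) = (\<lambda>z. G ((y, c, e) + L z))" for G :: "'n phase \<Rightarrow> complex"
    by (simp add: L_def in_x_def)
  have pt: "(y, c, e) + L z = (y + a *\<^sub>R z, c, e)" for z by (simp add: L_def in_x_def)
  note s = symbol_class_smooth[OF F]
  show "smooth (\<lambda>z. F (y + a *\<^sub>R z, c, e))" unfolding eq by (rule smooth_compose_affine[OF L s])
  have "foldr dir_deriv (map L vs) F = (\<lambda>p. of_real (a ^ length vs) * foldr dir_deriv (map in_x vs) F p)"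
  proof (induction vs)
    case (Cons v vs)
    have Lv: "L v = a *\<^sub>R in_x v" by (simp add: L_def in_x_def)
    show ?case
      using Cons by (intro ext) (simp add: Lv dir_deriv_scaleR smooth_differentiable smooth_cmult smooth_foldr_dir_deriv s dir_deriv_cmult scaleR_conv_of_real)
  qed simp
  then show d: "foldr dir_deriv vs (\<lambda>z. F (y + a *\<^sub>R z, c, e)) = (\<lambda>z. of_real (a ^ length vs) * foldr dir_deriv (map in_x vs) F (y + a *\<^sub>R z, c, e))"
    unfolding eq[of F] foldr_dir_deriv_compose_affine[OF L s] by (simp add: pt)
  have "\<forall>v\<in>set (map in_x vs). pure v" by (auto simp: pure_def in_x_def zero_prod_def)
  from symbol_class_bound[OF symbol_class_foldr_dir_deriv[OF F this]]
  obtain C where C: "\<And>p. norm (foldr dir_deriv (map in_x vs) F p) \<le> C * wt p powr (m + word_order \<rho> \<delta> (map in_x vs))" by blast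
  have "norm (foldr dir_deriv vs (\<lambda>z. F (y + a *\<^sub>R z, c, e)) z) \<le> \<bar>a ^ length vs\<bar> * (C * wt (y, c, e) powr (m + word_order \<rho> \<delta> (map in_x vs)))" for z
    unfolding d using C[of "(y + a *\<^sub>R z, c, e)"] by (simp add: norm_mult norm_power wt_eq power_abs mult_left_mono)
  then show "\<exists>A. \<forall>z. norm (foldr dir_deriv vs (\<lambda>z. F (y + a *\<^sub>R z, c, e)) z) \<le> A" by blast
qed

text \<open>The quadratic rate is weakened to a linear one, which suffices because freezing the
  frequency costs a factor \<open>q\<close> as well.\<close>

lemma one_minus_gauss_le:
  assumes "0 \<le> q" "q \<le> 1"
  shows "norm (gauss (q *\<^sub>R z) - 1) \<le> q * (1 + norm z) ^ 2"
proof -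
  have "1 - exp (- ((q * norm z)\<^sup>2 / 2)) \<le> (q * norm z)\<^sup>2 / 2"
    using exp_ge_add_one_self[of "- ((q * norm z)\<^sup>2 / 2)"] by simp
  also have "\<dots> \<le> (q * norm z)\<^sup>2" by simp
  also have "\<dots> = (q * q) * (norm z)\<^sup>2" by (simp add: power_mult_distrib power2_eq_square)
  also have "\<dots> \<le> q * (1 + norm z) ^ 2"
    using assms by (intro mult_mono power_mono) (auto simp: mult_left_le)
  finally have "1 - exp (- ((q * norm z)\<^sup>2 / 2)) \<le> q * (1 + norm z) ^ 2" .
  moreover have "gauss (q *\<^sub>R z) - 1 = complex_of_real (exp (- ((q * norm z)\<^sup>2 / 2)) - 1)"
    using assms by (simp add: gauss_def)
  moreover have "exp (- ((q * norm z)\<^sup>2 / 2)) \<le> 1" by simp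
  ultimately show ?thesis by (simp only: norm_of_real)
qed

text \<open>The scalings of space and frequency are reciprocal when the frequency spread equals
  \<open>l\<close>, so the phase is just z . s.\<close>

abbreviation monomial_form ::
  "('n::finite phase \<Rightarrow> complex) \<Rightarrow> 'n list \<Rightarrow> real^'n \<Rightarrow> real^'n \<Rightarrow> real^'n \<Rightarrow> real \<Rightarrow> real \<Rightarrow> complex"
  where "monomial_form H w y c e l q \<equiv> (LINT z|lborel. LINT s|lborel. H (y + (1 / l) *\<^sub>R z, c, e) *
    of_real (prod_list (map (($) s) w)) * gauss s * exp (\<i> * of_real (z \<bullet> s)) * gauss (q *\<^sub>R z))"

text \<open>One term of the Taylor expansion in \<open>\<xi>\<close>: the \<open>s\<close>-integral is a derivative of the Gaussian,
  and integrating by parts in \<open>z\<close> turns the factor \<open>s\<^sup>w\<close> into \<open>x\<close>-derivatives of the symbol.\<close>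
lemma packet_term:
  fixes F :: "'n::finite phase \<Rightarrow> complex"
  assumes F: "F \<in> symbol_class \<rho> \<delta> m"
  shows "\<exists>C>0. \<forall>y c e l q. 0 < l \<longrightarrow> 0 < q \<longrightarrow> q \<le> 1 \<longrightarrow>
    norm (monomial_form (foldr dir_deriv (xi_word w) F) w y c e l q -
      gauss_mass TYPE(real^'n) * (\<i> / of_real l) ^ length w * gauss_average (foldr dir_deriv (x_word w @ xi_word w) F) y c e l)
    \<le> C * q * wt (y, c, e) powr (m - \<rho> * real (length w))"
proof -
  define vs :: "(real^'n) list" where "vs = map (\<lambda>i. axis i 1) w"
  define k where "k = length w"
  define V where "V = foldr dir_deriv vs gauss"
  define H where "H = foldr dir_deriv (xi_word w) F"
  let ?m = "gauss_mass TYPE(real^'n)"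
  have H: "H \<in> symbol_class \<rho> \<delta> (m - \<rho> * real k)" unfolding H_def k_def by (rule symbol_class_xi_word[OF F])
  obtain C where C: "C > 0" "\<And>p. norm (H p) \<le> C * wt p powr (m - \<rho> * real k)" using symbol_class_bound[OF H] by blast
  obtain D j where D: "D \<ge> 0" "\<And>z. norm (V z) \<le> D * gauss_dom j (1 / 4) z"
    unfolding V_def using gauss_derivs_bound[of vs] by blast
  define I where "I = (LINT z|lborel. gauss_dom (2 + j) (1 / 4) (z::real^'n))"
  have I: "I \<ge> 0" unfolding I_def by (intro integral_nonneg_AE) (auto simp: gauss_dom_nonneg)
  have prod: "prod_list (map (\<lambda>v. v \<bullet> s) vs) = prod_list (map (($) s) w)" for s
    unfolding vs_def by (simp add: comp_def inner_axis' inner_commute[of "axis _ _"] inner_axis)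
  have x_word: "map in_x vs = x_word w" by (simp add: vs_def x_word_def)
  have inner: "(LINT s|lborel. of_real (prod_list (map (($) s) w)) * gauss s * exp (\<i> * of_real (z \<bullet> s))) = ?m * (- \<i>) ^ k * V z" for z
  proof -
    have "(- \<i>) ^ k * (\<i> ^ k * (LINT s|lborel. of_real (prod_list (map (($) s) w)) * gauss s * exp (\<i> * of_real (z \<bullet> s)))) = (- \<i>) ^ k * (?m * V z)"
      using fourier_poly_gauss[of vs z] unfolding prod V_def k_def by (simp add: vs_def)
    moreover have "(- \<i>) ^ k * \<i> ^ k = (1 :: complex)" by (simp flip: power_mult_distrib)
    ultimately have "1 * (LINT s|lborel. of_real (prod_list (map (($) s) w)) * gauss s * exp (\<i> * of_real (z \<bullet> s))) = (- \<i>) ^ k * (?m * V z)"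
      by (simp only: mult.assoc[symmetric])
    then show ?thesis by (simp only: mult_1_left mult_ac)
  qed
  have main: "norm (monomial_form H w y c e l q -
      ?m * (\<i> / of_real l) ^ k * gauss_average (foldr dir_deriv (x_word w) H) y c e l)
    \<le> (norm ?m * (C * q * wt (y, c, e) powr (m - \<rho> * real k) * D)) * I"
    if l: "0 < l" and q: "0 < q" "q \<le> 1" for y c e l q
  proof -
    define u where "u = (\<lambda>z. H (y + (1 / l) *\<^sub>R z, c, e))"
    note du = in_x_affine_derivs_bounded[OF H, where y=y and a="1 / l" and c=c and e=e, folded u_def]
    have ub: "norm (u z) \<le> C * wt (y, c, e) powr (m - \<rho> * real k)" for z
      unfolding u_def using C(2)[of "(y + (1 / l) *\<^sub>R z, c, e)"] by (simp add: wt_eq)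
    have sV: "smooth V" unfolding V_def by (intro smooth_foldr_dir_deriv smooth_gauss)
    have 1: "(LINT s|lborel. H (y + (1 / l) *\<^sub>R z, c, e) *
        of_real (prod_list (map (($) s) w)) * gauss s * exp (\<i> * of_real (z \<bullet> s)) * gauss (q *\<^sub>R z)) =
        ?m * (- \<i>) ^ k * (u z * V z * gauss (q *\<^sub>R z))" for z
    proof -
      have "(LINT s|lborel. H (y + (1 / l) *\<^sub>R z, c, e) *
        of_real (prod_list (map (($) s) w)) * gauss s * exp (\<i> * of_real (z \<bullet> s)) * gauss (q *\<^sub>R z)) =
        (LINT s|lborel. (u z * gauss (q *\<^sub>R z)) * (of_real (prod_list (map (($) s) w)) * gauss s * exp (\<i> * of_real (z \<bullet> s))))"
        by (rule Bochner_Integration.integral_cong) (simp_all add: u_def mult_ac)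
      also have "\<dots> = (u z * gauss (q *\<^sub>R z)) * (?m * (- \<i>) ^ k * V z)"
        unfolding integral_mult_right_zero inner ..
      finally show ?thesis by (simp add: mult_ac)
    qed
    have cont: "continuous_on UNIV u" "continuous_on UNIV V"
      using du(1) sV by (auto intro: smooth_continuous)
    have contg: "continuous_on UNIV (\<lambda>z. gauss (q *\<^sub>R z))"
      by (rule continuous_on_compose2[OF smooth_continuous[OF smooth_gauss]]) (auto intro!: continuous_intros)
    have uV: "norm (u z * V z) \<le> (C * wt (y, c, e) powr (m - \<rho> * real k) * D) * gauss_dom (0 + j) (1 / 4) z" for z
      by (rule gauss_dom_mult_le) (use ub D in auto)
    have i1: "integrable lborel (\<lambda>z. u z * V z)"
      using uV by (intro integrable_gauss_dominated[of "1/4"] borel_measurable_continuous_onI continuous_intros cont contg) auto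
    \<comment> \<open>The wide Gaussian is replaced by 1 before the integration by parts, at the
      price of a factor \<open>q\<close>; otherwise derivatives would fall on it too.\<close>
    have uVq: "norm ((gauss (q *\<^sub>R z) - 1) * (u z * V z)) \<le> (q * (C * wt (y, c, e) powr (m - \<rho> * real k) * D)) * gauss_dom (2 + (0 + j)) (1 / 4) z" for z
      by (rule gauss_dom_mult_le[OF one_minus_gauss_le uV]) (use q in auto)
    have i2: "integrable lborel (\<lambda>z. (gauss (q *\<^sub>R z) - 1) * (u z * V z))"
      using uVq by (intro integrable_gauss_dominated[of "1/4"] borel_measurable_continuous_onI continuous_intros cont contg) auto
    have split: "(LINT z|lborel. u z * V z * gauss (q *\<^sub>R z)) = (LINT z|lborel. u z * V z) + (LINT z|lborel. (gauss (q *\<^sub>R z) - 1) * (u z * V z))"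
      by (subst Bochner_Integration.integral_add[OF i1 i2, symmetric], rule Bochner_Integration.integral_cong) (simp_all add: algebra_simps)
    have "(LINT z|lborel. u z * V z) = (- 1) ^ length vs * (LINT z|lborel. foldr dir_deriv vs u z * gauss z)"
      unfolding V_def by (rule integral_by_parts_gauss[OF du(1) du(3)])
    also have "(LINT z|lborel. foldr dir_deriv vs u z * gauss z) = of_real ((1 / l) ^ k) * gauss_average (foldr dir_deriv (x_word w) H) y c e l"
      unfolding du(2) x_word gauss_average_def mult.assoc integral_mult_right_zero by (simp add: vs_def k_def)
    finally have ibp: "(LINT z|lborel. u z * V z) = (- 1) ^ k * (of_real ((1 / l) ^ k) * gauss_average (foldr dir_deriv (x_word w) H) y c e l)"
      by (simp add: vs_def k_def)
    \<comment> \<open>The sign (-1)^k from the integration by parts turns (-i)^k from the frequency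
      integral into i^k; the power of 1/l stems from the scaling of x.\<close>
    have "?m * (- \<i>) ^ k * (LINT z|lborel. u z * V z) = ?m * (\<i> / of_real l) ^ k * gauss_average (foldr dir_deriv (x_word w) H) y c e l"
    proof -
      have "(- \<i>) ^ k * (- 1) ^ k = (\<i> :: complex) ^ k" by (simp flip: power_mult_distrib)
      then have e: "(- \<i>) ^ k * (- 1) ^ k * of_real ((1 / l) ^ k) = (\<i> / of_real l) ^ k" by (simp add: power_divide)
      have "?m * (- \<i>) ^ k * ((- 1) ^ k * (a * g)) = ?m * ((- \<i>) ^ k * (- 1) ^ k * a) * g" for a g
        by (simp only: mult.assoc)
      then show ?thesis unfolding ibp by (simp only: e)
    qed
    then have "monomial_form H w y c e l q -
      ?m * (\<i> / of_real l) ^ k * gauss_average (foldr dir_deriv (x_word w) H) y c e l = ?m * (- \<i>) ^ k * (LINT z|lborel. (gauss (q *\<^sub>R z) - 1) * (u z * V z))"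
      unfolding 1 integral_mult_right_zero split distrib_left by (simp only: add_diff_cancel_left')
    then have eq: "norm (monomial_form H w y c e l q -
      ?m * (\<i> / of_real l) ^ k * gauss_average (foldr dir_deriv (x_word w) H) y c e l) = norm ?m * norm (LINT z|lborel. (gauss (q *\<^sub>R z) - 1) * (u z * V z))"
      by (simp only: norm_mult norm_power norm_minus_cancel norm_ii power_one mult_1_right)
    have "norm (LINT z|lborel. (gauss (q *\<^sub>R z) - 1) * (u z * V z)) \<le> (q * (C * wt (y, c, e) powr (m - \<rho> * real k) * D)) * I"
      unfolding I_def using norm_integral_gauss_dominated[OF _ uVq] by simp
    from mult_left_mono[OF this norm_ge_zero[of ?m]] show ?thesis
      unfolding eq by (simp only: mult_ac)
  qed
  have HH: "foldr dir_deriv (x_word w) H = foldr dir_deriv (x_word w @ xi_word w) F" by (simp add: H_def)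
  define B where "B = norm ?m * C * D * I + 1"
  have fin: "(norm ?m * (C * q * Z * D)) * I \<le> B * q * Z" if "0 < q" "0 \<le> Z" for q Z
  proof -
    have "(norm ?m * C * D * I) * (q * Z) \<le> B * (q * Z)" unfolding B_def using that by (intro mult_right_mono) auto
    then show ?thesis by (simp add: mult_ac)
  qed
  have all: "\<forall>y c e l q. 0 < l \<longrightarrow> 0 < q \<longrightarrow> q \<le> 1 \<longrightarrow> norm (monomial_form H w y c e l q -
      ?m * (\<i> / of_real l) ^ k * gauss_average (foldr dir_deriv (x_word w) H) y c e l)
    \<le> B * q * wt (y, c, e) powr (m - \<rho> * real k)"
    by (intro allI impI order_trans[OF main fin]) auto
  have Bpos: "B > 0" unfolding B_def using C D I by (intro add_nonneg_pos mult_nonneg_nonneg) auto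
  show ?thesis
    by (rule exI[of _ B], rule conjI[OF Bpos all[unfolded HH, unfolded k_def H_def]])
qed

text \<open>The origin of the loss q^(-n): the Taylor remainder is estimated in absolute value, so
  the mass of the wide Gaussian in \<open>z\<close> enters in full.\<close>

lemma integral_gauss_dom_scaled:
  assumes q: "q > 0"
  shows "(LINT z|lborel. gauss_dom 0 (q\<^sup>2 / 2) (z::'a::euclidean_space)) = (LINT z|lborel. gauss_dom 0 (1 / 2) (z::'a)) / q ^ DIM('a)"
proof -
  have 1: "complex_of_real (LINT z|lborel. gauss_dom 0 (q\<^sup>2 / 2) (z::'a)) = (LINT z|lborel. gauss (q *\<^sub>R (z::'a)))"
    unfolding integral_complex_of_real[symmetric]
    by (intro Bochner_Integration.integral_cong refl) (simp add: gauss_def gauss_dom_def power_mult_distrib)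
  have 2: "complex_of_real (LINT z|lborel. gauss_dom 0 (1 / 2) (z::'a)) = (LINT z|lborel. gauss (z::'a))"
    unfolding integral_complex_of_real[symmetric]
    by (intro Bochner_Integration.integral_cong refl) (simp add: gauss_def gauss_dom_def)
  have "(LINT z|lborel. gauss (z::'a)) = of_real (\<bar>q\<bar> ^ DIM('a)) * (LINT z|lborel. gauss (0 + q *\<^sub>R (z::'a)))"
    using q by (intro integral_lborel_affine) simp
  then have "complex_of_real (LINT z|lborel. gauss_dom 0 (1 / 2) (z::'a)) = complex_of_real (q ^ DIM('a) * (LINT z|lborel. gauss_dom 0 (q\<^sup>2 / 2) (z::'a)))"
    unfolding of_real_mult 1 2 using q by simp
  then have "(LINT z|lborel. gauss_dom 0 (1 / 2) (z::'a)) = q ^ DIM('a) * (LINT z|lborel. gauss_dom 0 (q\<^sup>2 / 2) (z::'a))"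
    by (simp only: of_real_eq_iff)
  then show ?thesis using q by simp
qed

lemma continuous_on_monomial:
  "continuous_on UNIV (\<lambda>p::'a::topological_space \<times> (real^'n::finite). prod_list (map (($) (snd p)) w))"
  by (induction w) (auto intro!: continuous_intros)

lemma packet_term_integrable:
  fixes H :: "'n::finite phase \<Rightarrow> complex"
  assumes H: "H \<in> symbol_class \<rho> \<delta> m" and q: "q \<noteq> 0"
  shows "iterated_integrable (\<lambda>(z, s). H (y + (1 / l) *\<^sub>R z, c, e) * of_real (prod_list (map (($) s) w)) * gauss s *
      exp (\<i> * of_real (z \<bullet> s)) * gauss (q *\<^sub>R z))"
proof -
  note cF = continuous_on_compose2[OF smooth_continuous[OF symbol_class_smooth[OF H]] _ subset_UNIV]
  note cg = continuous_on_compose2[OF smooth_continuous[OF smooth_gauss] _ subset_UNIV]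
  obtain C where C: "C > 0" "\<And>p. norm (H p) \<le> C * wt p powr m" using symbol_class_bound[OF H] by blast
  show ?thesis
  proof (rule iterated_integrableI)
    show "continuous_on UNIV (\<lambda>(z, s). H (y + (1 / l) *\<^sub>R z, c, e) * of_real (prod_list (map (($) s) w)) * gauss s *
      exp (\<i> * of_real (z \<bullet> s)) * gauss (q *\<^sub>R z))"
      unfolding case_prod_unfold
      by (intro continuous_on_mult cF cg continuous_on_exp continuous_on_of_real continuous_on_monomial continuous_intros)
    show "q\<^sup>2 / 2 > 0" "(1 / 2 :: real) > 0" using q by auto
    fix z s :: "real^'n"
    have 1: "norm (H (y + (1 / l) *\<^sub>R z, c, e)) \<le> C * wt (y, c, e) powr m"
      using C(2)[of "(y + (1 / l) *\<^sub>R z, c, e)"] by (simp add: wt_eq)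
    have "\<bar>prod_list (map (($) s) w)\<bar> \<le> norm s ^ length w" by (rule abs_prod_list_components_le)
    also have "\<dots> \<le> (1 + norm s) ^ length w" by (intro power_mono) auto
    finally have 2: "norm (complex_of_real (prod_list (map (($) s) w))) \<le> (1 + norm s) ^ length w" by simp
    have "norm (H (y + (1 / l) *\<^sub>R z, c, e) * of_real (prod_list (map (($) s) w)) * gauss s * exp (\<i> * of_real (z \<bullet> s)) * gauss (q *\<^sub>R z)) =
      norm (H (y + (1 / l) *\<^sub>R z, c, e)) * norm (complex_of_real (prod_list (map (($) s) w))) * (gauss_dom 0 (1 / 2) s * gauss_dom 0 (q\<^sup>2 / 2) z)"
      unfolding norm_mult norm_exp_i_times norm_gauss_scaled unfolding gauss_eq_gauss_dom by simp
    also have "\<dots> \<le> (C * wt (y, c, e) powr m) * (1 + norm s) ^ length w * (gauss_dom 0 (1 / 2) s * gauss_dom 0 (q\<^sup>2 / 2) z)"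
      by (intro mult_right_mono mult_mono' 1 2) (auto simp: gauss_dom_nonneg)
    also have "\<dots> = (C * wt (y, c, e) powr m) * gauss_dom 0 (q\<^sup>2 / 2) z * ((1 + norm s) ^ length w * gauss_dom 0 (1 / 2) s)"
      by (simp only: mult_ac)
    finally show "norm ((\<lambda>(z, s). H (y + (1 / l) *\<^sub>R z, c, e) * of_real (prod_list (map (($) s) w)) * gauss s *
      exp (\<i> * of_real (z \<bullet> s)) * gauss (q *\<^sub>R z)) (z, s)) \<le> (C * wt (y, c, e) powr m) * gauss_dom 0 (q\<^sup>2 / 2) z * gauss_dom (length w + 0) (1 / 2) s"
      unfolding gauss_dom_absorb by simp
  qed
qed

lemma power_le_powr_bound:
  assumes "0 < l" "l \<le> 2 * X powr \<kappa>" "1 \<le> (X::real)"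
  shows "l ^ k \<le> 2 ^ k * X powr (\<kappa> * real k)"
proof -
  have "l ^ k \<le> (2 * X powr \<kappa>) ^ k" using assms by (intro power_mono) auto
  also have "\<dots> = 2 ^ k * X powr (\<kappa> * real k)"
    using assms by (simp add: power_mult_distrib powr_powr flip: powr_realpow)
  finally show ?thesis .
qed

text \<open>M derivatives in frequency gain X^(-\<rho> M), and the spread contributes l^M <= 2^M
  X^(\<kappa> M). \<open>wt_segment_powr\<close> moves the weight from the intermediate point back
  to the base point at the cost of powers of 1 + |s|.\<close>

lemma packet_form_taylor_remainder:
  fixes F :: "'n::finite phase \<Rightarrow> complex"
  assumes F: "F \<in> symbol_class \<rho> \<delta> m" and \<kappa>: "0 \<le> \<kappa>" "\<kappa> < 1"
  shows "\<exists>C>0. \<forall>y c e l q. 0 < l \<longrightarrow> l \<le> 2 * wt (y, c, e) powr \<kappa> \<longrightarrow> 0 < q \<longrightarrow>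
    norm (packet_form F y c e l l q - (\<Sum>k<M. \<Sum>w | length w = k. of_real (l ^ k / fact k) *
      monomial_form (foldr dir_deriv (xi_word w) F) w y c e l q))
    \<le> C * (wt (y, c, e) powr (m - (\<rho> - \<kappa>) * real M) / q ^ CARD('n))"
proof -
  obtain C1 where C1: "C1 > 0" "\<And>p a s. norm ((dir_deriv (in_xi (a *\<^sub>R s)) ^^ M) F p) \<le> C1 * (\<bar>a\<bar> * norm s) ^ M * wt p powr (m - \<rho> * real M)"
    using xi_deriv_bound[OF F, of M] by blast
  obtain C2 P where C2: "C2 > 0" "\<And>y (c::real^'n) e s l t. 0 < l \<Longrightarrow> l \<le> 2 * wt (y, c, e) powr \<kappa> \<Longrightarrow> 0 \<le> t \<Longrightarrow> t \<le> 1 \<Longrightarrow>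
    wt (y, c + (t * l) *\<^sub>R s, e) powr (m - \<rho> * real M) \<le> C2 * wt (y, c, e) powr (m - \<rho> * real M) * (1 + norm s) ^ P"
    using wt_segment_powr[OF \<kappa>, of "m - \<rho> * real M"] by blast
  define Iz where "Iz = (LINT z|lborel. gauss_dom 0 (1 / 2) (z::real^'n))"
  define Is where "Is = (LINT s|lborel. gauss_dom (M + P) (1 / 2) (s::real^'n))"
  have I: "Iz \<ge> 0" "Is \<ge> 0" unfolding Iz_def Is_def by (intro integral_nonneg_AE; auto simp: gauss_dom_nonneg)+
  define C where "C = C1 * C2 * 2 ^ M * Iz * Is"
  have main: "norm (packet_form F y c e l l q - (\<Sum>k<M. \<Sum>w | length w = k. of_real (l ^ k / fact k) *
      monomial_form (foldr dir_deriv (xi_word w) F) w y c e l q))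
    \<le> C * (wt (y, c, e) powr (m - (\<rho> - \<kappa>) * real M) / q ^ CARD('n))"
    if l: "0 < l" "l \<le> 2 * wt (y, c, e) powr \<kappa>" and q: "0 < q" for y c e l q
  proof -
    define X where "X = wt (y, c, e)"
    have X: "X \<ge> 1" unfolding X_def by (rule wt_ge_1)
    define f0 where "f0 = (\<lambda>(z, s). F (y + (1 / l) *\<^sub>R z, c + l *\<^sub>R s, e) * gauss s * exp (\<i> * of_real (1 * (z \<bullet> s))) * gauss (q *\<^sub>R z))"
    define f where "f = (\<lambda>w (z, s). foldr dir_deriv (xi_word w) F (y + (1 / l) *\<^sub>R z, c, e) *
        of_real (prod_list (map (($) s) w)) * gauss s * exp (\<i> * of_real (z \<bullet> s)) * gauss (q *\<^sub>R z))"
    define h where "h = (\<lambda>p. \<Sum>k<M. \<Sum>w | length (w::'n list) = k. of_real (l ^ k / fact k) * f w p)"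
    have q0: "q \<noteq> 0" using q by simp
    have i0: "iterated_integrable f0" unfolding f0_def by (rule packet_form_integrand_integrable[OF F q0])
    have iw: "iterated_integrable (f w)" for w unfolding f_def by (rule packet_term_integrable[OF symbol_class_xi_word[OF F] q0])
    have ih: "iterated_integrable h" unfolding h_def by (intro iterated_integral_sum(1) iterated_integrable_cmult iw)
    have h: "(LINT z|lborel. LINT s|lborel. h (z, s)) = (\<Sum>k<M. \<Sum>w | length w = k. of_real (l ^ k / fact k) * (LINT z|lborel. LINT s|lborel. f w (z, s)))"
    proof -
      have "(LINT z|lborel. LINT s|lborel. h (z, s)) = (\<Sum>k<M. LINT z|lborel. LINT s|lborel. (\<Sum>w | length w = k. of_real (l ^ k / fact k) * f w (z, s)))"
        unfolding h_def
        by (rule iterated_integral_sum(2)[where I="{..<M}" and f="\<lambda>k p. \<Sum>w | length w = k. of_real (l ^ k / fact k) * f w p"])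
          (intro iterated_integral_sum(1) iterated_integrable_cmult iw)
      also have "\<dots> = (\<Sum>k<M. \<Sum>w | length w = k. LINT z|lborel. LINT s|lborel. of_real (l ^ k / fact k) * f w (z, s))"
        by (intro sum.cong refl iterated_integral_sum(2)[where f="\<lambda>w p. of_real (l ^ k / fact k) * f w p" for k] iterated_integrable_cmult iw)
      finally show ?thesis by (simp only: integral_mult_right_zero)
    qed
    have p: "packet_form F y c e l l q = (LINT z|lborel. LINT s|lborel. f0 (z, s))"
      using l by (simp add: packet_form_def f0_def)
    have bd: "norm (f0 (z, s) - h (z, s)) \<le> (C1 * C2 * 2 ^ M * X powr (m - (\<rho> - \<kappa>) * real M)) * gauss_dom 0 (q\<^sup>2 / 2) z * gauss_dom (M + P) (1 / 2) s" for z s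
    proof -
      let ?p = "(y + (1 / l) *\<^sub>R z, c, e)"
      define G where "G = gauss s * exp (\<i> * of_real (z \<bullet> s)) * gauss (q *\<^sub>R z)"
      have tay: "(\<Sum>k<M. (dir_deriv (in_xi (l *\<^sub>R s)) ^^ k) F ?p / fact k) * G = h (z, s)"
        unfolding funpow_dir_deriv_in_xi[OF symbol_class_smooth[OF F]] h_def f_def G_def
        by (simp add: sum_distrib_right sum_distrib_left sum_divide_distrib mult_ac)
      have pv: "?p + in_xi (l *\<^sub>R s) = (y + (1 / l) *\<^sub>R z, c + l *\<^sub>R s, e)" by (simp add: in_xi_def)
      have "norm (F (?p + in_xi (l *\<^sub>R s)) - (\<Sum>k<M. (dir_deriv (in_xi (l *\<^sub>R s)) ^^ k) F ?p / fact k)) \<le>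
          C1 * C2 * 2 ^ M * X powr (m - (\<rho> - \<kappa>) * real M) * (1 + norm s) ^ (M + P)"
      proof (rule taylor_along_line[OF symbol_class_smooth[OF F]])
        fix t :: real assume t: "0 \<le> t" "t \<le> 1"
        have tp: "?p + t *\<^sub>R in_xi (l *\<^sub>R s) = (y + (1 / l) *\<^sub>R z, c + (t * l) *\<^sub>R s, e)" by (simp add: in_xi_def)
        have w: "wt (y + (1 / l) *\<^sub>R z, c + (t * l) *\<^sub>R s, e) powr (m - \<rho> * real M) \<le> C2 * X powr (m - \<rho> * real M) * (1 + norm s) ^ P"
          using C2(2)[OF l t, of s] by (simp add: X_def wt_eq)
        have lM: "(\<bar>l\<bar> * norm s) ^ M \<le> (2 ^ M * X powr (\<kappa> * real M)) * (1 + norm s) ^ M"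
          unfolding power_mult_distrib using power_le_powr_bound[OF l(1) l(2)[folded X_def] X, of M] l
          by (intro mult_mono power_mono) auto
        have "norm ((dir_deriv (in_xi (l *\<^sub>R s)) ^^ M) F (?p + t *\<^sub>R in_xi (l *\<^sub>R s)))
          \<le> C1 * (\<bar>l\<bar> * norm s) ^ M * wt (y + (1 / l) *\<^sub>R z, c + (t * l) *\<^sub>R s, e) powr (m - \<rho> * real M)"
          unfolding tp by (rule C1(2))
        also have "\<dots> \<le> C1 * ((2 ^ M * X powr (\<kappa> * real M)) * (1 + norm s) ^ M) * (C2 * X powr (m - \<rho> * real M) * (1 + norm s) ^ P)"
          using C1(1) C2(1) by (intro mult_mono mult_left_mono lM w) auto
        also have "\<dots> = C1 * C2 * 2 ^ M * (X powr (\<kappa> * real M) * X powr (m - \<rho> * real M)) * (1 + norm s) ^ (M + P)"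
          by (simp add: power_add mult_ac)
        also have "X powr (\<kappa> * real M) * X powr (m - \<rho> * real M) = X powr (m - (\<rho> - \<kappa>) * real M)"
          by (simp add: algebra_simps flip: powr_add)
        finally show "norm ((dir_deriv (in_xi (l *\<^sub>R s)) ^^ M) F (?p + t *\<^sub>R in_xi (l *\<^sub>R s))) \<le>
          C1 * C2 * 2 ^ M * X powr (m - (\<rho> - \<kappa>) * real M) * (1 + norm s) ^ (M + P)" .
      qed
      then have "norm (F (?p + in_xi (l *\<^sub>R s)) - (\<Sum>k<M. (dir_deriv (in_xi (l *\<^sub>R s)) ^^ k) F ?p / fact k)) * norm G \<le>
          (C1 * C2 * 2 ^ M * X powr (m - (\<rho> - \<kappa>) * real M) * (1 + norm s) ^ (M + P)) * norm G"
        by (rule mult_right_mono) simp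
      moreover have "f0 (z, s) - h (z, s) = (F (?p + in_xi (l *\<^sub>R s)) - (\<Sum>k<M. (dir_deriv (in_xi (l *\<^sub>R s)) ^^ k) F ?p / fact k)) * G"
        unfolding left_diff_distrib tay pv by (simp add: f0_def G_def mult_ac)
      moreover have "norm G = gauss_dom 0 (1 / 2) s * gauss_dom 0 (q\<^sup>2 / 2) z"
        unfolding G_def norm_mult norm_exp_i_times norm_gauss_scaled unfolding gauss_eq_gauss_dom by simp
      ultimately have "norm (f0 (z, s) - h (z, s)) \<le> (C1 * C2 * 2 ^ M * X powr (m - (\<rho> - \<kappa>) * real M) * (1 + norm s) ^ (M + P)) * (gauss_dom 0 (1 / 2) s * gauss_dom 0 (q\<^sup>2 / 2) z)"
        by (simp only: norm_mult)
      also have "\<dots> = (C1 * C2 * 2 ^ M * X powr (m - (\<rho> - \<kappa>) * real M)) * gauss_dom 0 (q\<^sup>2 / 2) z * ((1 + norm s) ^ (M + P) * gauss_dom 0 (1 / 2) s)"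
        by (simp only: mult_ac)
      finally show ?thesis unfolding gauss_dom_absorb by simp
    qed
    have "norm (LINT z|lborel. LINT s|lborel. f0 (z, s) - h (z, s)) \<le>
        (C1 * C2 * 2 ^ M * X powr (m - (\<rho> - \<kappa>) * real M)) * (LINT z|lborel. gauss_dom 0 (q\<^sup>2 / 2) (z::real^'n)) * (LINT s|lborel. gauss_dom (M + P) (1 / 2) (s::real^'n))"
      by (rule norm_iterated_integral_le[of "q\<^sup>2 / 2" "1 / 2" "\<lambda>p. f0 p - h p"]) (use q bd in auto)
    also have "\<dots> = C * (X powr (m - (\<rho> - \<kappa>) * real M) / q ^ CARD('n))"
      unfolding integral_gauss_dom_scaled[OF q] by (simp add: C_def Iz_def Is_def)
    finally show ?thesis
      unfolding iterated_integral_diff[OF i0 ih] h p[symmetric] by (simp add: f_def X_def)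
  qed
  have "C * Z \<le> (C + 1) * Z" if "Z \<ge> 0" for Z using that by (intro mult_right_mono) auto
  note fin = this
  show ?thesis
  proof (rule exI[of _ "C + 1"], rule conjI)
    show "C + 1 > 0" unfolding C_def using I C1(1) C2(1) by (intro add_nonneg_pos mult_nonneg_nonneg) auto
  qed (use order_trans[OF main fin] in auto)
qed

text \<open>Each Taylor term is replaced by its Gaussian average through \<open>packet_term\<close>.
  The errors q l^k X^(m - \<rho> k) are all at most a constant times q X^m, because \<kappa> <
  \<rho>.\<close>

lemma packet_form_expand:
  fixes F :: "'n::finite phase \<Rightarrow> complex"
  assumes F: "F \<in> symbol_class \<rho> \<delta> m" and \<kappa>: "0 \<le> \<kappa>" "\<kappa> < \<rho>" "\<rho> \<le> 1"
  shows "\<exists>C>0. \<forall>y c e l q. 0 < l \<longrightarrow> l \<le> 2 * wt (y, c, e) powr \<kappa> \<longrightarrow> 0 < q \<longrightarrow> q \<le> 1 \<longrightarrow>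
    norm (packet_form F y c e l l q - gauss_mass TYPE(real^'n) * (\<Sum>k<M. \<Sum>w | length w = k. \<i> ^ k / fact k *
      gauss_average (foldr dir_deriv (x_word w @ xi_word w) F) y c e l))
    \<le> C * (q * wt (y, c, e) powr m + wt (y, c, e) powr (m - (\<rho> - \<kappa>) * real M) / q ^ CARD('n))"
proof -
  let ?m = "gauss_mass TYPE(real^'n)"
  have "\<kappa> < 1" using \<kappa> by simp
  from packet_form_taylor_remainder[OF F \<kappa>(1) this, of M]
  obtain C1 where C1: "C1 > 0" "\<And>y c e l q. 0 < l \<Longrightarrow> l \<le> 2 * wt (y, c, e) powr \<kappa> \<Longrightarrow> 0 < q \<Longrightarrow>
    norm (packet_form F y c e l l q - (\<Sum>k<M. \<Sum>w | length w = k. of_real (l ^ k / fact k) *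
      monomial_form (foldr dir_deriv (xi_word w) F) w y c e l q))
    \<le> C1 * (wt (y, c, e) powr (m - (\<rho> - \<kappa>) * real M) / q ^ CARD('n))" by blast
  have "\<forall>w. \<exists>C>0. \<forall>y c e l q. 0 < l \<longrightarrow> 0 < q \<longrightarrow> q \<le> 1 \<longrightarrow>
    norm (monomial_form (foldr dir_deriv (xi_word w) F) w y c e l q -
      ?m * (\<i> / of_real l) ^ length w * gauss_average (foldr dir_deriv (x_word w @ xi_word w) F) y c e l)
    \<le> C * q * wt (y, c, e) powr (m - \<rho> * real (length w))"
    using packet_term[OF F] by (intro allI)
  from choice[OF this] obtain C2 where C2: "\<And>w. C2 w > 0" "\<And>w y c e l q. 0 < l \<Longrightarrow> 0 < q \<Longrightarrow> q \<le> 1 \<Longrightarrow>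
    norm (monomial_form (foldr dir_deriv (xi_word w) F) w y c e l q -
      ?m * (\<i> / of_real l) ^ length w * gauss_average (foldr dir_deriv (x_word w @ xi_word w) F) y c e l)
    \<le> C2 w * q * wt (y, c, e) powr (m - \<rho> * real (length w))" by blast
  define D where "D = (\<Sum>k<M. \<Sum>w | length (w::'n list) = k. 2 ^ k * C2 w)"
  have D: "D \<ge> 0" unfolding D_def using C2(1) by (intro sum_nonneg mult_nonneg_nonneg) (auto simp: less_imp_le)
  have main: "norm (packet_form F y c e l l q - ?m * (\<Sum>k<M. \<Sum>w | length w = k. \<i> ^ k / fact k *
      gauss_average (foldr dir_deriv (x_word w @ xi_word w) F) y c e l))
    \<le> (C1 + D) * (q * wt (y, c, e) powr m + wt (y, c, e) powr (m - (\<rho> - \<kappa>) * real M) / q ^ CARD('n))"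
    if l: "0 < l" "l \<le> 2 * wt (y, c, e) powr \<kappa>" and q: "0 < q" "q \<le> 1" for y c e l q
  proof -
    define X where "X = wt (y, c, e)"
    have X: "X \<ge> 1" unfolding X_def by (rule wt_ge_1)
    define J where "J w = monomial_form (foldr dir_deriv (xi_word w) F) w y c e l q" for w
    define A where "A w = gauss_average (foldr dir_deriv (x_word w @ xi_word w) F) y c e l" for w
    have t: "norm (of_real (l ^ k / fact k) * J w - ?m * (\<i> ^ k / fact k * A w)) \<le> (2 ^ k * C2 w) * (q * X powr m)"
      if w: "length w = k" for w k
    proof -
      \<comment> \<open>The l^k of the Taylor term cancels the l^(-k) of the scaling in x, so the
        expansion depends on \<open>l\<close> only through the averages.\<close>
      have "?m * (\<i> ^ k / fact k * A w) = of_real (l ^ k / fact k) * (?m * (\<i> / of_real l) ^ k * A w)"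
        using l by (simp add: power_divide)
      then have "of_real (l ^ k / fact k) * J w - ?m * (\<i> ^ k / fact k * A w) = of_real (l ^ k / fact k) * (J w - ?m * (\<i> / of_real l) ^ k * A w)"
        by (simp only: right_diff_distrib)
      then have "norm (of_real (l ^ k / fact k) * J w - ?m * (\<i> ^ k / fact k * A w)) = l ^ k / fact k * norm (J w - ?m * (\<i> / of_real l) ^ k * A w)"
        using l by (simp add: norm_mult norm_divide norm_power)
      also have "\<dots> \<le> (2 ^ k * X powr (\<kappa> * real k)) * (C2 w * q * X powr (m - \<rho> * real k))"
      proof (rule mult_mono)
        have "l ^ k / fact k \<le> l ^ k / 1" using l by (intro divide_left_mono) (auto simp: fact_ge_1)
        then show "l ^ k / fact k \<le> 2 ^ k * X powr (\<kappa> * real k)"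
          using power_le_powr_bound[OF l(1) l(2)[folded X_def] X, of k] by simp
        show "norm (J w - ?m * (\<i> / of_real l) ^ k * A w) \<le> C2 w * q * X powr (m - \<rho> * real k)"
          using C2(2)[OF l(1) q, of w y c e] w unfolding J_def A_def X_def by simp
      qed (use X in auto)
      also have "\<dots> = (2 ^ k * C2 w) * (q * (X powr (\<kappa> * real k) * X powr (m - \<rho> * real k)))" by (simp only: mult_ac)
      also have "X powr (\<kappa> * real k) * X powr (m - \<rho> * real k) = X powr (m - (\<rho> - \<kappa>) * real k)"
        by (simp add: algebra_simps flip: powr_add)
      also have "(2 ^ k * C2 w) * (q * X powr (m - (\<rho> - \<kappa>) * real k)) \<le> (2 ^ k * C2 w) * (q * X powr m)"
        using X q \<kappa> C2(1)[of w] by (intro mult_left_mono powr_mono) auto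
      finally show ?thesis .
    qed
    have "norm ((\<Sum>k<M. \<Sum>w | length w = k. of_real (l ^ k / fact k) * J w) - ?m * (\<Sum>k<M. \<Sum>w | length w = k. \<i> ^ k / fact k * A w))
       = norm (\<Sum>k<M. \<Sum>w | length w = k. of_real (l ^ k / fact k) * J w - ?m * (\<i> ^ k / fact k * A w))"
      by (simp only: sum_subtractf sum_distrib_left)
    also have "\<dots> \<le> (\<Sum>k<M. \<Sum>w | length w = k. (2 ^ k * C2 w) * (q * X powr m))"
      by (intro sum_norm_le t) auto
    also have "\<dots> = D * (q * X powr m)" by (simp only: D_def sum_distrib_right)
    finally have 1: "norm ((\<Sum>k<M. \<Sum>w | length w = k. of_real (l ^ k / fact k) * J w) - ?m * (\<Sum>k<M. \<Sum>w | length w = k. \<i> ^ k / fact k * A w)) \<le> D * (q * X powr m)" .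
    have 2: "norm (packet_form F y c e l l q - (\<Sum>k<M. \<Sum>w | length w = k. of_real (l ^ k / fact k) * J w)) \<le> C1 * (X powr (m - (\<rho> - \<kappa>) * real M) / q ^ CARD('n))"
      unfolding J_def X_def by (rule C1(2)[OF l q(1)])
    have "norm (packet_form F y c e l l q - ?m * (\<Sum>k<M. \<Sum>w | length w = k. \<i> ^ k / fact k * A w)) \<le>
      C1 * (X powr (m - (\<rho> - \<kappa>) * real M) / q ^ CARD('n)) + D * (q * X powr m)"
      using norm_triangle_mono[OF 2 1] by simp
    also have "\<dots> \<le> (C1 + D) * (X powr (m - (\<rho> - \<kappa>) * real M) / q ^ CARD('n)) + (C1 + D) * (q * X powr m)"
      using C1(1) D q by (intro add_mono mult_right_mono) auto
    finally show ?thesis unfolding A_def X_def by (simp add: distrib_left add.commute)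
  qed
  then show ?thesis using C1(1) D by (intro exI[of _ "C1 + D"] conjI) auto
qed

section \<open>Recovering a symbol from its Gaussian averages\<close>

definition fdiff :: "'a::real_vector \<Rightarrow> ('a \<Rightarrow> complex) \<Rightarrow> 'a \<Rightarrow> complex"
  where "fdiff v f = (\<lambda>p. f (p + v) - f p)"

text \<open>The coefficients are binomial with alternating signs. A nonzero coefficient at the base
  point is all that is needed to solve for the value there.\<close>

lemma funpow_fdiff_expand:
  "\<exists>a :: nat \<Rightarrow> complex. a 0 \<noteq> 0 \<and> (\<forall>(f :: 'a::real_vector \<Rightarrow> complex) p v. (fdiff v ^^ J) f p = (\<Sum>j\<le>J. a j * f (p + real j *\<^sub>R v)))"
proof (induction J)
  case 0
  show ?case by (rule exI[of _ "\<lambda>_. 1"]) simp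
next
  case (Suc J)
  then obtain a :: "nat \<Rightarrow> complex" where a: "a 0 \<noteq> 0"
    "\<And>(f :: 'a \<Rightarrow> complex) p v. (fdiff v ^^ J) f p = (\<Sum>j\<le>J. a j * f (p + real j *\<^sub>R v))" by blast
  define b where "b j = (if j = 0 then 0 else a (j - 1)) - (if j \<le> J then a j else 0)" for j
  show ?case
  proof (rule exI[of _ b], intro conjI allI)
    show "b 0 \<noteq> 0" using a(1) by (simp add: b_def)
    fix f :: "'a \<Rightarrow> complex" and p v
    have "(fdiff v ^^ Suc J) f p = (\<Sum>j\<le>J. a j * f (p + v + real j *\<^sub>R v)) - (\<Sum>j\<le>J. a j * f (p + real j *\<^sub>R v))"
      by (simp add: fdiff_def[of v "(fdiff v ^^ J) f"] a(2))
    also have "(\<Sum>j\<le>J. a j * f (p + v + real j *\<^sub>R v)) = (\<Sum>j\<le>Suc J. (if j = 0 then 0 else a (j - 1)) * f (p + real j *\<^sub>R v))"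
      by (subst sum.atMost_Suc_shift) (simp add: scaleR_left_distrib add.assoc)
    also have "(\<Sum>j\<le>J. a j * f (p + real j *\<^sub>R v)) = (\<Sum>j\<le>Suc J. (if j \<le> J then a j else 0) * f (p + real j *\<^sub>R v))"
      by simp
    finally show "(fdiff v ^^ Suc J) f p = (\<Sum>j\<le>Suc J. b j * f (p + real j *\<^sub>R v))"
      by (simp only: b_def left_diff_distrib sum_subtractf)
  qed
qed

lemma funpow_fdiff_smooth:
  fixes f :: "'a::euclidean_space \<Rightarrow> complex"
  assumes f: "smooth f"
  shows "smooth ((fdiff v ^^ J) f) \<and> dir_deriv u ((fdiff v ^^ J) f) = (fdiff v ^^ J) (dir_deriv u f)"
proof (induction J)
  case (Suc J)
  let ?g = "(fdiff v ^^ J) f"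
  have g: "smooth ?g" using Suc by simp
  have eq: "fdiff v ?g = (\<lambda>p. ?g (v + p) + (- 1) * ?g p)" by (simp add: fdiff_def add.commute)
  have sh: "smooth (\<lambda>p. ?g (v + p))" by (rule smooth_compose_affine[OF bounded_linear_ident g])
  have "smooth (fdiff v ?g)" unfolding eq by (intro smooth_add smooth_cmult sh g)
  moreover have "dir_deriv u (fdiff v ?g) = fdiff v (dir_deriv u ?g)"
  proof
    fix x
    have "dir_deriv u (fdiff v ?g) x = dir_deriv u (\<lambda>p. ?g (v + p)) x + dir_deriv u (\<lambda>p. (- 1) * ?g p) x"
      unfolding eq by (intro dir_deriv_add smooth_differentiable sh smooth_cmult g)
    also have "\<dots> = dir_deriv u ?g (v + x) + (- 1) * dir_deriv u ?g x"
      by (simp only: dir_deriv_compose_affine[OF bounded_linear_ident smooth_differentiable[OF g]] dir_deriv_cmult[OF g])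
    finally show "dir_deriv u (fdiff v ?g) x = fdiff v (dir_deriv u ?g) x" by (simp add: fdiff_def add.commute)
  qed
  ultimately show ?case using Suc by simp
qed (use f in simp)

lemma funpow_fdiff_sum:
  "(fdiff v ^^ J) (\<lambda>p. \<Sum>i\<in>I. c i * f i p) = (\<lambda>p. \<Sum>i\<in>I. c i * (fdiff v ^^ J) (f i) p)"
  by (induction J) (simp_all add: fdiff_def right_diff_distrib sum_subtractf)

text \<open>Differences commute with derivatives, and shifts in x do not change the weight. Each
  difference therefore contributes one factor |z| and one x-derivative, that is, a factor
  X^\<delta>.\<close>

lemma funpow_fdiff_bound:
  fixes R :: "'n::finite phase \<Rightarrow> complex"
  assumes R: "R \<in> symbol_class \<rho> \<delta> m"
  shows "\<exists>C>0. \<forall>p z. norm ((fdiff (in_x z) ^^ J) R p) \<le> C * norm z ^ J * wt p powr (m + \<delta> * real J)"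
  using R
proof (induction J arbitrary: R m)
  case 0
  from symbol_class_bound[OF this] obtain C where "C > 0" "\<And>p. norm (R p) \<le> C * wt p powr m" by blast
  then show ?case by auto
next
  case (Suc J)
  define Ri where "Ri i = dir_deriv (in_x (axis i 1)) R" for i
  have Ri: "Ri i \<in> symbol_class \<rho> \<delta> (m + \<delta>)" for i
    using symbol_class_dir_deriv[OF Suc.prems, of "in_x (axis i 1)"] by (simp add: Ri_def pure_def in_x_def zero_prod_def)
  have "\<forall>i. \<exists>C>0. \<forall>p z. norm ((fdiff (in_x z) ^^ J) (Ri i) p) \<le> C * norm z ^ J * wt p powr (m + \<delta> + \<delta> * real J)"
    using Suc.IH[OF Ri] by blast
  from choice[OF this] obtain C where C: "\<And>i. C i > 0" "\<And>i p z. norm ((fdiff (in_x z) ^^ J) (Ri i) p) \<le> C i * norm z ^ J * wt p powr (m + \<delta> + \<delta> * real J)"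
    by blast
  define D where "D = (\<Sum>i\<in>UNIV. C i)"
  have D: "D > 0" unfolding D_def using C(1) by (intro sum_pos) auto
  have "norm ((fdiff (in_x z) ^^ Suc J) R p) \<le> D * norm z ^ Suc J * wt p powr (m + \<delta> * real (Suc J))" for p z
  proof -
    let ?g = "(fdiff (in_x z) ^^ J) R"
    note s = symbol_class_smooth[OF Suc.prems]
    have g: "smooth ?g" "dir_deriv (in_x z) ?g = (fdiff (in_x z) ^^ J) (dir_deriv (in_x z) R)"
      using funpow_fdiff_smooth[OF s] by blast+
    have L: "linear (in_x :: real^'n \<Rightarrow> 'n phase)" by (rule bounded_linear.linear[OF bounded_linear_in(1)])
    have z: "in_x z = (\<Sum>i\<in>UNIV. z $ i *\<^sub>R in_x (axis i 1))"
      by (subst vec_expand_axis) (use L in \<open>simp only: linear_sum linear_cmul\<close>)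
    have dz: "dir_deriv (in_x z) R = (\<lambda>p. \<Sum>i\<in>UNIV. of_real (z $ i) * Ri i p)"
    proof
      fix p
      obtain R' where R': "(R has_derivative R') (at p)" using smooth_differentiable[OF s] unfolding differentiable_def by blast
      show "dir_deriv (in_x z) R p = (\<Sum>i\<in>UNIV. of_real (z $ i) * Ri i p)"
        unfolding Ri_def dir_deriv_eq[OF R'] z
        using has_derivative_linear[OF R'] by (simp add: linear_sum linear_cmul scaleR_conv_of_real)
    qed
    have bd: "norm (dir_deriv (in_x z) ?g p') \<le> D * norm z ^ Suc J * wt p' powr (m + \<delta> * real (Suc J))" for p'
    proof -
      have "norm (dir_deriv (in_x z) ?g p') \<le> (\<Sum>i\<in>UNIV. norm (of_real (z $ i) * (fdiff (in_x z) ^^ J) (Ri i) p'))"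
        unfolding g(2) dz funpow_fdiff_sum by (rule norm_sum)
      also have "\<dots> \<le> (\<Sum>i\<in>UNIV. norm z * (C i * norm z ^ J * wt p' powr (m + \<delta> + \<delta> * real J)))"
        unfolding norm_mult by (intro sum_mono mult_mono C(2)) (auto simp: component_le_norm_cart)
      also have "\<dots> = D * norm z ^ Suc J * wt p' powr (m + \<delta> * real (Suc J))"
        by (simp add: D_def sum_distrib_left sum_distrib_right algebra_simps)
      finally show ?thesis .
    qed
    have "norm (?g (p + in_x z) - (\<Sum>k<1. (dir_deriv (in_x z) ^^ k) ?g p / fact k)) \<le> D * norm z ^ Suc J * wt p powr (m + \<delta> * real (Suc J))"
    proof (rule taylor_along_line[OF g(1)])
      fix t :: real
      have "wt (p + t *\<^sub>R in_x z) = wt p" by (simp add: wt_def in_x_def)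
      then show "norm ((dir_deriv (in_x z) ^^ 1) ?g (p + t *\<^sub>R in_x z)) \<le> D * norm z ^ Suc J * wt p powr (m + \<delta> * real (Suc J))"
        using bd[of "p + t *\<^sub>R in_x z"] by simp
    qed
    then show ?thesis by (simp add: fdiff_def[of "in_x z" ?g])
  qed
  then show ?case using D by blast
qed

lemma gauss_average_integrable:
  fixes R :: "'n::finite phase \<Rightarrow> complex"
  assumes R: "R \<in> symbol_class \<rho> \<delta> m"
  shows "integrable lborel (\<lambda>z. R (y + a *\<^sub>R z, c, e) * gauss z)"
proof -
  obtain C where C: "C > 0" "\<And>p. norm (R p) \<le> C * wt p powr m" using symbol_class_bound[OF R] by blast
  have "norm (R (y + a *\<^sub>R z, c, e)) \<le> (C * wt (y, c, e) powr m) * (1 + norm z) ^ 0" for z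
    using C(2)[of "(y + a *\<^sub>R z, c, e)"] by (simp add: wt_eq)
  from gauss_dom_mult_le[OF this norm_gauss_le] show ?thesis
    by (intro integrable_gauss_dominated[of "1/2"] borel_measurable_continuous_onI continuous_intros
      smooth_continuous in_x_affine_derivs_bounded(1)[OF R] smooth_gauss) auto
qed

text \<open>The difference step is made proportional to the integration variable: integrating the
  J-th difference with step h z against the Gaussian in \<open>z\<close> turns its j-th node into an
  average with parameter X^\<kappa> / j, while node 0 is not averaged at all and returns the value
  itself.\<close>

lemma symbol_bound_of_gauss_averages:
  fixes R :: "'n::finite phase \<Rightarrow> complex"
  assumes R: "R \<in> symbol_class \<rho> \<delta> m"
  shows "\<exists>C>0. \<forall>y \<xi> \<eta> B. (\<forall>l. 0 < l \<longrightarrow> l \<le> wt (y, \<xi>, \<eta>) powr \<kappa> \<longrightarrow> norm (gauss_average R y \<xi> \<eta> l) \<le> B) \<longrightarrow>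
    norm (R (y, \<xi>, \<eta>)) \<le> C * (B + wt (y, \<xi>, \<eta>) powr (m - (\<kappa> - \<delta>) * real J))"
proof -
  obtain a :: "nat \<Rightarrow> complex" where a: "a 0 \<noteq> 0"
    "\<And>(f :: 'n phase \<Rightarrow> complex) p v. (fdiff v ^^ J) f p = (\<Sum>j\<le>J. a j * f (p + real j *\<^sub>R v))"
    using funpow_fdiff_expand[of J] by blast
  obtain C where C: "C > 0" "\<And>p z. norm ((fdiff (in_x z) ^^ J) R p) \<le> C * norm z ^ J * wt p powr (m + \<delta> * real J)"
    using funpow_fdiff_bound[OF R, of J] by blast
  let ?m = "gauss_mass TYPE(real^'n)"
  have m0: "norm ?m > 0" using gauss_mass_nonzero[where 'a="real^'n"] by simp
  define I where "I = (LINT z|lborel. gauss_dom J (1 / 2) (z::real^'n))"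
  have I: "I \<ge> 0" unfolding I_def by (intro integral_nonneg_AE) (auto simp: gauss_dom_nonneg)
  define S where "S = (\<Sum>j=1..J. norm (a j))"
  have S: "S \<ge> 0" unfolding S_def by (intro sum_nonneg) auto
  define K where "K = norm (a 0) * norm ?m"
  have K: "K > 0" using a(1) m0 by (simp add: K_def)
  define D where "D = (C * I + S + 1) / K"
  have D: "D > 0" unfolding D_def using C(1) I S K by (intro divide_pos_pos add_nonneg_pos add_nonneg_nonneg mult_nonneg_nonneg) auto
  have "norm (R (y, \<xi>, \<eta>)) \<le> D * (B + wt (y, \<xi>, \<eta>) powr (m - (\<kappa> - \<delta>) * real J))"
    if B: "\<And>l. 0 < l \<Longrightarrow> l \<le> wt (y, \<xi>, \<eta>) powr \<kappa> \<Longrightarrow> norm (gauss_average R y \<xi> \<eta> l) \<le> B" for y \<xi> \<eta> B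
  proof -
    define X where "X = wt (y, \<xi>, \<eta>)"
    have X: "X \<ge> 1" unfolding X_def by (rule wt_ge_1)
    \<comment> \<open>Each of the J differences contributes \<open>h\<close> times an x-derivative
      of relative size X^\<delta>, a gain of X^(\<delta> - \<kappa>).\<close>
    define h where "h = X powr (- \<kappa>)"
    have h: "h > 0" using X by (simp add: h_def)
    define f where "f = (\<lambda>j z. R (y + (real j * h) *\<^sub>R z, \<xi>, \<eta>) * gauss z)"
    have fi: "integrable lborel (f j)" for j unfolding f_def by (rule gauss_average_integrable[OF R])
    have B0: "B \<ge> 0" using B[of "X powr \<kappa>"] X by (auto simp: X_def[symmetric] intro: order_trans[OF norm_ge_zero])
    have fj: "norm (LINT z|lborel. f j z) \<le> B" if "1 \<le> j" for j
    proof -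
      have "real j * h = 1 / (X powr \<kappa> / real j)" by (simp add: h_def powr_minus divide_inverse)
      then have "(LINT z|lborel. f j z) = gauss_average R y \<xi> \<eta> (X powr \<kappa> / real j)"
        unfolding f_def gauss_average_def by simp
      moreover have "X powr \<kappa> / real j \<le> X powr \<kappa> / 1" using that X by (intro divide_left_mono) auto
      ultimately show ?thesis using B[of "X powr \<kappa> / real j"] that X by (simp add: X_def)
    qed
    have f0: "(LINT z|lborel. f 0 z) = R (y, \<xi>, \<eta>) * ?m" by (simp add: f_def integral_gauss)
    have rep: "(\<Sum>j\<le>J. a j * f j z) = (fdiff (in_x (h *\<^sub>R z)) ^^ J) R (y, \<xi>, \<eta>) * gauss z" for z
      unfolding a(2) by (simp add: f_def in_x_def sum_distrib_right sum_distrib_left mult_ac)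
    have "norm (LINT z|lborel. (\<Sum>j\<le>J. a j * f j z)) \<le> (C * (h ^ J * X powr (m + \<delta> * real J)) * 1) * (LINT z|lborel. gauss_dom (J + 0) (1 / 2) (z::real^'n))"
    proof (rule norm_integral_gauss_dominated)
      fix z :: "real^'n"
      have "norm ((fdiff (in_x (h *\<^sub>R z)) ^^ J) R (y, \<xi>, \<eta>)) \<le> C * norm (h *\<^sub>R z) ^ J * X powr (m + \<delta> * real J)"
        unfolding X_def by (rule C(2))
      also have "\<dots> = (C * (h ^ J * X powr (m + \<delta> * real J))) * norm z ^ J"
        using h by (simp add: power_mult_distrib mult_ac)
      also have "\<dots> \<le> (C * (h ^ J * X powr (m + \<delta> * real J))) * (1 + norm z) ^ J"
        using C(1) h by (intro mult_left_mono power_mono) auto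
      finally show "norm (\<Sum>j\<le>J. a j * f j z) \<le> (C * (h ^ J * X powr (m + \<delta> * real J)) * 1) * gauss_dom (J + 0) (1 / 2) z"
        unfolding rep by (rule gauss_dom_mult_le[OF _ norm_gauss_le])
    qed simp
    moreover have "h ^ J * X powr (m + \<delta> * real J) = X powr (m - (\<kappa> - \<delta>) * real J)"
    proof -
      have "h ^ J = X powr (- \<kappa> * real J)" using X by (simp add: h_def powr_powr flip: powr_realpow)
      then show ?thesis by (simp add: algebra_simps flip: powr_add)
    qed
    ultimately have 1: "norm (LINT z|lborel. (\<Sum>j\<le>J. a j * f j z)) \<le> C * I * X powr (m - (\<kappa> - \<delta>) * real J)"
      by (simp add: I_def mult_ac)
    have "(LINT z|lborel. (\<Sum>j\<le>J. a j * f j z)) = (\<Sum>j\<le>J. a j * (LINT z|lborel. f j z))"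
      using fi by (simp add: Bochner_Integration.integral_sum)
    also have "\<dots> = a 0 * (LINT z|lborel. f 0 z) + (\<Sum>j=1..J. a j * (LINT z|lborel. f j z))"
    proof -
      have "{..J} = insert 0 {1..J}" by auto
      then show ?thesis by simp
    qed
    finally have a0: "a 0 * (R (y, \<xi>, \<eta>) * ?m) = (LINT z|lborel. (\<Sum>j\<le>J. a j * f j z)) - (\<Sum>j=1..J. a j * (LINT z|lborel. f j z))"
      by (simp add: f0)
    have "K * norm (R (y, \<xi>, \<eta>)) = norm ((LINT z|lborel. (\<Sum>j\<le>J. a j * f j z)) - (\<Sum>j=1..J. a j * (LINT z|lborel. f j z)))"
      unfolding a0[symmetric] by (simp add: K_def norm_mult mult_ac)
    also have "\<dots> \<le> norm (LINT z|lborel. (\<Sum>j\<le>J. a j * f j z)) + norm (\<Sum>j=1..J. a j * (LINT z|lborel. f j z))"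
      by (rule norm_triangle_ineq4)
    also have "norm (\<Sum>j=1..J. a j * (LINT z|lborel. f j z)) \<le> (\<Sum>j=1..J. norm (a j) * B)"
      by (intro sum_norm_le) (auto simp: norm_mult intro!: mult_left_mono fj)
    also have "\<dots> = S * B" by (simp add: S_def sum_distrib_right)
    finally have "K * norm (R (y, \<xi>, \<eta>)) \<le> C * I * X powr (m - (\<kappa> - \<delta>) * real J) + S * B" using 1 by linarith
    also have "\<dots> \<le> (C * I + S + 1) * X powr (m - (\<kappa> - \<delta>) * real J) + (C * I + S + 1) * B"
      using C(1) I S B0 by (intro add_mono mult_right_mono) (auto intro: add_increasing)
    also have "\<dots> = K * (D * (B + X powr (m - (\<kappa> - \<delta>) * real J)))"
    proof -
      have KD: "C * I + S + 1 = K * D" using K by (simp add: D_def)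
      show ?thesis unfolding KD by (simp only: distrib_left mult.assoc add.commute)
    qed
    finally show ?thesis using K unfolding X_def by simp
  qed
  then show ?thesis using D by blast
qed

section \<open>The transpose expansions\<close>

definition flip1 :: "'n::finite phase \<Rightarrow> 'n phase"
  where "flip1 p = (fst p, - fst (snd p) - snd (snd p), snd (snd p))"

text \<open>\<open>flip1\<close> is an involution, so the second bound is the first one at the
  flipped point.\<close>

lemma wt_flip1: "wt (flip1 p) \<le> 2 * wt p" "wt p \<le> 2 * wt (flip1 p)"
proof -
  have *: "norm (- a - b) + norm b \<le> 2 * (norm a + norm b)" for a b :: "real^'a"
  proof -
    have "norm (- a - b) + norm b \<le> (norm a + norm b) + norm b"
      using norm_triangle_ineq4[of "- a" b] by simp
    also have "\<dots> \<le> 2 * (norm a + norm b)" by simp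
    finally show ?thesis .
  qed
  show "wt (flip1 p) \<le> 2 * wt p" using *[of "fst (snd p)" "snd (snd p)"] by (simp add: wt_def flip1_def)
  show "wt p \<le> 2 * wt (flip1 p)"
    using *[of "- fst (snd p) - snd (snd p)" "snd (snd p)"] by (simp add: wt_def flip1_def)
qed

lemma symbol_class_flip1:
  assumes "F \<in> symbol_class \<rho> \<delta> m"
  shows "(\<lambda>p. F (flip1 p)) \<in> symbol_class \<rho> \<delta> m"
proof (rule symbol_class_compose_linear[OF assms, where K=2])
  show "bounded_linear flip1"
    unfolding flip1_def by (intro bounded_linear_Pair bounded_linear_sub bounded_linear_minus
      bounded_linear_fst bounded_linear_compose[OF bounded_linear_fst] bounded_linear_compose[OF bounded_linear_snd] bounded_linear_snd)
  show "pure (flip1 b) \<and> (fst (flip1 b) = 0) = (fst b = 0)" if "b \<in> Basis" for b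
    using that by (auto simp: pure_def flip1_def Basis_prod_def zero_prod_def)
qed (auto intro: wt_flip1)

text \<open>The terms of order k indexed by words, with 1/k! in place of 1/\<alpha>!;
  \<open>expansion_term_eq\<close> regroups them. Derivatives are taken first and the point is
  flipped afterwards.\<close>

definition expansion_term :: "('n::finite phase \<Rightarrow> complex) \<Rightarrow> nat \<Rightarrow> 'n phase \<Rightarrow> complex"
  where "expansion_term F k = (\<lambda>p. \<Sum>w | length w = k. \<i> ^ k / fact k * foldr dir_deriv (x_word w @ xi_word w) F (flip1 p))"

lemma expansion_term_symbol_class:
  assumes F: "F \<in> symbol_class \<rho> \<delta> m"
  shows "expansion_term F k \<in> symbol_class \<rho> \<delta> (m - (\<rho> - \<delta>) * real k)"
  unfolding expansion_term_def
proof (intro symbol_class_sum symbol_class_cmult symbol_class_flip1)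
  fix w :: "'a list" assume "w \<in> {w. length w = k}"
  then show "foldr dir_deriv (x_word w @ xi_word w) F \<in> symbol_class \<rho> \<delta> (m - (\<rho> - \<delta>) * real k)"
    using symbol_class_x_xi_word[OF F, of w] by simp
qed

lemma gauss_average_remainder:
  fixes F :: "'n::finite phase \<Rightarrow> complex"
  assumes F: "F \<in> symbol_class \<rho> \<delta> m" and F': "F' \<in> symbol_class \<rho> \<delta> m"
  shows "gauss_average (\<lambda>p. F' p - (\<Sum>k<M. expansion_term F k p)) y \<xi> \<eta> l =
    gauss_average F' y \<xi> \<eta> l - (\<Sum>k<M. \<Sum>w | length w = k. \<i> ^ k / fact k *
      gauss_average (foldr dir_deriv (x_word w @ xi_word w) F) y (- \<xi> - \<eta>) \<eta> l)"
proof -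
  note i = gauss_average_integrable[OF symbol_class_x_xi_word[OF F]]
  have "gauss_average (\<lambda>p. F' p - (\<Sum>k<M. expansion_term F k p)) y \<xi> \<eta> l =
    (LINT z|lborel. F' (y + (1 / l) *\<^sub>R z, \<xi>, \<eta>) * gauss z - (\<Sum>k<M. \<Sum>w | length w = k. \<i> ^ k / fact k *
      (foldr dir_deriv (x_word w @ xi_word w) F (y + (1 / l) *\<^sub>R z, - \<xi> - \<eta>, \<eta>) * gauss z)))"
    unfolding gauss_average_def expansion_term_def flip1_def
    by (intro Bochner_Integration.integral_cong refl) (simp add: left_diff_distrib sum_distrib_right mult.assoc)
  also have "\<dots> = (LINT z|lborel. F' (y + (1 / l) *\<^sub>R z, \<xi>, \<eta>) * gauss z) - (\<Sum>k<M. \<Sum>w | length w = k. \<i> ^ k / fact k *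
      (LINT z|lborel. foldr dir_deriv (x_word w @ xi_word w) F (y + (1 / l) *\<^sub>R z, - \<xi> - \<eta>, \<eta>) * gauss z))"
  proof -
    let ?g = "\<lambda>w z. foldr dir_deriv (x_word w @ xi_word w) F (y + (1 / l) *\<^sub>R z, - \<xi> - \<eta>, \<eta>) * gauss z"
    have "(LINT z|lborel. (\<Sum>k<M. \<Sum>w | length w = k. \<i> ^ k / fact k * ?g w z)) = (\<Sum>k<M. LINT z|lborel. (\<Sum>w | length w = k. \<i> ^ k / fact k * ?g w z))"
      by (rule Bochner_Integration.integral_sum) (intro Bochner_Integration.integrable_sum integrable_mult_right i)
    also have "\<dots> = (\<Sum>k<M. \<Sum>w | length w = k. LINT z|lborel. \<i> ^ k / fact k * ?g w z)"
      by (intro sum.cong refl Bochner_Integration.integral_sum integrable_mult_right i)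
    finally have "(LINT z|lborel. (\<Sum>k<M. \<Sum>w | length w = k. \<i> ^ k / fact k * ?g w z)) = (\<Sum>k<M. \<Sum>w | length w = k. \<i> ^ k / fact k * (LINT z|lborel. ?g w z))"
      by (simp only: integral_mult_right_zero)
    moreover have "(LINT z|lborel. F' (y + (1 / l) *\<^sub>R z, \<xi>, \<eta>) * gauss z - (\<Sum>k<M. \<Sum>w | length w = k. \<i> ^ k / fact k * ?g w z)) =
      (LINT z|lborel. F' (y + (1 / l) *\<^sub>R z, \<xi>, \<eta>) * gauss z) - (LINT z|lborel. (\<Sum>k<M. \<Sum>w | length w = k. \<i> ^ k / fact k * ?g w z))"
      by (intro Bochner_Integration.integral_diff gauss_average_integrable[OF F'] Bochner_Integration.integrable_sum integrable_mult_right i)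
    ultimately show ?thesis by (simp only:)
  qed
  finally show ?thesis unfolding gauss_average_def .
qed

text \<open>The two packet forms are equal; one is close to the average of the transposed symbol,
  the other to the averages of the expansion. Only the choice of \<open>q\<close> and M as functions
  of the target rate S remains.\<close>

lemma gauss_average_remainder_decay:
  fixes F F' :: "'n::finite phase \<Rightarrow> complex"
  assumes \<kappa>: "0 \<le> \<kappa>" "\<kappa> < \<rho>" "\<rho> \<le> 1"
    and F: "F \<in> symbol_class \<rho> \<delta> m" and F': "F' \<in> symbol_class \<rho> \<delta> m"
    and T: "\<And>y \<xi> \<eta> l q. l > 0 \<Longrightarrow> q > 0 \<Longrightarrow> packet_form F y (- \<xi> - \<eta>) \<eta> l l q = packet_form F' y \<xi> \<eta> (q * l) l 1"
  shows "\<exists>M0. \<forall>M\<ge>M0. \<exists>C. \<forall>y \<xi> \<eta> l. 0 < l \<longrightarrow> l \<le> wt (y, \<xi>, \<eta>) powr \<kappa> \<longrightarrow>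
    norm (gauss_average (\<lambda>p. F' p - (\<Sum>k<M. expansion_term F k p)) y \<xi> \<eta> l) \<le> C * wt (y, \<xi>, \<eta>) powr (- S)"
proof -
  let ?m = "gauss_mass TYPE(real^'n)" and ?n = "CARD('n)"
  have m0: "norm ?m > 0" using gauss_mass_nonzero[where 'a="real^'n"] by simp
  obtain C1 P where C1: "C1 > 0" "\<And>y \<xi> \<eta> l q. 0 < l \<Longrightarrow> l \<le> wt (y, \<xi>, \<eta>) \<Longrightarrow> 0 < q \<Longrightarrow> q \<le> 1 \<Longrightarrow>
    norm (packet_form F' y \<xi> \<eta> (q * l) l 1 - ?m * gauss_average F' y \<xi> \<eta> l) \<le> C1 * q * wt (y, \<xi>, \<eta>) ^ P"
    using packet_form_freeze[OF F'] by blast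
  \<comment> \<open>Large enough that q = X^(-Q) brings both the loss X^P of freezing and the factor
    X^m of the expansion down to X^(-S).\<close>
  define Q where "Q = \<bar>S\<bar> + \<bar>m\<bar> + real P"
  \<comment> \<open>Chosen after Q: the gain (\<rho> - \<kappa>) M must cover m, the target S and
    the loss n Q from q^(-n).\<close>
  define M0 where "M0 = nat \<lceil>\<bar>m + real ?n * Q + S\<bar> / (\<rho> - \<kappa>)\<rceil>"
  show ?thesis
  proof (intro exI[of _ M0] allI impI)
    fix M assume "M \<ge> M0"
    then have "\<bar>m + real ?n * Q + S\<bar> / (\<rho> - \<kappa>) \<le> real M" unfolding M0_def by linarith
    then have M: "m - (\<rho> - \<kappa>) * real M + real ?n * Q \<le> - S"
      using \<kappa> by (simp add: divide_le_eq mult.commute)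
    define b where "b = m - (\<rho> - \<kappa>) * real M"
    obtain C2 where C2: "C2 > 0" "\<And>y c e l q. 0 < l \<Longrightarrow> l \<le> 2 * wt (y, c, e) powr \<kappa> \<Longrightarrow> 0 < q \<Longrightarrow> q \<le> 1 \<Longrightarrow>
      norm (packet_form F y c e l l q - ?m * (\<Sum>k<M. \<Sum>w | length w = k. \<i> ^ k / fact k *
        gauss_average (foldr dir_deriv (x_word w @ xi_word w) F) y c e l))
      \<le> C2 * (q * wt (y, c, e) powr m + wt (y, c, e) powr b / q ^ ?n)"
      using packet_form_expand[OF F \<kappa>, of M] unfolding b_def by blast
    define C where "C = (C1 + C2 * (2 powr \<bar>m\<bar> + 2 powr \<bar>b\<bar>)) / norm ?m"
    have "norm (gauss_average (\<lambda>p. F' p - (\<Sum>k<M. expansion_term F k p)) y \<xi> \<eta> l) \<le> C * wt (y, \<xi>, \<eta>) powr (- S)"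
      if l: "0 < l" "l \<le> wt (y, \<xi>, \<eta>) powr \<kappa>" for y \<xi> \<eta> l
    proof -
      define X where "X = wt (y, \<xi>, \<eta>)"
      define Xc where "Xc = wt (y, - \<xi> - \<eta>, \<eta>)"
      have X: "X \<ge> 1" unfolding X_def by (rule wt_ge_1)
      have Xc: "Xc \<ge> 1" unfolding Xc_def by (rule wt_ge_1)
      have XX: "Xc \<le> 2 * X" "X \<le> 2 * Xc"
        using wt_flip1[of "(y, \<xi>, \<eta>)"] by (auto simp: X_def Xc_def flip1_def)
      have cmp: "Xc powr a \<le> 2 powr \<bar>a\<bar> * X powr a" for a
        using X Xc XX by (intro powr_comparable) auto
      define q where "q = X powr (- Q)"
      have Q: "Q \<ge> 0" by (simp add: Q_def)
      have q: "0 < q" "q \<le> 1" using X Q powr_mono[of "- Q" 0 X] by (auto simp: q_def)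
      have lX: "l \<le> X" using l(2) powr_mono[of \<kappa> 1 X] X \<kappa> by (simp add: X_def)
      \<comment> \<open>The expansion is centred at the frequency - \<xi> - \<eta>, where the weight
        agrees with X only up to a factor 2; the slack 2 in the admissible range of \<open>l\<close>
        is meant for this.\<close>
      have lXc: "l \<le> 2 * Xc powr \<kappa>"
      proof -
        have "X powr \<kappa> \<le> (2 * Xc) powr \<kappa>" using XX X \<kappa> by (intro powr_mono2) auto
        also have "\<dots> = 2 powr \<kappa> * Xc powr \<kappa>" using Xc by (simp add: powr_mult)
        also have "\<dots> \<le> 2 powr 1 * Xc powr \<kappa>" using \<kappa> by (intro mult_right_mono powr_mono) auto
        finally show ?thesis using l(2) by (simp add: X_def)
      qed
      define E where "E = (\<Sum>k<M. \<Sum>w | length w = k. \<i> ^ k / fact k * gauss_average (foldr dir_deriv (x_word w @ xi_word w) F) y (- \<xi> - \<eta>) \<eta> l)"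
      have 1: "norm (packet_form F' y \<xi> \<eta> (q * l) l 1 - ?m * gauss_average F' y \<xi> \<eta> l) \<le> C1 * X powr (- S)"
      proof -
        have "X ^ P = X powr real P" using X by (simp add: powr_realpow)
        then have "q * X ^ P = X powr (- Q + real P)" by (simp only: q_def powr_add)
        also have "\<dots> \<le> X powr (- S)" using X by (intro powr_mono) (auto simp: Q_def)
        finally have "C1 * (q * X ^ P) \<le> C1 * X powr (- S)" using C1(1) by (intro mult_left_mono) auto
        then show ?thesis using C1(2)[OF l(1) lX[unfolded X_def] q] by (simp add: X_def mult.assoc)
      qed
      have 2: "norm (packet_form F y (- \<xi> - \<eta>) \<eta> l l q - ?m * E) \<le> C2 * (2 powr \<bar>m\<bar> + 2 powr \<bar>b\<bar>) * X powr (- S)"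
      proof -
        have "q * Xc powr m \<le> q * (2 powr \<bar>m\<bar> * X powr m)" using cmp[of m] q by (intro mult_left_mono) auto
        also have "\<dots> = 2 powr \<bar>m\<bar> * X powr (- Q + m)" by (simp only: q_def powr_add mult_ac)
        also have "\<dots> \<le> 2 powr \<bar>m\<bar> * X powr (- S)" using X by (intro mult_left_mono powr_mono) (auto simp: Q_def)
        finally have 3: "q * Xc powr m \<le> 2 powr \<bar>m\<bar> * X powr (- S)" .
        have "q ^ ?n = X powr (- (real ?n * Q))" using X by (simp add: q_def powr_powr mult.commute flip: powr_realpow)
        then have "Xc powr b / q ^ ?n = Xc powr b * X powr (real ?n * Q)" by (simp add: powr_minus divide_inverse)
        also have "\<dots> \<le> (2 powr \<bar>b\<bar> * X powr b) * X powr (real ?n * Q)" using cmp[of b] by (intro mult_right_mono) auto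
        also have "\<dots> = 2 powr \<bar>b\<bar> * X powr (b + real ?n * Q)" by (simp add: powr_add)
        also have "\<dots> \<le> 2 powr \<bar>b\<bar> * X powr (- S)" using X M by (intro mult_left_mono powr_mono) (auto simp: b_def)
        finally have 4: "Xc powr b / q ^ ?n \<le> 2 powr \<bar>b\<bar> * X powr (- S)" .
        have "norm (packet_form F y (- \<xi> - \<eta>) \<eta> l l q - ?m * E) \<le> C2 * (q * Xc powr m + Xc powr b / q ^ ?n)"
          unfolding E_def Xc_def by (rule C2(2)[OF l(1) lXc[unfolded Xc_def] q])
        also have "\<dots> \<le> C2 * (2 powr \<bar>m\<bar> * X powr (- S) + 2 powr \<bar>b\<bar> * X powr (- S))"
          using 3 4 C2(1) by (intro mult_left_mono add_mono) auto
        finally show ?thesis by (simp add: algebra_simps)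
      qed
      have "norm ?m * norm (gauss_average F' y \<xi> \<eta> l - E) = norm (?m * gauss_average F' y \<xi> \<eta> l - ?m * E)"
        by (simp add: norm_mult flip: right_diff_distrib)
      also have "\<dots> = norm ((packet_form F y (- \<xi> - \<eta>) \<eta> l l q - ?m * E) - (packet_form F' y \<xi> \<eta> (q * l) l 1 - ?m * gauss_average F' y \<xi> \<eta> l))"
        unfolding T[OF l(1) q(1)] by (simp add: algebra_simps)
      also have "\<dots> \<le> C2 * (2 powr \<bar>m\<bar> + 2 powr \<bar>b\<bar>) * X powr (- S) + C1 * X powr (- S)"
        using norm_triangle_ineq4 1 2 by (meson add_mono order_trans)
      also have "\<dots> = norm ?m * (C * X powr (- S))"
        using m0 by (simp add: C_def field_simps)
      finally have "norm (gauss_average F' y \<xi> \<eta> l - E) \<le> C * X powr (- S)" using m0 by simp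
      then show ?thesis unfolding gauss_average_remainder[OF F F'] E_def X_def .
    qed
    then show "\<exists>C. \<forall>y \<xi> \<eta> l. 0 < l \<longrightarrow> l \<le> wt (y, \<xi>, \<eta>) powr \<kappa> \<longrightarrow>
      norm (gauss_average (\<lambda>p. F' p - (\<Sum>k<M. expansion_term F k p)) y \<xi> \<eta> l) \<le> C * wt (y, \<xi>, \<eta>) powr (- S)"
      by blast
  qed
qed

lemma expansion_in_symbol_class:
  fixes F F' :: "'n::finite phase \<Rightarrow> complex"
  assumes \<delta>: "0 \<le> \<delta>" "\<delta> < \<rho>" "\<rho> \<le> 1"
    and F: "F \<in> symbol_class \<rho> \<delta> m" and F': "F' \<in> symbol_class \<rho> \<delta> m"
    and T: "\<And>y \<xi> \<eta> l q. l > 0 \<Longrightarrow> q > 0 \<Longrightarrow> packet_form F y (- \<xi> - \<eta>) \<eta> l l q = packet_form F' y \<xi> \<eta> (q * l) l 1"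
  shows "(\<lambda>p. F' p - (\<Sum>k<N. expansion_term F k p)) \<in> symbol_class \<rho> \<delta> (m - (\<rho> - \<delta>) * real N)"
proof (rule symbol_class_of_rapidly_decaying[OF F' expansion_term_symbol_class[OF F]])
  show "0 \<le> \<rho> - \<delta>" using \<delta> by simp
  define \<kappa> where "\<kappa> = (\<rho> + \<delta>) / 2"
  have \<kappa>: "0 \<le> \<kappa>" "\<kappa> < \<rho>" "\<delta> < \<kappa>" using \<delta> by (auto simp: \<kappa>_def)
  show "rapidly_decaying (\<lambda>M p. F' p - (\<Sum>k<M. expansion_term F k p))"
    unfolding rapidly_decaying_def
  proof
    fix S :: real
    \<comment> \<open>Fixed before M: every remainder lies in the class of order m whatever M is, so
      one J makes the differences small enough for all of them.\<close>
    define J where "J = nat \<lceil>\<bar>m + S\<bar> / (\<kappa> - \<delta>)\<rceil>"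
    have "\<bar>m + S\<bar> / (\<kappa> - \<delta>) \<le> real J" unfolding J_def by linarith
    then have J: "m - (\<kappa> - \<delta>) * real J \<le> - S" using \<kappa> by (simp add: divide_le_eq mult.commute)
    obtain M0 where M0: "\<And>M. M \<ge> M0 \<Longrightarrow> \<exists>C. \<forall>y \<xi> \<eta> l. 0 < l \<longrightarrow> l \<le> wt (y, \<xi>, \<eta>) powr \<kappa> \<longrightarrow>
      norm (gauss_average (\<lambda>p. F' p - (\<Sum>k<M. expansion_term F k p)) y \<xi> \<eta> l) \<le> C * wt (y, \<xi>, \<eta>) powr (- S)"
      using gauss_average_remainder_decay[OF \<kappa>(1,2) \<delta>(3) F F' T, of S] by blast
    show "\<exists>M0. \<forall>M\<ge>M0. \<exists>C. \<forall>p. norm (F' p - (\<Sum>k<M. expansion_term F k p)) \<le> C * wt p powr (- S)"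
    proof (intro exI[of _ M0] allI impI)
      fix M assume "M \<ge> M0"
      then obtain C where C: "\<And>y \<xi> \<eta> l. 0 < l \<Longrightarrow> l \<le> wt (y, \<xi>, \<eta>) powr \<kappa> \<Longrightarrow>
        norm (gauss_average (\<lambda>p. F' p - (\<Sum>k<M. expansion_term F k p)) y \<xi> \<eta> l) \<le> C * wt (y, \<xi>, \<eta>) powr (- S)"
        using M0 by blast
      have "(\<lambda>p. F' p + (- 1) * (\<Sum>k<M. expansion_term F k p)) \<in> symbol_class \<rho> \<delta> m"
        using \<delta> by (intro symbol_class_add symbol_class_cmult symbol_class_sum F' symbol_class_mono[OF expansion_term_symbol_class[OF F]]) auto
      then have R: "(\<lambda>p. F' p - (\<Sum>k<M. expansion_term F k p)) \<in> symbol_class \<rho> \<delta> m" by simp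
      obtain D where D: "D > 0" "\<And>y \<xi> \<eta> B. (\<And>l. 0 < l \<Longrightarrow> l \<le> wt (y, \<xi>, \<eta>) powr \<kappa> \<Longrightarrow>
          norm (gauss_average (\<lambda>p. F' p - (\<Sum>k<M. expansion_term F k p)) y \<xi> \<eta> l) \<le> B) \<Longrightarrow>
        norm (F' (y, \<xi>, \<eta>) - (\<Sum>k<M. expansion_term F k (y, \<xi>, \<eta>))) \<le> D * (B + wt (y, \<xi>, \<eta>) powr (m - (\<kappa> - \<delta>) * real J))"
        using symbol_bound_of_gauss_averages[OF R, of \<kappa> J] by blast
      have "norm (F' p - (\<Sum>k<M. expansion_term F k p)) \<le> (D * (C + 1)) * wt p powr (- S)" for p
      proof -
        obtain y \<xi> \<eta> where p: "p = (y, \<xi>, \<eta>)" by (cases p)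
        have "norm (F' p - (\<Sum>k<M. expansion_term F k p)) \<le> D * (C * wt p powr (- S) + wt p powr (m - (\<kappa> - \<delta>) * real J))"
          unfolding p by (rule D(2)[OF C])
        also have "\<dots> \<le> D * (C * wt p powr (- S) + wt p powr (- S))"
          using D(1) J by (intro mult_left_mono add_left_mono powr_mono wt_ge_1) auto
        finally show ?thesis by (simp add: algebra_simps)
      qed
      then show "\<exists>C. \<forall>p. norm (F' p - (\<Sum>k<M. expansion_term F k p)) \<le> C * wt p powr (- S)" by blast
    qed
  qed
qed

section \<open>From words back to multi-indices\<close>

lemma mset_mi_word_count: "mset (mi_word (count (mset w))) = image_mset (\<lambda>i. axis i 1) (mset (w :: 'n::finite list))"
proof (induction w)
  case Nil
  show ?case by (simp add: mset_mi_word)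
next
  case (Cons i w)
  have c: "count (mset (i # w)) = (count (mset w))(i := Suc (count (mset w) i))" by auto
  show ?case unfolding c mset_mi_word_update Cons by simp
qed

text \<open>The words with given letter counts are the permutations of one multiset; their number is
  the multinomial coefficient k!/\<alpha>!, stated without division.\<close>

lemma card_words_of_count:
  fixes \<alpha> :: "'n::finite multi_index"
  shows "card {w. length w = mi_abs \<alpha> \<and> count (mset w) = \<alpha>} * mi_fact \<alpha> = fact (mi_abs \<alpha>)"
proof -
  define A where "A = (\<Sum>i\<in>UNIV. replicate_mset (\<alpha> i) i)"
  have cA: "count A = \<alpha>" by (auto simp: A_def count_sum)
  have sA: "size A = mi_abs \<alpha>" by (simp add: A_def size_multiset_sum mi_abs_def)
  have "{w. length w = mi_abs \<alpha> \<and> count (mset w) = \<alpha>} = permutations_of_multiset A"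
    unfolding permutations_of_multiset_def
  proof (intro Collect_cong iffI)
    fix w assume "length w = mi_abs \<alpha> \<and> count (mset w) = \<alpha>"
    then show "mset w = A" using cA by (metis multiset_eqI)
  next
    fix w assume "mset w = A"
    then show "length w = mi_abs \<alpha> \<and> count (mset w) = \<alpha>" using cA sA by (metis size_mset)
  qed
  moreover have "(\<Prod>x\<in>set_mset A. fact (count A x)) = mi_fact \<alpha>"
    unfolding mi_fact_def cA by (rule prod.mono_neutral_left) (auto simp: cA set_mset_def)
  ultimately show ?thesis using card_permutations_of_multiset_aux[of A] by (simp add: sA)
qed

text \<open>Words with the same letter counts give the same derivative, so a multi-index collects
  k!/\<alpha>! equal terms and the weight 1/k! becomes 1/\<alpha>!.\<close>

lemma expansion_term_eq:
  fixes \<sigma> :: "'n::finite bisymbol"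
  assumes s: "smooth (uncurry3 \<sigma>)"
  shows "expansion_term (uncurry3 \<sigma>) k (x, \<xi>, \<eta>) = (\<Sum>\<alpha> | mi_abs \<alpha> = k. transpose1_term \<sigma> \<alpha> x \<xi> \<eta>)"
proof -
  define g where "g w = foldr dir_deriv (x_word w @ xi_word w) (uncurry3 \<sigma>) (flip1 (x, \<xi>, \<eta>))" for w
  define W where "W = {w :: 'n list. length w = k}"
  have fW: "finite W" unfolding W_def by (rule finite_words)
  have weight: "\<i> ^ k / fact k * (of_nat (card {w \<in> W. count (mset w) = \<alpha>}) * d) = \<i> ^ mi_abs \<alpha> / of_nat (mi_fact \<alpha>) * d"
    if "mi_abs \<alpha> = k" for \<alpha> d
  proof -
    have "{w \<in> W. count (mset w) = \<alpha>} = {w. length w = mi_abs \<alpha> \<and> count (mset w) = \<alpha>}" using that by (auto simp: W_def)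
    then have "card {w \<in> W. count (mset w) = \<alpha>} * mi_fact \<alpha> = fact k" using card_words_of_count[of \<alpha>] that by simp
    then have "of_nat (card {w \<in> W. count (mset w) = \<alpha>}) * of_nat (mi_fact \<alpha>) = (fact k :: complex)"
      by (metis of_nat_fact of_nat_mult)
    moreover have "mi_fact \<alpha> \<noteq> 0" by (simp add: mi_fact_def)
    ultimately show ?thesis using that by (simp add: field_simps)
  qed
  have g: "g w = deriv_x \<alpha> (deriv_xi \<alpha> \<sigma>) x (- \<xi> - \<eta>) \<eta>" if "count (mset w) = \<alpha>" for w \<alpha>
  proof -
    have "mset (x_word w @ xi_word w) = mset (map in_x (mi_word \<alpha>) @ map in_xi (mi_word \<alpha>))"
      unfolding that[symmetric] by (simp add: mset_mi_word_count x_word_def xi_word_def image_mset.compositionality comp_def)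
    from foldr_dir_deriv_mset_cong[OF s this]
    have "foldr dir_deriv (x_word w @ xi_word w) (uncurry3 \<sigma>) = foldr dir_deriv (map in_x (mi_word \<alpha>)) (foldr dir_deriv (map in_xi (mi_word \<alpha>)) (uncurry3 \<sigma>))"
      by simp
    also have "\<dots> = uncurry3 (deriv_x \<alpha> (deriv_xi \<alpha> \<sigma>))"
      using uncurry3_deriv(1)[of "deriv_xi \<alpha> \<sigma>" \<alpha>] uncurry3_deriv(2)[OF s, of \<alpha>] smooth_foldr_dir_deriv[OF s] by simp
    finally show ?thesis by (simp add: g_def uncurry3_def flip1_def)
  qed
  have img: "(\<lambda>w. count (mset w)) ` W \<subseteq> {\<alpha>. mi_abs \<alpha> = k}"
  proof
    fix \<alpha> assume "\<alpha> \<in> (\<lambda>w. count (mset w)) ` W"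
    then obtain w where w: "length w = k" "\<alpha> = count (mset w)" by (auto simp: W_def)
    have "mi_abs \<alpha> = length (mi_word \<alpha> :: (real^'n) list)" by (simp add: length_mi_word)
    also have "\<dots> = size (mset (mi_word \<alpha> :: (real^'n) list))" by simp
    also have "\<dots> = k" unfolding w(2) mset_mi_word_count by (simp add: w(1))
    finally show "\<alpha> \<in> {\<alpha>. mi_abs \<alpha> = k}" by simp
  qed
  have "expansion_term (uncurry3 \<sigma>) k (x, \<xi>, \<eta>) = \<i> ^ k / fact k * (\<Sum>w\<in>W. g w)"
    by (simp add: expansion_term_def g_def W_def sum_distrib_left)
  also have "(\<Sum>w\<in>W. g w) = (\<Sum>\<alpha> | mi_abs \<alpha> = k. \<Sum>w\<in>{w \<in> W. count (mset w) = \<alpha>}. g w)"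
    by (rule sum.group[OF fW finite_mi_abs_eq img, symmetric])
  also have "\<dots> = (\<Sum>\<alpha> | mi_abs \<alpha> = k. of_nat (card {w \<in> W. count (mset w) = \<alpha>}) * deriv_x \<alpha> (deriv_xi \<alpha> \<sigma>) x (- \<xi> - \<eta>) \<eta>)"
    by (intro sum.cong refl) (simp add: g)
  also have "\<i> ^ k / fact k * \<dots> = (\<Sum>\<alpha> | mi_abs \<alpha> = k. transpose1_term \<sigma> \<alpha> x \<xi> \<eta>)"
    unfolding sum_distrib_left transpose1_term_def by (intro sum.cong refl weight) simp
  finally show ?thesis .
qed

lemma sum_mi_abs_less: "(\<Sum>\<alpha> | mi_abs (\<alpha> :: 'n::finite multi_index) < N. f \<alpha>) = (\<Sum>k<N. \<Sum>\<alpha> | mi_abs \<alpha> = k. f \<alpha>)"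
proof -
  have "(\<Sum>k<N. \<Sum>\<alpha> | \<alpha> \<in> {\<alpha>. mi_abs \<alpha> < N} \<and> mi_abs \<alpha> = k. f \<alpha>) = (\<Sum>\<alpha> | mi_abs \<alpha> < N. f \<alpha>)"
    using sum.group[OF finite_mi_abs_less finite_lessThan, of mi_abs N N f] by auto
  moreover have "{\<alpha>. \<alpha> \<in> {\<alpha>. mi_abs \<alpha> < N} \<and> mi_abs \<alpha> = k} = {\<alpha> :: 'n multi_index. mi_abs \<alpha> = k}" if "k < N" for k
    using that by auto
  ultimately show ?thesis by simp
qed

text \<open>The transposition identity enters for packets with a common centre only. In this form it
  can also be obtained from the second transpose, after exchange of the frequencies.\<close>

lemma transpose1_remainder:
  fixes \<sigma> \<sigma>' :: "'n::finite bisymbol"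
  assumes \<delta>: "0 \<le> \<delta>" "\<delta> < \<rho>" "\<rho> \<le> 1"
    and \<sigma>: "\<sigma> \<in> BS m \<rho> \<delta>" and \<sigma>': "\<sigma>' \<in> BS m \<rho> \<delta>"
    and T: "\<And>y a \<theta> b \<eta> d \<zeta>. a > 0 \<Longrightarrow> b > 0 \<Longrightarrow> d > 0 \<Longrightarrow>
      pairing (bilinear_op \<sigma> (packet a y \<theta>) (packet b y \<eta>)) (packet d y \<zeta>) =
      pairing (bilinear_op \<sigma>' (packet d y \<zeta>) (packet b y \<eta>)) (packet a y \<theta>)"
  shows "(\<lambda>x \<xi> \<eta>. \<sigma>' x \<xi> \<eta> - (\<Sum>\<alpha> | mi_abs \<alpha> < N. transpose1_term \<sigma> \<alpha> x \<xi> \<eta>)) \<in> BS (m + (\<delta> - \<rho>) * real N) \<rho> \<delta>"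
proof -
  note F = \<sigma>[unfolded BS_iff_symbol_class] and F' = \<sigma>'[unfolded BS_iff_symbol_class]
  have "(\<lambda>p. uncurry3 \<sigma>' p - (\<Sum>k<N. expansion_term (uncurry3 \<sigma>) k p)) \<in> symbol_class \<rho> \<delta> (m - (\<rho> - \<delta>) * real N)"
    by (rule expansion_in_symbol_class[OF \<delta> F F' packet_form_transpose[OF F F' T]])
  moreover have "(\<lambda>p. uncurry3 \<sigma>' p - (\<Sum>k<N. expansion_term (uncurry3 \<sigma>) k p)) =
    uncurry3 (\<lambda>x \<xi> \<eta>. \<sigma>' x \<xi> \<eta> - (\<Sum>\<alpha> | mi_abs \<alpha> < N. transpose1_term \<sigma> \<alpha> x \<xi> \<eta>))"
    by (auto simp: uncurry3_def[of "\<lambda>x \<xi> \<eta>. _ x \<xi> \<eta> - _ x \<xi> \<eta>"] uncurry3_def[of \<sigma>'] expansion_term_eq[OF symbol_class_smooth[OF F]] sum_mi_abs_less)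
  moreover have "m - (\<rho> - \<delta>) * real N = m + (\<delta> - \<rho>) * real N" by (simp add: algebra_simps)
  ultimately show ?thesis unfolding BS_iff_symbol_class by simp
qed

section \<open>Exchange of the two frequencies\<close>

lemma BS_swap:
  fixes \<sigma> :: "'n::finite bisymbol"
  assumes "\<sigma> \<in> BS m \<rho> \<delta>"
  shows "(\<lambda>x \<xi> \<eta>. \<sigma> x \<eta> \<xi>) \<in> BS m \<rho> \<delta>"
proof -
  define L :: "'n phase \<Rightarrow> 'n phase" where "L p = (fst p, snd (snd p), fst (snd p))" for p
  have "(\<lambda>p. uncurry3 \<sigma> (L p)) \<in> symbol_class \<rho> \<delta> m"
  proof (rule symbol_class_compose_linear[OF assms[unfolded BS_iff_symbol_class], where K=1])
    show "bounded_linear L"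
      unfolding L_def by (intro bounded_linear_Pair bounded_linear_fst bounded_linear_compose[OF bounded_linear_fst]
        bounded_linear_compose[OF bounded_linear_snd] bounded_linear_snd)
    show "pure (L b) \<and> (fst (L b) = 0) = (fst b = 0)" if "b \<in> Basis" for b
      using that by (auto simp: pure_def L_def Basis_prod_def zero_prod_def)
  qed (auto simp: L_def wt_def)
  moreover have "(\<lambda>p. uncurry3 \<sigma> (L p)) = uncurry3 (\<lambda>x \<xi> \<eta>. \<sigma> x \<eta> \<xi>)"
    by (auto simp: L_def uncurry3_def)
  ultimately show ?thesis unfolding BS_iff_symbol_class by simp
qed

text \<open>In \<open>bilinear_op\<close> the order of integration is fixed, so exchanging the two
  arguments calls for Fubini's theorem; the Gaussian transforms of packets supply the absolute
  integrability.\<close>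

lemma bilinear_op_packets_swap:
  fixes \<sigma> :: "'n::finite bisymbol"
  assumes \<sigma>: "\<sigma> \<in> BS m \<rho> \<delta>" and r: "r > 0" and \<nu>: "\<nu> > 0"
  shows "bilinear_op (\<lambda>x \<xi> \<eta>. \<sigma> x \<eta> \<xi>) (packet \<nu> y e) (packet r y c) = bilinear_op \<sigma> (packet r y c) (packet \<nu> y e)"
proof
  fix x
  note F = \<sigma>[unfolded BS_iff_symbol_class]
  define f where "f = (\<lambda>(t, s). \<sigma> x (c + r *\<^sub>R s) (e + \<nu> *\<^sub>R t) * gauss s * gauss t * exp (\<i> * of_real ((x - y) \<bullet> (c + r *\<^sub>R s + e + \<nu> *\<^sub>R t))))"
  obtain C k where C: "C > 0" "\<And>p. norm (uncurry3 \<sigma> p) \<le> C * wt p ^ k" using wt_power_bound[OF F] by blast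
  define K where "K = 1 + norm c + r + norm e + \<nu>"
  have "integrable lborel f"
  proof (rule integrable_gauss_dominated[of "1/2"])
    note cF = continuous_on_compose2[OF smooth_continuous[OF symbol_class_smooth[OF F]] _ subset_UNIV]
    note cg = continuous_on_compose2[OF smooth_continuous[OF smooth_gauss] _ subset_UNIV]
    have f: "f = (\<lambda>p. uncurry3 \<sigma> (x, c + r *\<^sub>R snd p, e + \<nu> *\<^sub>R fst p) * gauss (snd p) * gauss (fst p) * exp (\<i> * of_real ((x - y) \<bullet> (c + r *\<^sub>R snd p + e + \<nu> *\<^sub>R fst p))))"
      by (auto simp: f_def uncurry3_def)
    show "f \<in> borel_measurable borel"
      unfolding f
      by (intro borel_measurable_continuous_onI continuous_on_mult cF cg continuous_on_exp continuous_on_of_real continuous_intros)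
    fix p :: "(real^'n) \<times> (real^'n)"
    obtain t s where p: "p = (t, s)" by (cases p)
    have np: "norm s \<le> norm p" "norm t \<le> norm p" unfolding p by (rule norm_snd_le, rule norm_fst_le)
    have "wt (x, c + r *\<^sub>R s, e + \<nu> *\<^sub>R t) \<le> 1 + (norm c + r * norm s) + (norm e + \<nu> * norm t)"
      using norm_triangle_ineq[of c "r *\<^sub>R s"] norm_triangle_ineq[of e "\<nu> *\<^sub>R t"] r \<nu> by (simp add: wt_eq)
    also have "\<dots> \<le> 1 + (norm c + r * norm p) + (norm e + \<nu> * norm p)"
      using r \<nu> np by (intro add_mono mult_left_mono order_refl) auto
    also have "\<dots> \<le> K * (1 + norm p)" using r \<nu> by (simp add: K_def algebra_simps)
    finally have "wt (x, c + r *\<^sub>R s, e + \<nu> *\<^sub>R t) ^ k \<le> (K * (1 + norm p)) ^ k" by (intro power_mono wt_nonneg)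
    then have 1: "norm (uncurry3 \<sigma> (x, c + r *\<^sub>R s, e + \<nu> *\<^sub>R t)) \<le> (C * K ^ k) * (1 + norm p) ^ k"
      using C(1) by (intro order_trans[OF C(2)]) (simp add: power_mult_distrib mult.assoc)
    have "norm (gauss s * gauss t) \<le> 1 * gauss_dom 0 (1 / 2) p"
      by (simp add: p gauss_def gauss_dom_def norm_mult norm_Pair flip: exp_add) (simp add: field_simps)
    from gauss_dom_mult_le[OF 1 this]
    show "norm (f p) \<le> (C * K ^ k * 1) * gauss_dom (k + 0) (1 / 2) p"
      by (simp add: f p norm_mult mult.assoc)
  qed simp
  then have "(LINT s|lborel. LINT t|lborel. f (t, s)) = (LINT t|lborel. LINT s|lborel. f (t, s))"
    using lborel_pair.Fubini_integral[of "\<lambda>t s. f (t, s)"] by (simp add: lborel_prod)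
  then show "bilinear_op (\<lambda>x \<xi> \<eta>. \<sigma> x \<eta> \<xi>) (packet \<nu> y e) (packet r y c) x = bilinear_op \<sigma> (packet r y c) (packet \<nu> y e) x"
    unfolding bilinear_op_packets[OF r \<nu>] bilinear_op_packets[OF \<nu> r] by (simp add: f_def mult_ac add_ac)
qed

lemma asymptotic_expansionI:
  assumes "\<delta> < \<rho>"
    and "\<And>N. (\<lambda>x \<xi> \<eta>. \<sigma> x \<xi> \<eta> - (\<Sum>j<N. s j x \<xi> \<eta>)) \<in> BS (m + (\<delta> - \<rho>) * real N) \<rho> \<delta>"
  shows "asymptotic_expansion \<rho> \<delta> \<sigma> s"
  unfolding asymptotic_expansion_def
proof (intro exI[of _ "\<lambda>N. m + (\<delta> - \<rho>) * real N"] conjI allI impI assms)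
  show "decseq (\<lambda>N. m + (\<delta> - \<rho>) * real N)"
    using assms(1) by (intro decseq_SucI) (simp add: algebra_simps)
  show "filterlim (\<lambda>N. m + (\<delta> - \<rho>) * real N) at_bot sequentially"
    unfolding filterlim_at_bot eventually_sequentially
  proof (intro allI exI impI)
    fix Z :: real and n :: nat assume "nat \<lceil>(m - Z) / (\<rho> - \<delta>)\<rceil> \<le> n"
    then have "(m - Z) / (\<rho> - \<delta>) \<le> real n" by linarith
    then have "m - Z \<le> real n * (\<rho> - \<delta>)" using assms(1) by (simp add: pos_divide_le_eq)
    then show "m + (\<delta> - \<rho>) * real n \<le> Z" by (simp add: algebra_simps)
  qed
qed

theorem theorem2:
  fixes m \<rho> \<delta> :: real
    and \<sigma> \<sigma>1 \<sigma>2 :: "real^'n::finite \<Rightarrow> real^'n \<Rightarrow> real^'n \<Rightarrow> complex"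
  assumes "0 \<le> \<delta>" and "\<delta> < \<rho>" and "\<rho> \<le> 1"
    and "\<sigma> \<in> BS m \<rho> \<delta>"
    and "\<sigma>1 \<in> BS m \<rho> \<delta>" and "is_transpose1 (bilinear_op \<sigma>) (bilinear_op \<sigma>1)"
    and "\<sigma>2 \<in> BS m \<rho> \<delta>" and "is_transpose2 (bilinear_op \<sigma>) (bilinear_op \<sigma>2)"
  shows
    "asymptotic_expansion \<rho> \<delta> \<sigma>1
       (\<lambda>j x \<xi> \<eta>. \<Sum>\<alpha> | mi_abs \<alpha> = j. transpose1_term \<sigma> \<alpha> x \<xi> \<eta>) \<and>
     asymptotic_expansion \<rho> \<delta> \<sigma>2
       (\<lambda>j x \<xi> \<eta>. \<Sum>\<alpha> | mi_abs \<alpha> = j. transpose2_term \<sigma> \<alpha> x \<xi> \<eta>) \<and>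
     (\<forall>N::nat.
       (\<lambda>x \<xi> \<eta>. \<sigma>1 x \<xi> \<eta> - (\<Sum>\<alpha> | mi_abs \<alpha> < N. transpose1_term \<sigma> \<alpha> x \<xi> \<eta>))
         \<in> BS (m + (\<delta> - \<rho>) * real N) \<rho> \<delta> \<and>
       (\<lambda>x \<xi> \<eta>. \<sigma>2 x \<xi> \<eta> - (\<Sum>\<alpha> | mi_abs \<alpha> < N. transpose2_term \<sigma> \<alpha> x \<xi> \<eta>))
         \<in> BS (m + (\<delta> - \<rho>) * real N) \<rho> \<delta>)"
proof -
  have 1: "(\<lambda>x \<xi> \<eta>. \<sigma>1 x \<xi> \<eta> - (\<Sum>\<alpha> | mi_abs \<alpha> < N. transpose1_term \<sigma> \<alpha> x \<xi> \<eta>)) \<in> BS (m + (\<delta> - \<rho>) * real N) \<rho> \<delta>" for N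
  proof (rule transpose1_remainder[OF assms(1-5)])
    fix y \<theta> \<eta> \<zeta> :: "real^'n" and a b d :: real
    assume "a > 0" "b > 0" "d > 0"
    then have "packet a y \<theta> \<in> schwartz" "packet b y \<eta> \<in> schwartz" "packet d y \<zeta> \<in> schwartz"
      by (auto intro: packet_schwartz)
    then show "pairing (bilinear_op \<sigma> (packet a y \<theta>) (packet b y \<eta>)) (packet d y \<zeta>) =
      pairing (bilinear_op \<sigma>1 (packet d y \<zeta>) (packet b y \<eta>)) (packet a y \<theta>)"
      using assms(6) unfolding is_transpose1_def by blast
  qed
  \<comment> \<open>The second transpose is the first transpose for the symbols with \<xi> and
    \<eta> exchanged; the class \<open>BS\<close> is invariant under the exchange, and the terms of
    the two expansions correspond.\<close>
  have 2: "(\<lambda>x \<xi> \<eta>. \<sigma>2 x \<xi> \<eta> - (\<Sum>\<alpha> | mi_abs \<alpha> < N. transpose2_term \<sigma> \<alpha> x \<xi> \<eta>)) \<in> BS (m + (\<delta> - \<rho>) * real N) \<rho> \<delta>" for N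
  proof -
    have "(\<lambda>x \<xi> \<eta>. \<sigma>2 x \<eta> \<xi> - (\<Sum>\<alpha> | mi_abs \<alpha> < N. transpose1_term (\<lambda>x \<xi> \<eta>. \<sigma> x \<eta> \<xi>) \<alpha> x \<xi> \<eta>)) \<in> BS (m + (\<delta> - \<rho>) * real N) \<rho> \<delta>"
    proof (rule transpose1_remainder[OF assms(1-3) BS_swap[OF assms(4)] BS_swap[OF assms(7)]])
      fix y \<theta> \<eta> \<zeta> :: "real^'n" and a b d :: real
      assume pos: "a > 0" "b > 0" "d > 0"
      then have "packet a y \<theta> \<in> schwartz" "packet b y \<eta> \<in> schwartz" "packet d y \<zeta> \<in> schwartz"
        by (auto intro: packet_schwartz)
      then show "pairing (bilinear_op (\<lambda>x \<xi> \<eta>. \<sigma> x \<eta> \<xi>) (packet a y \<theta>) (packet b y \<eta>)) (packet d y \<zeta>) =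
        pairing (bilinear_op (\<lambda>x \<xi> \<eta>. \<sigma>2 x \<eta> \<xi>) (packet d y \<zeta>) (packet b y \<eta>)) (packet a y \<theta>)"
        unfolding bilinear_op_packets_swap[OF assms(4) pos(2,1)] bilinear_op_packets_swap[OF assms(7) pos(2,3)]
        using assms(8) unfolding is_transpose2_def by blast
    qed
    moreover have "transpose1_term (\<lambda>x \<xi> \<eta>. \<sigma> x \<eta> \<xi>) \<alpha> x \<eta> \<xi> = transpose2_term \<sigma> \<alpha> x \<xi> \<eta>" for \<alpha> x \<xi> \<eta>
    proof -
      have c: "- \<eta> - \<xi> = - \<xi> - \<eta>" by simp
      show ?thesis unfolding transpose1_term_def transpose2_term_def deriv_x_def deriv_xi_def deriv_eta_def c ..
    qed
    ultimately show ?thesis using BS_swap by fastforce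
  qed
  have "asymptotic_expansion \<rho> \<delta> \<sigma>1 (\<lambda>j x \<xi> \<eta>. \<Sum>\<alpha> | mi_abs \<alpha> = j. transpose1_term \<sigma> \<alpha> x \<xi> \<eta>)"
    by (rule asymptotic_expansionI[OF assms(2) 1[unfolded sum_mi_abs_less]])
  moreover have "asymptotic_expansion \<rho> \<delta> \<sigma>2 (\<lambda>j x \<xi> \<eta>. \<Sum>\<alpha> | mi_abs \<alpha> = j. transpose2_term \<sigma> \<alpha> x \<xi> \<eta>)"
    by (rule asymptotic_expansionI[OF assms(2) 2[unfolded sum_mi_abs_less]])
  ultimately show ?thesis using 1 2 by blast
qed

end
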